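(* Let $X$ and $Y$ be operator spaces with fixed noncommutative Shilov boundaries $\partial X$ and $\partial Y$ which are right $C^*$-modules over the same $C^*$-algebra $B$; regard $X\subset\partial X$ and $Y\subset\partial Y$. Let $T:X\to Y$ be a map. The following are equivalent: (i) $T$ is the restriction to $X$ of an adjointable (in the usual $C^*$-module sense) $B$-module map $R:\partial X\to\partial Y$ such that $R(X)\subset Y$ and $R^*(Y)\subset X$. (ii) There exists a map $S:Y\to X$ such that $\langle T(x)\,|\,y\rangle=\langle x\,|\,S(y)\rangle$ (Shilov inner products) for all $x\in X$, $y\in Y$. Moreover, the set $\mathcal{A}_l(X,Y)$ consisting of the maps $T$ satisfying condition (ii) is a closed subspace of $B(X,Y)$ (the bounded linear maps from $X$ to $Y$), and it is a $C^*$-bimodule over the algebras $\mathcal{A}_l(X)$ and $\mathcal{A}_l(Y)$. The module actions on $\mathcal{A}_l(X,Y)$ are simply composition of operators. The $\mathcal{A}_l(X)$-valued inner product on $\mathcal{A}_l(X,Y)$ is $\langle T\,|\,R\rangle=SR$ for $T,R\in\mathcal{A}_l(X,Y)$, where $S$ is related to $T$ as in (ii).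
   Context: A right $C^*$-module $Z$ over a $C^*$-algebra $B$ is a (not necessarily full) right Hilbert $C^*$-module, with $B$-valued inner product $\langle\cdot|\cdot\rangle$ linear in the second variable. It carries its canonical operator space structure $\|[z_{ij}]\|=\|[\sum_k\langle z_{ki}|z_{kj}\rangle]\|^{1/2}$. A ternary morphism between $C^*$-modules is a linear map $\theta$ with $\theta(x\langle y|z\rangle)=\theta(x)\langle\theta(y)|\theta(z)\rangle$. Noncommutative Shilov boundary: for an operator space $X$ this is a pair $(\partial X,i)$, where $\partial X$ is a right $C^*$-module over some $C^*$-algebra and $i:X\to\partial X$ is a linear complete isometry, such that $\partial X$ is the smallest closed subspace $E$ of itself containing $i(X)$ with $x\langle y|z\rangle\in E$ for all $x,y,z\in E$, and with the universal property: for every right $C^*$-module $Z$ and linear complete isometry $k:X\to Z$ such that $Z$ is generated by $k(X)$ in the same sense, there is a (necessarily unique and surjective) ternary morphism $\theta:Z\to\partial X$ with $\theta\circ k=i$. The Shilov inner product on $X$ is the restriction to $X$ (via $i$) of the $B$-valued inner product of $\partial X$; similarly for $Y$. $\mathcal{A}_l(X)=\mathcal{A}_l(X,X)$ is the set of maps $T:X\to X$ for which there is a map $S:X\to X$ with $\langle T(x)|y\rangle=\langle x|S(y)\rangle$ for all $x,y\in X$. It is known to be a $C^*$-algebra, with composition as product, involution $T^*=S$ and the norm of $B(X)$. $\mathcal{A}_l(Y)$ is defined likewise. A $C^*$-bimodule over $\mathcal{A}_l(X)$ and $\mathcal{A}_l(Y)$ means an $\mathcal{A}_l(Y)$-$\mathcal{A}_l(X)$-bimodule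 that is a right $C^*$-module over $\mathcal{A}_l(X)$ and a left $C^*$-module over $\mathcal{A}_l(Y)$, with inner products compatible in the usual way ($[T|R]\,Q=T\langle R|Q\rangle$, where $[\cdot|\cdot]$ is the left inner product), the norm being that of $B(X,Y)$. *)

theory Defs
  imports "HOL-Analysis.Abstract_Metric_Spaces" "HOL-Algebra.Module"
begin

section \<open>Complex normed spaces with explicit carriers\<close>

text \<open>
  Complex vector spaces are modules over the field of complex numbers in the sense of HOL-Algebra.
  The fields \<^const>\<open>mult\<close> and \<^const>\<open>one\<close>, which the record type \<open>module\<close> inherits from \<open>ring\<close>,
  carry no meaning for a vector space; a (not necessarily unital) C*-algebra uses \<^const>\<open>mult\<close> only.
\<close>

definition complex_ring :: "complex ring" where
  "complex_ring = \<lparr>carrier = UNIV, mult = (*), one = 1, zero = 0, add = (+)\<rparr>"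

abbreviation complex_vspace :: "(complex, 'a, 'm) module_scheme \<Rightarrow> bool" where
  "complex_vspace V \<equiv> Module.module complex_ring V"

abbreviation linear_subspace :: "'a set \<Rightarrow> (complex, 'a, 'm) module_scheme \<Rightarrow> bool" where
  "linear_subspace E V \<equiv> submodule E complex_ring V"

definition linear_map ::
  "(complex, 'a, 'm) module_scheme \<Rightarrow> (complex, 'c, 'k) module_scheme \<Rightarrow> ('a \<Rightarrow> 'c) \<Rightarrow> bool" where
  "linear_map V W f \<longleftrightarrow> f \<in> carrier V \<rightarrow> carrier W
     \<and> (\<forall>x\<in>carrier V. \<forall>y\<in>carrier V. f (x \<oplus>\<^bsub>V\<^esub> y) = f x \<oplus>\<^bsub>W\<^esub> f y)
     \<and> (\<forall>c. \<forall>x\<in>carrier V. f (c \<odot>\<^bsub>V\<^esub> x) = c \<odot>\<^bsub>W\<^esub> f x)"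

text \<open>
  \<^locale>\<open>Metric_space\<close> requires symmetry and nonnegativity on the whole type, hence the value 0
  outside the carrier.
\<close>

definition norm_dist :: "(complex, 'a, 'm) module_scheme \<Rightarrow> ('a \<Rightarrow> real) \<Rightarrow> 'a \<Rightarrow> 'a \<Rightarrow> real" where
  "norm_dist V N x y = (if x \<in> carrier V \<and> y \<in> carrier V then N (x \<ominus>\<^bsub>V\<^esub> y) else 0)"

definition norm_topology :: "(complex, 'a, 'm) module_scheme \<Rightarrow> ('a \<Rightarrow> real) \<Rightarrow> 'a topology" where
  "norm_topology V N = Metric_space.mtopology (carrier V) (norm_dist V N)"

locale complex_banach =
  fixes V :: "(complex, 'a, 'm) module_scheme" (structure) and N :: "'a \<Rightarrow> real"
  assumes vspace: "complex_vspace V"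
    and norm_nonneg: "x \<in> carrier V \<Longrightarrow> 0 \<le> N x"
    and norm_eq_zero: "x \<in> carrier V \<Longrightarrow> N x = 0 \<longleftrightarrow> x = \<zero>"
    and norm_smult: "x \<in> carrier V \<Longrightarrow> N (c \<odot> x) = cmod c * N x"
    and norm_triangle: "\<lbrakk>x \<in> carrier V; y \<in> carrier V\<rbrakk> \<Longrightarrow> N (x \<oplus> y) \<le> N x + N y"
    and complete: "Metric_space.mcomplete (carrier V) (norm_dist V N)"

section \<open>C*-algebras and C*-modules\<close>

record 'a cstar = "(complex, 'a) module" +
  star :: "'a \<Rightarrow> 'a"
  nrm :: "'a \<Rightarrow> real"

locale cstar_algebra =
  fixes A :: "'a cstar" (structure)
  assumes banach: "complex_banach A (nrm A)"
    and mult_closed: "\<lbrakk>a \<in> carrier A; b \<in> carrier A\<rbrakk> \<Longrightarrow> a \<otimes> b \<in> carrier A"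
    and mult_assoc: "\<lbrakk>a \<in> carrier A; b \<in> carrier A; c \<in> carrier A\<rbrakk> \<Longrightarrow> (a \<otimes> b) \<otimes> c = a \<otimes> (b \<otimes> c)"
    and distr_left: "\<lbrakk>a \<in> carrier A; b \<in> carrier A; c \<in> carrier A\<rbrakk> \<Longrightarrow> (a \<oplus> b) \<otimes> c = a \<otimes> c \<oplus> b \<otimes> c"
    and distr_right: "\<lbrakk>a \<in> carrier A; b \<in> carrier A; c \<in> carrier A\<rbrakk> \<Longrightarrow> a \<otimes> (b \<oplus> c) = a \<otimes> b \<oplus> a \<otimes> c"
    and smult_mult_left: "\<lbrakk>a \<in> carrier A; b \<in> carrier A\<rbrakk> \<Longrightarrow> (z \<odot> a) \<otimes> b = z \<odot> (a \<otimes> b)"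
    and smult_mult_right: "\<lbrakk>a \<in> carrier A; b \<in> carrier A\<rbrakk> \<Longrightarrow> a \<otimes> (z \<odot> b) = z \<odot> (a \<otimes> b)"
    and star_closed: "a \<in> carrier A \<Longrightarrow> star A a \<in> carrier A"
    and star_star: "a \<in> carrier A \<Longrightarrow> star A (star A a) = a"
    and star_add: "\<lbrakk>a \<in> carrier A; b \<in> carrier A\<rbrakk> \<Longrightarrow> star A (a \<oplus> b) = star A a \<oplus> star A b"
    and star_smult: "a \<in> carrier A \<Longrightarrow> star A (z \<odot> a) = cnj z \<odot> star A a"
    and star_mult: "\<lbrakk>a \<in> carrier A; b \<in> carrier A\<rbrakk> \<Longrightarrow> star A (a \<otimes> b) = star A b \<otimes> star A a"
    and norm_mult: "\<lbrakk>a \<in> carrier A; b \<in> carrier A\<rbrakk> \<Longrightarrow> nrm A (a \<otimes> b) \<le> nrm A a * nrm A b"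
    and cstar_identity: "a \<in> carrier A \<Longrightarrow> nrm A (star A a \<otimes> a) = (nrm A a)\<^sup>2"

definition cstar_positive :: "'a cstar \<Rightarrow> 'a \<Rightarrow> bool" where
  "cstar_positive A a \<longleftrightarrow> (\<exists>b\<in>carrier A. a = star A b \<otimes>\<^bsub>A\<^esub> b)"

record ('b, 'z) cmodule = "(complex, 'z) module" +
  ract :: "'z \<Rightarrow> 'b \<Rightarrow> 'z"
  rip :: "'z \<Rightarrow> 'z \<Rightarrow> 'b"

definition cmod_norm :: "'b cstar \<Rightarrow> ('b, 'z, 'm) cmodule_scheme \<Rightarrow> 'z \<Rightarrow> real" where
  "cmod_norm B Z z = sqrt (nrm B (rip Z z z))"

locale right_cstar_module =
  fixes B :: "'b cstar" and Z :: "('b, 'z, 'm) cmodule_scheme"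
  assumes cstar_algebra: "cstar_algebra B"
    and banach: "complex_banach Z (cmod_norm B Z)"
    and act_closed: "\<lbrakk>z \<in> carrier Z; b \<in> carrier B\<rbrakk> \<Longrightarrow> ract Z z b \<in> carrier Z"
    and act_mult: "\<lbrakk>z \<in> carrier Z; b \<in> carrier B; c \<in> carrier B\<rbrakk>
        \<Longrightarrow> ract Z z (b \<otimes>\<^bsub>B\<^esub> c) = ract Z (ract Z z b) c"
    and act_add_left: "\<lbrakk>z \<in> carrier Z; w \<in> carrier Z; b \<in> carrier B\<rbrakk>
        \<Longrightarrow> ract Z (z \<oplus>\<^bsub>Z\<^esub> w) b = ract Z z b \<oplus>\<^bsub>Z\<^esub> ract Z w b"
    and act_add_right: "\<lbrakk>z \<in> carrier Z; b \<in> carrier B; c \<in> carrier B\<rbrakk>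
        \<Longrightarrow> ract Z z (b \<oplus>\<^bsub>B\<^esub> c) = ract Z z b \<oplus>\<^bsub>Z\<^esub> ract Z z c"
    and act_smult_left: "\<lbrakk>z \<in> carrier Z; b \<in> carrier B\<rbrakk>
        \<Longrightarrow> ract Z (u \<odot>\<^bsub>Z\<^esub> z) b = u \<odot>\<^bsub>Z\<^esub> ract Z z b"
    and act_smult_right: "\<lbrakk>z \<in> carrier Z; b \<in> carrier B\<rbrakk>
        \<Longrightarrow> ract Z z (u \<odot>\<^bsub>B\<^esub> b) = u \<odot>\<^bsub>Z\<^esub> ract Z z b"
    and ip_closed: "\<lbrakk>z \<in> carrier Z; w \<in> carrier Z\<rbrakk> \<Longrightarrow> rip Z z w \<in> carrier B"
    and ip_add: "\<lbrakk>z \<in> carrier Z; w \<in> carrier Z; v \<in> carrier Z\<rbrakk>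
        \<Longrightarrow> rip Z z (w \<oplus>\<^bsub>Z\<^esub> v) = rip Z z w \<oplus>\<^bsub>B\<^esub> rip Z z v"
    and ip_smult: "\<lbrakk>z \<in> carrier Z; w \<in> carrier Z\<rbrakk> \<Longrightarrow> rip Z z (u \<odot>\<^bsub>Z\<^esub> w) = u \<odot>\<^bsub>B\<^esub> rip Z z w"
    and ip_act: "\<lbrakk>z \<in> carrier Z; w \<in> carrier Z; b \<in> carrier B\<rbrakk>
        \<Longrightarrow> rip Z z (ract Z w b) = rip Z z w \<otimes>\<^bsub>B\<^esub> b"
    and ip_star: "\<lbrakk>z \<in> carrier Z; w \<in> carrier Z\<rbrakk> \<Longrightarrow> star B (rip Z z w) = rip Z w z"
    and ip_positive: "z \<in> carrier Z \<Longrightarrow> cstar_positive B (rip Z z z)"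
    and ip_definite: "\<lbrakk>z \<in> carrier Z; rip Z z z = \<zero>\<^bsub>B\<^esub>\<rbrakk> \<Longrightarrow> z = \<zero>\<^bsub>Z\<^esub>"

record ('a, 'b, 'z) cbimodule = "('b, 'z) cmodule" +
  lact :: "'a \<Rightarrow> 'z \<Rightarrow> 'z"
  lip :: "'z \<Rightarrow> 'z \<Rightarrow> 'a"

locale left_cstar_module =
  fixes A :: "'a cstar" and Z :: "('a, 'b, 'z) cbimodule"
  assumes cstar_algebra: "cstar_algebra A"
    and banach: "complex_banach Z (\<lambda>z. sqrt (nrm A (lip Z z z)))"
    and act_closed: "\<lbrakk>a \<in> carrier A; z \<in> carrier Z\<rbrakk> \<Longrightarrow> lact Z a z \<in> carrier Z"
    and act_mult: "\<lbrakk>a \<in> carrier A; c \<in> carrier A; z \<in> carrier Z\<rbrakk>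
        \<Longrightarrow> lact Z (a \<otimes>\<^bsub>A\<^esub> c) z = lact Z a (lact Z c z)"
    and act_add_left: "\<lbrakk>a \<in> carrier A; c \<in> carrier A; z \<in> carrier Z\<rbrakk>
        \<Longrightarrow> lact Z (a \<oplus>\<^bsub>A\<^esub> c) z = lact Z a z \<oplus>\<^bsub>Z\<^esub> lact Z c z"
    and act_add_right: "\<lbrakk>a \<in> carrier A; z \<in> carrier Z; w \<in> carrier Z\<rbrakk>
        \<Longrightarrow> lact Z a (z \<oplus>\<^bsub>Z\<^esub> w) = lact Z a z \<oplus>\<^bsub>Z\<^esub> lact Z a w"
    and act_smult_left: "\<lbrakk>a \<in> carrier A; z \<in> carrier Z\<rbrakk>
        \<Longrightarrow> lact Z (u \<odot>\<^bsub>A\<^esub> a) z = u \<odot>\<^bsub>Z\<^esub> lact Z a z"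
    and act_smult_right: "\<lbrakk>a \<in> carrier A; z \<in> carrier Z\<rbrakk>
        \<Longrightarrow> lact Z a (u \<odot>\<^bsub>Z\<^esub> z) = u \<odot>\<^bsub>Z\<^esub> lact Z a z"
    and ip_closed: "\<lbrakk>z \<in> carrier Z; w \<in> carrier Z\<rbrakk> \<Longrightarrow> lip Z z w \<in> carrier A"
    and ip_add: "\<lbrakk>z \<in> carrier Z; w \<in> carrier Z; v \<in> carrier Z\<rbrakk>
        \<Longrightarrow> lip Z (z \<oplus>\<^bsub>Z\<^esub> w) v = lip Z z v \<oplus>\<^bsub>A\<^esub> lip Z w v"
    and ip_smult: "\<lbrakk>z \<in> carrier Z; w \<in> carrier Z\<rbrakk> \<Longrightarrow> lip Z (u \<odot>\<^bsub>Z\<^esub> z) w = u \<odot>\<^bsub>A\<^esub> lip Z z w"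
    and ip_act: "\<lbrakk>a \<in> carrier A; z \<in> carrier Z; w \<in> carrier Z\<rbrakk>
        \<Longrightarrow> lip Z (lact Z a z) w = a \<otimes>\<^bsub>A\<^esub> lip Z z w"
    and ip_star: "\<lbrakk>z \<in> carrier Z; w \<in> carrier Z\<rbrakk> \<Longrightarrow> star A (lip Z z w) = lip Z w z"
    and ip_positive: "z \<in> carrier Z \<Longrightarrow> cstar_positive A (lip Z z z)"
    and ip_definite: "\<lbrakk>z \<in> carrier Z; lip Z z z = \<zero>\<^bsub>A\<^esub>\<rbrakk> \<Longrightarrow> z = \<zero>\<^bsub>Z\<^esub>"

text \<open>An \<open>A\<close>-\<open>B\<close>-bimodule whose two C*-module norms both coincide with the given norm \<open>N\<close>.\<close>

locale cstar_bimodule =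
  fixes A :: "'a cstar" and B :: "'b cstar" and Z :: "('a, 'b, 'z) cbimodule" and N :: "'z \<Rightarrow> real"
  assumes left: "left_cstar_module A Z"
    and right: "right_cstar_module B Z"
    and act_commute: "\<lbrakk>a \<in> carrier A; z \<in> carrier Z; b \<in> carrier B\<rbrakk>
        \<Longrightarrow> ract Z (lact Z a z) b = lact Z a (ract Z z b)"
    and ip_compatible: "\<lbrakk>z \<in> carrier Z; w \<in> carrier Z; v \<in> carrier Z\<rbrakk>
        \<Longrightarrow> lact Z (lip Z z w) v = ract Z z (rip Z w v)"
    and norm_right: "z \<in> carrier Z \<Longrightarrow> cmod_norm B Z z = N z"
    and norm_left: "z \<in> carrier Z \<Longrightarrow> sqrt (nrm A (lip Z z z)) = N z"

definition bmodule_map ::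
  "'b cstar \<Rightarrow> ('b, 'p) cmodule \<Rightarrow> ('b, 'q) cmodule \<Rightarrow> ('p \<Rightarrow> 'q) \<Rightarrow> bool" where
  "bmodule_map B P Q R \<longleftrightarrow> linear_map P Q R
     \<and> (\<forall>p\<in>carrier P. \<forall>b\<in>carrier B. R (ract P p b) = ract Q (R p) b)"

definition adjoint_maps ::
  "('b, 'p) cmodule \<Rightarrow> ('b, 'q) cmodule \<Rightarrow> ('p \<Rightarrow> 'q) \<Rightarrow> ('q \<Rightarrow> 'p) \<Rightarrow> bool" where
  "adjoint_maps P Q R R' \<longleftrightarrow> R \<in> carrier P \<rightarrow> carrier Q \<and> R' \<in> carrier Q \<rightarrow> carrier P
     \<and> (\<forall>p\<in>carrier P. \<forall>q\<in>carrier Q. rip Q (R p) q = rip P p (R' q))"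

definition ternary_morphism ::
  "('d, 'z) cmodule \<Rightarrow> ('b, 'p) cmodule \<Rightarrow> ('z \<Rightarrow> 'p) \<Rightarrow> bool" where
  "ternary_morphism Z P \<theta> \<longleftrightarrow> linear_map Z P \<theta>
     \<and> (\<forall>x\<in>carrier Z. \<forall>y\<in>carrier Z. \<forall>z\<in>carrier Z.
          \<theta> (ract Z x (rip Z y z)) = ract P (\<theta> x) (rip P (\<theta> y) (\<theta> z)))"

definition generated_by :: "'b cstar \<Rightarrow> ('b, 'z) cmodule \<Rightarrow> 'z set \<Rightarrow> bool" where
  "generated_by B Z G \<longleftrightarrow>
     (\<forall>E. linear_subspace E Z \<longrightarrow> closedin (norm_topology Z (cmod_norm B Z)) E \<longrightarrow> G \<subseteq> E \<longrightarrow>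
          (\<forall>x\<in>E. \<forall>y\<in>E. \<forall>z\<in>E. ract Z x (rip Z y z) \<in> E) \<longrightarrow> E = carrier Z)"

section \<open>Operator spaces\<close>

text \<open>
  An \<open>n \<times> n\<close> matrix is a function of two indices, of which only the values at indices below \<open>n\<close> matter.
  The norm of \<open>M\<^sub>n(B)\<close> for a C*-algebra \<open>B\<close> is the operator norm of the faithful representation
  of \<open>M\<^sub>n(B)\<close> by left multiplication on the right C*-module of columns \<open>B\<^sup>n\<close>, whose
  norm is \<open>column_norm\<close>; this is the C*-norm of \<open>M\<^sub>n(B)\<close>.
\<close>

definition matrices :: "(complex, 'a, 'm) module_scheme \<Rightarrow> nat \<Rightarrow> (nat \<Rightarrow> nat \<Rightarrow> 'a) set" where
  "matrices V n = {v. \<forall>i<n. \<forall>j<n. v i j \<in> carrier V}"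

definition column_norm :: "'b cstar \<Rightarrow> nat \<Rightarrow> (nat \<Rightarrow> 'b) \<Rightarrow> real" where
  "column_norm B n v = sqrt (nrm B (\<Oplus>\<^bsub>B\<^esub>i\<in>{..<n}. star B (v i) \<otimes>\<^bsub>B\<^esub> v i))"

definition cstar_matrix_norm :: "'b cstar \<Rightarrow> nat \<Rightarrow> (nat \<Rightarrow> nat \<Rightarrow> 'b) \<Rightarrow> real" where
  "cstar_matrix_norm B n b =
     Sup {column_norm B n (\<lambda>i. \<Oplus>\<^bsub>B\<^esub>j\<in>{..<n}. b i j \<otimes>\<^bsub>B\<^esub> v j) | v.
           v \<in> {..<n} \<rightarrow> carrier B \<and> column_norm B n v \<le> 1}"

definition cmod_matrix_norm ::
  "'b cstar \<Rightarrow> ('b, 'z) cmodule \<Rightarrow> nat \<Rightarrow> (nat \<Rightarrow> nat \<Rightarrow> 'z) \<Rightarrow> real" where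
  "cmod_matrix_norm B Z n z =
     sqrt (cstar_matrix_norm B n (\<lambda>i j. \<Oplus>\<^bsub>B\<^esub>k\<in>{..<n}. rip Z (z k i) (z k j)))"

text \<open>Operator norm of a scalar \<open>n \<times> m\<close> matrix between the Hilbert spaces of dimensions \<open>m\<close> and \<open>n\<close>.\<close>

definition scalar_matrix_norm :: "nat \<Rightarrow> nat \<Rightarrow> (nat \<Rightarrow> nat \<Rightarrow> complex) \<Rightarrow> real" where
  "scalar_matrix_norm n m \<alpha> =
     Sup {sqrt (\<Sum>i<n. (cmod (\<Sum>k<m. \<alpha> i k * \<xi> k))\<^sup>2) | \<xi>. (\<Sum>k<m. (cmod (\<xi> k))\<^sup>2) \<le> 1}"

record 'x opspace = "(complex, 'x) module" +
  mnorm :: "nat \<Rightarrow> (nat \<Rightarrow> nat \<Rightarrow> 'x) \<Rightarrow> real"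

definition op_norm :: "'x opspace \<Rightarrow> 'x \<Rightarrow> real" where
  "op_norm X x = mnorm X 1 (\<lambda>_ _. x)"

text \<open>
  Operator spaces are given abstractly by Ruan's axioms; as usual they are norm complete, i.e.
  up to complete isometry they are the closed subspaces of the algebras of operators on Hilbert spaces.
\<close>

locale operator_space =
  fixes X :: "'x opspace" (structure)
  assumes banach: "complex_banach X (op_norm X)"
    and mnorm_cong: "\<lbrakk>0 < n; v \<in> matrices X n; \<And>i j. \<lbrakk>i < n; j < n\<rbrakk> \<Longrightarrow> v i j = w i j\<rbrakk>
        \<Longrightarrow> mnorm X n v = mnorm X n w"
    and mnorm_nonneg: "\<lbrakk>0 < n; v \<in> matrices X n\<rbrakk> \<Longrightarrow> 0 \<le> mnorm X n v"
    and mnorm_eq_zero: "\<lbrakk>0 < n; v \<in> matrices X n\<rbrakk>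
        \<Longrightarrow> mnorm X n v = 0 \<longleftrightarrow> (\<forall>i<n. \<forall>j<n. v i j = \<zero>)"
    and mnorm_smult: "\<lbrakk>0 < n; v \<in> matrices X n\<rbrakk>
        \<Longrightarrow> mnorm X n (\<lambda>i j. c \<odot> v i j) = cmod c * mnorm X n v"
    and mnorm_triangle: "\<lbrakk>0 < n; v \<in> matrices X n; w \<in> matrices X n\<rbrakk>
        \<Longrightarrow> mnorm X n (\<lambda>i j. v i j \<oplus> w i j) \<le> mnorm X n v + mnorm X n w"
    and mnorm_direct_sum: "\<lbrakk>0 < m; 0 < n; v \<in> matrices X m; w \<in> matrices X n\<rbrakk>
        \<Longrightarrow> mnorm X (m + n) (\<lambda>i j. if i < m \<and> j < m then v i j
                                  else if m \<le> i \<and> m \<le> j then w (i - m) (j - m) else \<zero>)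
            = max (mnorm X m v) (mnorm X n w)"
    and mnorm_scalar_matrices: "\<lbrakk>0 < m; 0 < n; v \<in> matrices X m\<rbrakk>
        \<Longrightarrow> mnorm X n (\<lambda>i j. \<Oplus>k\<in>{..<m}. \<Oplus>l\<in>{..<m}. (\<alpha> i k * \<beta> l j) \<odot> v k l)
            \<le> scalar_matrix_norm n m \<alpha> * mnorm X m v * scalar_matrix_norm m n \<beta>"

definition complete_isometry ::
  "'x opspace \<Rightarrow> 'b cstar \<Rightarrow> ('b, 'z) cmodule \<Rightarrow> ('x \<Rightarrow> 'z) \<Rightarrow> bool" where
  "complete_isometry X B Z k \<longleftrightarrow> linear_map X Z k
     \<and> (\<forall>n>0. \<forall>v\<in>matrices X n. cmod_matrix_norm B Z n (\<lambda>i j. k (v i j)) = mnorm X n v)"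

text \<open>
  HOL cannot quantify over types inside a formula, so the competitors \<open>Z\<close> in the universal property and
  their coefficient algebras \<open>D\<close> have carriers in the type \<^typ>\<open>nat \<Rightarrow> 'x\<close>. Up to isomorphism this is
  no restriction: if \<open>Z\<close> is generated by the image of \<open>X\<close>, then \<open>Z\<close>, and the closed ideal
  of \<open>D\<close> spanned by the inner products of \<open>Z\<close> (over which \<open>Z\<close> is again a C*-module with the same inner
  product, matrix norms and ternary product), have at most as many elements as there are
  sequences in \<open>X\<close>.
\<close>

locale shilov_boundary =
  fixes X :: "'x opspace" and B :: "'b cstar" and P :: "('b, 'p) cmodule" and i :: "'x \<Rightarrow> 'p"
  assumes operator_space: "operator_space X"
    and cmodule: "right_cstar_module B P"
    and embedding: "complete_isometry X B P i"
    and generated: "generated_by B P (i ` carrier X)"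
    and universal: "\<And>(D :: (nat \<Rightarrow> 'x) cstar) (Z :: (nat \<Rightarrow> 'x, nat \<Rightarrow> 'x) cmodule) k.
        \<lbrakk>right_cstar_module D Z; complete_isometry X D Z k; generated_by D Z (k ` carrier X)\<rbrakk>
        \<Longrightarrow> \<exists>\<theta>. ternary_morphism Z P \<theta> \<and> (\<forall>x\<in>carrier X. \<theta> (k x) = i x)"

section \<open>Bounded and adjointable maps between operator spaces\<close>

text \<open>Elements of function spaces are extensional, so that equality is equality on the carrier.\<close>

definition bop_norm :: "'x opspace \<Rightarrow> 'y opspace \<Rightarrow> ('x \<Rightarrow> 'y) \<Rightarrow> real" where
  "bop_norm X Y T = Sup {op_norm Y (T x) | x. x \<in> carrier X \<and> op_norm X x \<le> 1}"

definition bounded_ops :: "'x opspace \<Rightarrow> 'y opspace \<Rightarrow> (complex, 'x \<Rightarrow> 'y) module" where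
  "bounded_ops X Y =
     \<lparr>carrier = {T \<in> carrier X \<rightarrow>\<^sub>E carrier Y. linear_map X Y T
                  \<and> (\<exists>K. \<forall>x\<in>carrier X. op_norm Y (T x) \<le> K * op_norm X x)},
      mult = undefined, one = undefined,
      zero = (\<lambda>x\<in>carrier X. \<zero>\<^bsub>Y\<^esub>),
      add = (\<lambda>T R. \<lambda>x\<in>carrier X. T x \<oplus>\<^bsub>Y\<^esub> R x),
      smult = (\<lambda>c T. \<lambda>x\<in>carrier X. c \<odot>\<^bsub>Y\<^esub> T x)\<rparr>"

text \<open>
  The Shilov inner product of \<open>x, x' \<in> X\<close> is \<open>rip P (i x) (i x')\<close>, where \<open>(P, i)\<close> is the fixed
  Shilov boundary of \<open>X\<close>; similarly for \<open>Y\<close> with \<open>(Q, j)\<close>.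
\<close>

definition shilov_adjoint ::
  "'x opspace \<Rightarrow> ('b, 'p) cmodule \<Rightarrow> ('x \<Rightarrow> 'p) \<Rightarrow> 'y opspace \<Rightarrow> ('b, 'q) cmodule \<Rightarrow> ('y \<Rightarrow> 'q)
     \<Rightarrow> ('x \<Rightarrow> 'y) \<Rightarrow> ('y \<Rightarrow> 'x) \<Rightarrow> bool" where
  "shilov_adjoint X P i Y Q j T S \<longleftrightarrow>
     (\<forall>x\<in>carrier X. \<forall>y\<in>carrier Y. rip Q (j (T x)) (j y) = rip P (i x) (i (S y)))"

definition Al ::
  "'x opspace \<Rightarrow> ('b, 'p) cmodule \<Rightarrow> ('x \<Rightarrow> 'p) \<Rightarrow> 'y opspace \<Rightarrow> ('b, 'q) cmodule \<Rightarrow> ('y \<Rightarrow> 'q)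
     \<Rightarrow> ('x \<Rightarrow> 'y) set" where
  "Al X P i Y Q j =
     {T \<in> carrier X \<rightarrow>\<^sub>E carrier Y. \<exists>S \<in> carrier Y \<rightarrow> carrier X. shilov_adjoint X P i Y Q j T S}"

text \<open>\<open>S\<close> is unique because the Shilov inner product separates the points of \<open>X\<close>.\<close>

definition Al_adj ::
  "'x opspace \<Rightarrow> ('b, 'p) cmodule \<Rightarrow> ('x \<Rightarrow> 'p) \<Rightarrow> 'y opspace \<Rightarrow> ('b, 'q) cmodule \<Rightarrow> ('y \<Rightarrow> 'q)
     \<Rightarrow> ('x \<Rightarrow> 'y) \<Rightarrow> ('y \<Rightarrow> 'x)" where
  "Al_adj X P i Y Q j T =
     (THE S. S \<in> carrier Y \<rightarrow>\<^sub>E carrier X \<and> shilov_adjoint X P i Y Q j T S)"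

definition Al_algebra ::
  "'x opspace \<Rightarrow> ('b, 'p) cmodule \<Rightarrow> ('x \<Rightarrow> 'p) \<Rightarrow> ('x \<Rightarrow> 'x) cstar" where
  "Al_algebra X P i =
     \<lparr>carrier = Al X P i X P i,
      mult = compose (carrier X), one = (\<lambda>x\<in>carrier X. x),
      zero = \<zero>\<^bsub>bounded_ops X X\<^esub>, add = add (bounded_ops X X), smult = smult (bounded_ops X X),
      star = Al_adj X P i X P i, nrm = bop_norm X X\<rparr>"

definition Al_bimodule ::
  "'x opspace \<Rightarrow> ('b, 'p) cmodule \<Rightarrow> ('x \<Rightarrow> 'p) \<Rightarrow> 'y opspace \<Rightarrow> ('b, 'q) cmodule \<Rightarrow> ('y \<Rightarrow> 'q)
     \<Rightarrow> ('y \<Rightarrow> 'y, 'x \<Rightarrow> 'x, 'x \<Rightarrow> 'y) cbimodule" where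
  "Al_bimodule X P i Y Q j =
     \<lparr>carrier = Al X P i Y Q j,
      mult = undefined, one = undefined,
      zero = \<zero>\<^bsub>bounded_ops X Y\<^esub>, add = add (bounded_ops X Y), smult = smult (bounded_ops X Y),
      ract = (\<lambda>T V. compose (carrier X) T V),
      rip = (\<lambda>T R. compose (carrier X) (Al_adj X P i Y Q j T) R),
      lact = (\<lambda>V T. compose (carrier X) V T),
      lip = (\<lambda>T R. compose (carrier Y) T (Al_adj X P i Y Q j R))\<rparr>"

end

theory Submission
  imports Defs "HOL-Analysis.Urysohn"
begin

text \<open>
  Write \<open>\<langle>x | y\<rangle>\<close> for the Shilov inner product. The space \<open>X\<close> with this \<open>B\<close>-valued inner product behaves like a
  Hilbert space: the norm is given by \<open>\<parallel>x\<parallel>\<^sup>2 = \<parallel>\<langle>x | x\<rangle>\<parallel>\<close>, and the Cauchy-Schwarz inequality holds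
  (\<open>Cauchy_Schwarz\<close>). Hence a map \<open>T\<close> that has an adjoint \<open>S\<close> is linear, bounded by Baire's theorem (\<open>adj_bounded\<close>),
  and \<open>\<parallel>S T\<parallel> = \<parallel>T\<parallel>\<^sup>2\<close> (\<open>adj_cstar_identity\<close>). So \<open>A\<^sub>l(X)\<close> is a unital C*-algebra, and \<open>A\<^sub>l(X, Y)\<close> is
  complete, because along a Cauchy sequence the adjoints converge too (\<open>Al_complete\<close>).

  Two facts depend on positivity in C*-algebras: the Cauchy-Schwarz inequality with constant one, and the existence
  of \<open>V\<close> in \<open>A\<^sub>l(X)\<close> with \<open>S T = V\<^sup>* V\<close>. In a unital C*-algebra call a self-adjoint \<open>p\<close> positive if \<open>\<parallel>t - p\<parallel> \<le> t\<close> for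
  some \<open>t\<close>. An iteration gives positive elements square roots (\<open>pos_sqrt\<close>). If \<open>h\<close> and \<open>v\<close> are self-adjoint and commute
  and \<open>h\<^sup>2 + v\<^sup>2 = t\<close>, then \<open>h + \<i> v\<close> is a multiple of a unitary, so \<open>\<parallel>h\<parallel>\<^sup>2 \<le> t\<close>. From these two facts follow the monotonicity of
  the norm (\<open>norm_pos_mono\<close>) and, by the argument of Kelley and Vaught, the positivity of \<open>a\<^sup>* a\<close>
  (\<open>pos_star_mult_self\<close>). The algebra \<open>B\<close> need not have a unit; its multipliers do, and they are \<open>A\<^sub>l(B)\<close> for
  \<open>B\<close> as an inner product space over itself. Finally, if \<open>v\<^sup>2 = t - S T\<close> with \<open>t = \<parallel>S T\<parallel>\<close>, then
  \<open>\<langle>v x | v x\<rangle> + \<langle>T x | T x\<rangle> = t \<langle>x | x\<rangle>\<close>, and monotonicity in \<open>B\<close> gives \<open>\<parallel>t - S T\<parallel> \<le> t\<close> (\<open>adjoint_mult_positive\<close>).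

  For the implication from (ii) to (i), let \<open>T\<close> have the adjoint \<open>S\<close>. An extension of \<open>T\<close> to \<open>\<partial>X\<close> has to map
  \<open>\<Sum>\<^sub>k x\<^sub>k b\<^sub>k\<close> to \<open>q = \<Sum>\<^sub>k (T x\<^sub>k) b\<^sub>k\<close>. With \<open>s\<^sub>n = \<Sum>\<^sub>k (S T)\<^sup>n x\<^sub>k b\<^sub>k\<close> one finds \<open>\<langle>s\<^sub>n | s\<^sub>m\<rangle> = \<langle>s\<^sub>0 | s\<^sub>n\<^sub>+\<^sub>m\<rangle>\<close> and
  \<open>\<langle>q | q\<rangle> = \<langle>s\<^sub>0 | s\<^sub>1\<rangle>\<close>. The first identity gives \<open>\<parallel>s\<^sub>n\<parallel>\<^sup>2 \<le> \<parallel>s\<^sub>0\<parallel> \<parallel>s\<^sub>2\<^sub>n\<parallel>\<close>. As \<open>\<parallel>s\<^sub>n\<parallel>\<close> grows at most like \<open>K\<^sup>n\<close>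
  for a bound \<open>K > 0\<close> of \<open>S T\<close>, it follows that \<open>\<parallel>s\<^sub>1\<parallel> \<le> K \<parallel>s\<^sub>0\<parallel>\<close> (\<open>orbit_step_bound\<close>). Therefore \<open>\<parallel>q\<parallel>\<^sup>2 \<le> K \<parallel>s\<^sub>0\<parallel>\<^sup>2\<close>, and the
  extension is well defined and bounded on a subspace that is dense, because \<open>X\<close> generates \<open>\<partial>X\<close>. The extensions of \<open>T\<close>
  and of \<open>S\<close> are adjoint to each other by density (\<open>adjointable_extension\<close>).
\<close>

section \<open>Normed spaces with explicit carriers\<close>

lemma complex_ring_simps [simp]:
  "carrier complex_ring = UNIV" "monoid.mult complex_ring = (*)" "one complex_ring = 1"
  "zero complex_ring = 0" "add complex_ring = (+)"
  by (simp_all add: complex_ring_def)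

lemma cring_complex_ring: "cring complex_ring"
proof (rule cringI)
  show "abelian_group complex_ring"
  proof (rule abelian_groupI)
    fix x assume "x \<in> carrier complex_ring"
    show "\<exists>y\<in>carrier complex_ring. y \<oplus>\<^bsub>complex_ring\<^esub> x = \<zero>\<^bsub>complex_ring\<^esub>"
      by (rule bexI[of _ "- x"]) auto
  qed auto
  show "Group.comm_monoid complex_ring"
    by (rule comm_monoidI) auto
qed (auto simp: algebra_simps)

lemma complex_ring_a_inv [simp]: "\<ominus>\<^bsub>complex_ring\<^esub> c = - c"
proof -
  interpret cring complex_ring by (rule cring_complex_ring)
  have "- c \<oplus>\<^bsub>complex_ring\<^esub> c = \<zero>\<^bsub>complex_ring\<^esub>" by simp
  then show ?thesis by (metis UNIV_I complex_ring_simps(1) minus_equality)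
qed

text \<open>
  Norm completeness is separated from the other axioms because the bounded operators between two spaces
  serve below only as a normed space around \<open>A\<^sub>l(X, Y)\<close>, which is complete for a reason of its own.
\<close>
locale complex_normed =
  fixes V :: "(complex, 'a, 'm) module_scheme" (structure) and N :: "'a \<Rightarrow> real"
  assumes vspace: "complex_vspace V"
    and norm_nonneg: "x \<in> carrier V \<Longrightarrow> 0 \<le> N x"
    and norm_eq_zero: "x \<in> carrier V \<Longrightarrow> N x = 0 \<longleftrightarrow> x = \<zero>"
    and norm_smult: "x \<in> carrier V \<Longrightarrow> N (c \<odot> x) = cmod c * N x"
    and norm_triangle: "\<lbrakk>x \<in> carrier V; y \<in> carrier V\<rbrakk> \<Longrightarrow> N (x \<oplus> y) \<le> N x + N y"
begin

sublocale V: Module.module complex_ring V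
  by (rule vspace)

lemma scal_closed [simp, intro]: "x \<in> carrier V \<Longrightarrow> c \<odot> x \<in> carrier V"
  using V.smult_closed by simp

lemma scal_add_left: "x \<in> carrier V \<Longrightarrow> (a + b) \<odot> x = a \<odot> x \<oplus> b \<odot> x"
  using V.smult_l_distr by simp

lemma scal_add_right: "\<lbrakk>x \<in> carrier V; y \<in> carrier V\<rbrakk> \<Longrightarrow> a \<odot> (x \<oplus> y) = a \<odot> x \<oplus> a \<odot> y"
  using V.smult_r_distr by simp

lemma scal_scal [simp]: "x \<in> carrier V \<Longrightarrow> a \<odot> (b \<odot> x) = (a * b) \<odot> x"
  using V.smult_assoc1[of a b x] by simp

lemma scal_one [simp]: "x \<in> carrier V \<Longrightarrow> 1 \<odot> x = x"
  using V.smult_one by simp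

lemma scal_null [simp]: "x \<in> carrier V \<Longrightarrow> 0 \<odot> x = \<zero>"
  using V.smult_l_null by simp

lemma scal_zero [simp]: "c \<odot> \<zero> = \<zero>"
  using V.smult_r_null by simp

lemma scal_minus_left: "x \<in> carrier V \<Longrightarrow> (- c) \<odot> x = \<ominus> (c \<odot> x)"
  using V.smult_l_minus[of c x] by simp

lemma scal_minus_right: "x \<in> carrier V \<Longrightarrow> c \<odot> (\<ominus> x) = \<ominus> (c \<odot> x)"
  using V.smult_r_minus[of c x] by simp

lemma scal_diff_right:
  "\<lbrakk>x \<in> carrier V; y \<in> carrier V\<rbrakk> \<Longrightarrow> a \<odot> (x \<ominus> y) = a \<odot> x \<ominus> a \<odot> y"
  by (simp add: V.minus_eq scal_add_right scal_minus_right)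

lemma minus_scal: "x \<in> carrier V \<Longrightarrow> \<ominus> x = (- 1) \<odot> x"
  by (simp add: scal_minus_left)

lemma diff_scal: "y \<in> carrier V \<Longrightarrow> x \<ominus> y = x \<oplus> (- 1) \<odot> y"
  by (simp add: V.minus_eq minus_scal)

lemma diff_self [simp]: "x \<in> carrier V \<Longrightarrow> x \<ominus> x = \<zero>"
  by (simp add: V.minus_eq V.r_neg)

lemma diff_closed [simp, intro]: "\<lbrakk>x \<in> carrier V; y \<in> carrier V\<rbrakk> \<Longrightarrow> x \<ominus> y \<in> carrier V"
  by (simp add: V.minus_eq)

lemma diff_zero [simp]: "x \<in> carrier V \<Longrightarrow> x \<ominus> \<zero> = x"
  using V.r_zero[of x] by (simp add: diff_scal)

lemma diff_add_diff:
  "\<lbrakk>x \<in> carrier V; y \<in> carrier V; z \<in> carrier V\<rbrakk> \<Longrightarrow> (x \<ominus> y) \<oplus> (y \<ominus> z) = x \<ominus> z"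
  by (simp add: V.minus_eq V.a_ac V.r_neg2 V.r_neg1)

lemma add_diff_add:
  "\<lbrakk>x \<in> carrier V; y \<in> carrier V; z \<in> carrier V; w \<in> carrier V\<rbrakk>
    \<Longrightarrow> (x \<oplus> y) \<ominus> (z \<oplus> w) = (x \<ominus> z) \<oplus> (y \<ominus> w)"
  by (simp add: V.minus_eq V.minus_add V.a_ac)

lemma diff_add_cancel: "\<lbrakk>x \<in> carrier V; y \<in> carrier V\<rbrakk> \<Longrightarrow> (x \<ominus> y) \<oplus> y = x"
  by (simp add: V.minus_eq V.a_ac V.l_neg V.r_neg)

lemma diff_eq_zero_iff: "\<lbrakk>x \<in> carrier V; y \<in> carrier V\<rbrakk> \<Longrightarrow> x \<ominus> y = \<zero> \<longleftrightarrow> x = y"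
  using diff_add_cancel[of x y] by auto

lemma diff_diff_eq:
  "\<lbrakk>x \<in> carrier V; y \<in> carrier V; z \<in> carrier V\<rbrakk> \<Longrightarrow> (x \<ominus> y) \<ominus> (z \<ominus> y) = x \<ominus> z"
  by (simp add: V.minus_eq V.minus_add V.a_ac V.r_neg2 V.r_neg1 V.r_neg V.l_neg)

lemma diff_diff_cancel: "\<lbrakk>x \<in> carrier V; y \<in> carrier V\<rbrakk> \<Longrightarrow> x \<ominus> (x \<ominus> y) = y"
  by (simp add: V.minus_eq V.minus_add V.r_neg2)

lemma diff_eq_diff:
  assumes "x \<in> carrier V" "y \<in> carrier V" "z \<in> carrier V" "w \<in> carrier V" "x \<oplus> y = z \<oplus> w"
  shows "x \<ominus> w = z \<ominus> y"
proof -
  have "(x \<oplus> y) \<ominus> (w \<oplus> y) = (z \<oplus> w) \<ominus> (w \<oplus> y)"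
    using assms(5) by simp
  also have "\<dots> = (w \<oplus> z) \<ominus> (w \<oplus> y)"
    using assms by (simp add: V.a_comm)
  finally show ?thesis
    using assms(1-4) by (simp add: add_diff_add)
qed

lemma diff_add:
  "\<lbrakk>x \<in> carrier V; y \<in> carrier V; z \<in> carrier V\<rbrakk> \<Longrightarrow> x \<ominus> (y \<oplus> z) = (x \<ominus> y) \<ominus> z"
  by (simp add: V.minus_eq V.minus_add V.a_assoc)

lemma add_add_diff:
  assumes "x \<in> carrier V" "y \<in> carrier V"
  shows "(x \<oplus> y) \<oplus> (y \<ominus> x) = 2 \<odot> y"
proof -
  have "(x \<oplus> y) \<oplus> (y \<ominus> x) = (y \<oplus> y) \<oplus> (x \<oplus> \<ominus> x)"
    using assms by (simp add: V.minus_eq V.a_ac)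
  then show ?thesis
    using assms scal_add_left[of y 1 1] by (simp add: V.r_neg)
qed

lemma norm_zero [simp]: "N \<zero> = 0"
  using norm_eq_zero by simp

lemma norm_minus: "x \<in> carrier V \<Longrightarrow> N (\<ominus> x) = N x"
  by (simp add: minus_scal norm_smult)

lemma norm_diff_le: "\<lbrakk>x \<in> carrier V; y \<in> carrier V\<rbrakk> \<Longrightarrow> N (x \<ominus> y) \<le> N x + N y"
  using norm_triangle[of x "\<ominus> y"] by (simp add: V.minus_eq norm_minus)

lemma norm_diff_commute: "\<lbrakk>x \<in> carrier V; y \<in> carrier V\<rbrakk> \<Longrightarrow> N (x \<ominus> y) = N (y \<ominus> x)"
proof -
  assume "x \<in> carrier V" "y \<in> carrier V"
  then have "x \<ominus> y = (- 1) \<odot> (y \<ominus> x)"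
    by (simp add: diff_scal scal_add_right V.a_comm)
  with \<open>x \<in> carrier V\<close> \<open>y \<in> carrier V\<close> show ?thesis by (simp add: norm_smult)
qed

lemma norm_le_diff: "\<lbrakk>x \<in> carrier V; y \<in> carrier V\<rbrakk> \<Longrightarrow> N x \<le> N (x \<ominus> y) + N y"
  using norm_triangle[of "x \<ominus> y" y] by (simp add: diff_add_cancel)

lemma abs_norm_diff: "\<lbrakk>x \<in> carrier V; y \<in> carrier V\<rbrakk> \<Longrightarrow> \<bar>N x - N y\<bar> \<le> N (x \<ominus> y)"
  using norm_le_diff[of x y] norm_le_diff[of y x] norm_diff_commute[of x y] by linarith

lemma norm_diff_triangle:
  "\<lbrakk>x \<in> carrier V; y \<in> carrier V; z \<in> carrier V\<rbrakk> \<Longrightarrow> N (x \<ominus> z) \<le> N (x \<ominus> y) + N (y \<ominus> z)"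
  using norm_triangle[of "x \<ominus> y" "y \<ominus> z"] by (simp add: diff_add_diff)

lemma Metric_space_norm: "Metric_space (carrier V) (norm_dist V N)"
proof
  show "norm_dist V N x y = 0 \<longleftrightarrow> x = y" if "x \<in> carrier V" "y \<in> carrier V" for x y
    using that by (simp add: norm_dist_def norm_eq_zero diff_eq_zero_iff)
qed (auto simp: norm_dist_def norm_nonneg norm_diff_commute norm_diff_triangle)

sublocale M: Metric_space "carrier V" "norm_dist V N"
  by (rule Metric_space_norm)

text \<open>
  Sequences suffice in metric spaces, and the distance is \<open>N (x \<ominus> y)\<close>; working with real null sequences
  avoids the case distinction in \<^const>\<open>norm_dist\<close>.
\<close>
definition tends :: "(nat \<Rightarrow> 'a) \<Rightarrow> 'a \<Rightarrow> bool" where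
  "tends x l \<longleftrightarrow> l \<in> carrier V \<and> (\<forall>n. x n \<in> carrier V) \<and> (\<lambda>n. N (x n \<ominus> l)) \<longlonglongrightarrow> 0"

lemma tendsD:
  assumes "tends x l"
  shows "l \<in> carrier V" "x n \<in> carrier V" "(\<lambda>n. N (x n \<ominus> l)) \<longlonglongrightarrow> 0"
  using assms by (auto simp: tends_def)

lemma tends_iff_limitin:
  assumes "\<And>n. x n \<in> carrier V"
  shows "tends x l \<longleftrightarrow> limitin (norm_topology V N) x l sequentially"
proof -
  have "(\<lambda>n. norm_dist V N (x n) l) = (\<lambda>n. N (x n \<ominus> l))" if "l \<in> carrier V"
    using assms that by (auto simp: norm_dist_def)
  then show ?thesis
    using assms by (auto simp: tends_def norm_topology_def M.limitin_metric_dist_null)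
qed

lemma closedin_iff_sequentially:
  "closedin (norm_topology V N) E \<longleftrightarrow>
     E \<subseteq> carrier V \<and> (\<forall>x l. (\<forall>n. x n \<in> E) \<longrightarrow> tends x l \<longrightarrow> l \<in> E)"
  using tends_iff_limitin unfolding norm_topology_def M.metric_closedin_iff_sequentially_closed
  by (smt (verit, best) image_subset_iff subsetD UNIV_I)

lemma tends_dominated:
  assumes "\<And>n. x n \<in> carrier V" "l \<in> carrier V" "\<And>n. N (x n \<ominus> l) \<le> t n" "t \<longlonglongrightarrow> 0"
  shows "tends x l"
  unfolding tends_def
  using assms norm_nonneg by (auto intro!: tendsto_sandwich[OF _ _ tendsto_const \<open>t \<longlonglongrightarrow> 0\<close>])

lemma tends_const: "l \<in> carrier V \<Longrightarrow> tends (\<lambda>n. l) l"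
  by (simp add: tends_def)

lemma tends_Suc: "tends x l \<Longrightarrow> tends (\<lambda>n. x (Suc n)) l"
  unfolding tends_def using LIMSEQ_Suc[of "\<lambda>n. N (x n \<ominus> l)"] by auto

lemma tends_norm: "tends x l \<Longrightarrow> (\<lambda>n. N (x n)) \<longlonglongrightarrow> N l"
proof (rule Lim_transform)
  assume "tends x l"
  note l = tendsD[OF this]
  show "(\<lambda>n. N (x n) - N l) \<longlonglongrightarrow> 0"
  proof (rule Lim_null_comparison[OF _ l(3)])
    show "\<forall>\<^sub>F n in sequentially. norm (N (x n) - N l) \<le> N (x n \<ominus> l)"
      using abs_norm_diff[OF l(2) l(1)] by (simp add: abs_minus_commute)
  qed
qed simp

lemma tends_unique:
  assumes "tends x l" "tends x m"
  shows "l = m"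
proof -
  note l = tendsD[OF assms(1)] and m = tendsD[OF assms(2)]
  have "(\<lambda>n. N (x n \<ominus> l) + N (x n \<ominus> m)) \<longlonglongrightarrow> 0 + 0"
    by (intro tendsto_add l m)
  moreover have "N (l \<ominus> m) \<le> N (x n \<ominus> l) + N (x n \<ominus> m)" for n
    using norm_diff_triangle[OF l(1) l(2) m(1), of n] norm_diff_commute[OF l(1) l(2), of n] by simp
  ultimately have "N (l \<ominus> m) \<le> 0"
    by (simp add: LIMSEQ_le_const)
  then show ?thesis
    using l(1) m(1) norm_nonneg[of "l \<ominus> m"] norm_eq_zero[of "l \<ominus> m"] diff_eq_zero_iff by simp
qed

lemma tends_add:
  assumes "tends x l" "tends y m"
  shows "tends (\<lambda>n. x n \<oplus> y n) (l \<oplus> m)"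
proof -
  note l = tendsD[OF assms(1)] and m = tendsD[OF assms(2)]
  have "(\<lambda>n. N (x n \<ominus> l) + N (y n \<ominus> m)) \<longlonglongrightarrow> 0 + 0"
    by (intro tendsto_add l m)
  then show ?thesis
    using l m norm_triangle[of "x _ \<ominus> l" "y _ \<ominus> m"]
    by (intro tends_dominated[where t = "\<lambda>n. N (x n \<ominus> l) + N (y n \<ominus> m)"])
      (auto simp: add_diff_add)
qed

lemma tends_smult:
  assumes "tends x l"
  shows "tends (\<lambda>n. c \<odot> x n) (c \<odot> l)"
proof -
  note l = tendsD[OF assms(1)]
  have "(\<lambda>n. cmod c * N (x n \<ominus> l)) \<longlonglongrightarrow> cmod c * 0"
    by (intro tendsto_mult tendsto_const l)
  then show ?thesis
    using l
    by (intro tends_dominated[where t = "\<lambda>n. cmod c * N (x n \<ominus> l)"])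
      (auto simp: norm_smult scal_diff_right[symmetric])
qed

lemma tends_diff:
  assumes "tends x l" "tends y m"
  shows "tends (\<lambda>n. x n \<ominus> y n) (l \<ominus> m)"
  using tends_add[OF assms(1) tends_smult[OF assms(2), of "- 1"]]
    tendsD[OF assms(1)] tendsD[OF assms(2)] by (simp add: diff_scal)

end

sublocale complex_banach \<subseteq> complex_normed
  by (rule complex_normed.intro[OF vspace norm_nonneg norm_eq_zero norm_smult norm_triangle])

context complex_banach
begin

lemma Cauchy_tends:
  assumes x: "\<And>n. x n \<in> carrier V"
    and "\<And>\<epsilon>. \<epsilon> > 0 \<Longrightarrow> \<exists>M. \<forall>m\<ge>M. \<forall>n\<ge>M. N (x m \<ominus> x n) < \<epsilon>"
  shows "\<exists>l. tends x l"
proof -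
  have "M.MCauchy x"
    using assms by (fastforce simp: M.MCauchy_def norm_dist_def)
  then have "\<exists>l. limitin M.mtopology x l sequentially"
    using complete M.mcomplete_def by blast
  then show ?thesis
    using tends_iff_limitin[of x] x by (simp add: norm_topology_def)
qed

end

lemma complex_banachI:
  assumes "complex_normed V N"
    and lim: "\<And>x. \<lbrakk>\<And>n. x n \<in> carrier V;
        \<And>\<epsilon>. \<epsilon> > 0 \<Longrightarrow> \<exists>M. \<forall>m\<ge>M. \<forall>n\<ge>M. N (x m \<ominus>\<^bsub>V\<^esub> x n) < \<epsilon>\<rbrakk> \<Longrightarrow> \<exists>l. complex_normed.tends V N x l"
  shows "complex_banach V N"
proof -
  interpret complex_normed V N by fact
  have "M.mcomplete"
    unfolding M.mcomplete_def
  proof (intro allI impI)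
    fix x assume x: "M.MCauchy x"
    then have c: "x n \<in> carrier V" for n
      by (auto simp: M.MCauchy_def)
    moreover have "\<exists>M. \<forall>m\<ge>M. \<forall>n\<ge>M. N (x m \<ominus>\<^bsub>V\<^esub> x n) < \<epsilon>" if "\<epsilon> > 0" for \<epsilon>
      using x that c unfolding M.MCauchy_def norm_dist_def by (smt (verit, best))
    ultimately obtain l where "tends x l" using lim by blast
    then show "\<exists>l. limitin M.mtopology x l sequentially"
      using tends_iff_limitin[of x] c by (auto simp: norm_topology_def)
  qed
  then show ?thesis
    using vspace norm_nonneg norm_eq_zero norm_smult norm_triangle by (intro complex_banach.intro)
qed

section \<open>Positivity in C*-algebras\<close>

sublocale cstar_algebra \<subseteq> complex_banach A "nrm A"
  by (rule banach)

context cstar_algebra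
begin

lemmas [simp, intro] = mult_closed star_closed
lemmas [simp] = star_star

lemma mult_zero_left [simp]: "a \<in> carrier A \<Longrightarrow> \<zero> \<otimes> a = \<zero>"
  using smult_mult_left[of "\<zero>" a 0] by simp

lemma mult_zero_right [simp]: "a \<in> carrier A \<Longrightarrow> a \<otimes> \<zero> = \<zero>"
  using smult_mult_right[of a "\<zero>" 0] by simp

lemma mult_minus_left: "\<lbrakk>a \<in> carrier A; b \<in> carrier A\<rbrakk> \<Longrightarrow> (\<ominus> a) \<otimes> b = \<ominus> (a \<otimes> b)"
  by (simp add: minus_scal smult_mult_left)

lemma mult_minus_right: "\<lbrakk>a \<in> carrier A; b \<in> carrier A\<rbrakk> \<Longrightarrow> a \<otimes> (\<ominus> b) = \<ominus> (a \<otimes> b)"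
  by (simp add: minus_scal smult_mult_right)

lemma mult_diff_left:
  "\<lbrakk>a \<in> carrier A; b \<in> carrier A; c \<in> carrier A\<rbrakk> \<Longrightarrow> (a \<ominus> b) \<otimes> c = a \<otimes> c \<ominus> b \<otimes> c"
  by (simp add: V.minus_eq distr_left mult_minus_left)

lemma mult_diff_right:
  "\<lbrakk>a \<in> carrier A; b \<in> carrier A; c \<in> carrier A\<rbrakk> \<Longrightarrow> a \<otimes> (b \<ominus> c) = a \<otimes> b \<ominus> a \<otimes> c"
  by (simp add: V.minus_eq distr_right mult_minus_right)

lemma commuting_diff_squares:
  assumes "u \<in> carrier A" "v \<in> carrier A" "u \<otimes> v = v \<otimes> u"
  shows "u \<otimes> u \<ominus> v \<otimes> v = (u \<oplus> v) \<otimes> (u \<ominus> v)"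
proof -
  have "(u \<oplus> v) \<otimes> (u \<ominus> v) = (u \<otimes> u \<oplus> u \<otimes> v) \<ominus> (v \<otimes> v \<oplus> u \<otimes> v)"
    using assms by (simp add: distr_left mult_diff_right V.a_comm)
  also have "\<dots> = u \<otimes> u \<ominus> v \<otimes> v"
    using assms by (simp add: add_diff_add)
  finally show ?thesis by simp
qed

lemma star_zero [simp]: "star A \<zero> = \<zero>"
  using star_smult[of "\<zero>" 0] by simp

lemma star_minus: "a \<in> carrier A \<Longrightarrow> star A (\<ominus> a) = \<ominus> star A a"
  by (simp add: minus_scal star_smult)

lemma star_diff: "\<lbrakk>a \<in> carrier A; b \<in> carrier A\<rbrakk> \<Longrightarrow> star A (a \<ominus> b) = star A a \<ominus> star A b"
  by (simp add: V.minus_eq star_add star_minus)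

text \<open>
  From \<open>\<parallel>b\<parallel>\<^sup>2 = \<parallel>b\<^sup>* b\<parallel> \<le> \<parallel>b\<^sup>*\<parallel> \<parallel>b\<parallel>\<close>, applied to \<open>a\<close> and to \<open>a\<^sup>*\<close>.
\<close>
lemma norm_star [simp]:
  assumes "a \<in> carrier A"
  shows "nrm A (star A a) = nrm A a"
proof -
  have le: "nrm A b \<le> nrm A (star A b)" if b: "b \<in> carrier A" for b
  proof (cases "nrm A b = 0")
    case False
    then have "nrm A b > 0" using norm_nonneg[OF b] by simp
    moreover have "nrm A b * nrm A b \<le> nrm A (star A b) * nrm A b"
      using norm_mult[of "star A b" b] cstar_identity[OF b] b by (simp add: power2_eq_square)
    ultimately show ?thesis by simp
  qed (simp add: b norm_nonneg)
  show ?thesis using le[OF assms] le[of "star A a"] assms by simp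
qed

lemma norm_sa_square:
  "\<lbrakk>a \<in> carrier A; star A a = a\<rbrakk> \<Longrightarrow> nrm A (a \<otimes> a) = (nrm A a)\<^sup>2"
  using cstar_identity[of a] by simp

lemma tends_mult:
  assumes "tends x l" "tends y m"
  shows "tends (\<lambda>n. x n \<otimes> y n) (l \<otimes> m)"
proof -
  note l = tendsD[OF assms(1)] and m = tendsD[OF assms(2)]
  let ?t = "\<lambda>n. nrm A (x n) * nrm A (y n \<ominus> m) + nrm A (x n \<ominus> l) * nrm A m"
  have "?t \<longlonglongrightarrow> nrm A l * 0 + 0 * nrm A m"
    by (intro tendsto_add tendsto_mult l m tendsto_const tends_norm assms)
  then have t: "?t \<longlonglongrightarrow> 0" by simp
  have "nrm A (x n \<otimes> y n \<ominus> l \<otimes> m) \<le> ?t n" for n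
  proof -
    have "x n \<otimes> y n \<ominus> l \<otimes> m = x n \<otimes> (y n \<ominus> m) \<oplus> (x n \<ominus> l) \<otimes> m"
      using l m by (simp add: mult_diff_left mult_diff_right diff_add_diff)
    then show ?thesis
      using norm_triangle[of "x n \<otimes> (y n \<ominus> m)" "(x n \<ominus> l) \<otimes> m"]
        norm_mult[of "x n" "y n \<ominus> m"] norm_mult[of "x n \<ominus> l" m] l m by fastforce
  qed
  then show ?thesis
    using l m t by (intro tends_dominated[where t = ?t]) auto
qed

lemma tends_star: "tends x l \<Longrightarrow> tends (\<lambda>n. star A (x n)) (star A l)"
  unfolding tends_def by (simp add: star_diff[symmetric])

end

text \<open>
  The unit is allowed to vanish: \<open>A\<^sub>l(X)\<close> is the zero algebra when \<open>X = 0\<close>. Therefore only \<open>\<parallel>1\<parallel> \<le> 1\<close> is available.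
\<close>
locale unital_cstar_algebra = cstar_algebra +
  assumes one_closed [simp, intro]: "\<one> \<in> carrier A"
    and one_mult [simp]: "a \<in> carrier A \<Longrightarrow> \<one> \<otimes> a = a"
    and mult_one [simp]: "a \<in> carrier A \<Longrightarrow> a \<otimes> \<one> = a"
begin

sublocale R: ring A
proof (rule ringI)
  show "abelian_group A" ..
  show "monoid A"
    by (rule monoidI) (auto simp: mult_assoc)
qed (auto simp: distr_left distr_right)

lemma star_one [simp]: "star A \<one> = \<one>"
  using star_mult[of "star A \<one>" \<one>] by simp

lemma norm_one_le: "nrm A \<one> \<le> 1"
proof (rule ccontr)
  assume "\<not> nrm A \<one> \<le> 1"
  moreover have "nrm A \<one> = nrm A \<one> * nrm A \<one>"
    using norm_sa_square[of \<one>] by (simp add: power2_eq_square)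
  ultimately show False by simp
qed

abbreviation scalar :: "real \<Rightarrow> 'a" where
  "scalar t \<equiv> complex_of_real t \<odot> \<one>"

lemma star_scalar [simp]: "star A (scalar t) = scalar t"
  by (simp add: star_smult)

lemma scalar_mult [simp]: "a \<in> carrier A \<Longrightarrow> scalar t \<otimes> a = complex_of_real t \<odot> a"
  by (simp add: smult_mult_left)

lemma mult_scalar [simp]: "a \<in> carrier A \<Longrightarrow> a \<otimes> scalar t = complex_of_real t \<odot> a"
  by (simp add: smult_mult_right)

lemma norm_scalar_le: "0 \<le> t \<Longrightarrow> nrm A (scalar t) \<le> t"
  using mult_left_mono[OF norm_one_le, of t] by (simp add: norm_smult)

end

text \<open>
  The solution \<open>w\<close> of \<open>w = (k + w\<^sup>2) / 2\<close> satisfies \<open>(1 - w)\<^sup>2 = 1 - k\<close>. It is found by iteration from \<open>0\<close>; the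
  iterates are polynomials in \<open>k\<close> with nonnegative coefficients, so that for \<open>\<parallel>k\<parallel> \<le> 1\<close> the scalar iteration for \<open>k = 1\<close>
  dominates both them and their increments. The scalar iterates increase and are bounded by \<open>1\<close>.
\<close>
primrec sqrt_bound :: "nat \<Rightarrow> real" where
  "sqrt_bound 0 = 0"
| "sqrt_bound (Suc n) = (1 + (sqrt_bound n)\<^sup>2) / 2"

lemma sqrt_bound_range: "0 \<le> sqrt_bound n \<and> sqrt_bound n \<le> 1"
proof (induction n)
  case (Suc n)
  then have "(sqrt_bound n)\<^sup>2 \<le> 1" by (simp add: power_le_one)
  then show ?case by simp
qed simp

lemma sqrt_bound_mono: "mono sqrt_bound"
proof (rule incseq_SucI)
  fix n
  have "0 \<le> (1 - sqrt_bound n)\<^sup>2" by simp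
  then show "sqrt_bound n \<le> sqrt_bound (Suc n)"
    by (simp add: power2_eq_square algebra_simps)
qed

context unital_cstar_algebra
begin

primrec sqrt_iter :: "'a \<Rightarrow> nat \<Rightarrow> 'a" where
  "sqrt_iter k 0 = \<zero>"
| "sqrt_iter k (Suc n) = (1 / 2) \<odot> (k \<oplus> sqrt_iter k n \<otimes> sqrt_iter k n)"

text \<open>
  Convergence follows from the increments \<open>w\<^sub>n\<^sub>+\<^sub>1 - w\<^sub>n = (w\<^sub>n + w\<^sub>n\<^sub>-\<^sub>1) (w\<^sub>n - w\<^sub>n\<^sub>-\<^sub>1) / 2\<close>, which the scalar increments dominate even for
  \<open>\<parallel>k\<parallel> = 1\<close>. All iterates are polynomials in \<open>k\<close>, so the root is self-adjoint and commutes with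
  everything that commutes with \<open>k\<close>.
\<close>
lemma sqrt_one_minus:
  assumes k: "k \<in> carrier A" and sa: "star A k = k" and le: "nrm A k \<le> 1"
  obtains v where "v \<in> carrier A" "star A v = v" "v \<otimes> v = \<one> \<ominus> k" "nrm A (\<one> \<ominus> v) \<le> 1"
    "\<And>c. \<lbrakk>c \<in> carrier A; c \<otimes> k = k \<otimes> c\<rbrakk> \<Longrightarrow> c \<otimes> v = v \<otimes> c"
proof -
  let ?w = "sqrt_iter k" and ?t = sqrt_bound
  have w [simp]: "?w n \<in> carrier A" for n
    by (induction n) (auto simp: k)
  have star: "star A (?w n) = ?w n" for n
    by (induction n) (auto simp: k star_smult star_add star_mult sa)
  have comm: "c \<otimes> ?w n = ?w n \<otimes> c" if c: "c \<in> carrier A" "c \<otimes> k = k \<otimes> c" for c n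
  proof (induction n)
    case (Suc n)
    have "c \<otimes> (?w n \<otimes> ?w n) = (?w n \<otimes> ?w n) \<otimes> c"
      using c Suc by (metis mult_assoc w)
    then show ?case
      using c k by (simp add: smult_mult_left smult_mult_right distr_left distr_right)
  qed (use c in simp)
  have comm_w: "?w m \<otimes> ?w n = ?w n \<otimes> ?w m" for m n
    using comm[of "?w m" n] comm[of k m] k by simp
  have bound: "nrm A (?w n) \<le> ?t n" for n
  proof (induction n)
    case (Suc n)
    have "nrm A (k \<oplus> ?w n \<otimes> ?w n) \<le> nrm A k + nrm A (?w n) * nrm A (?w n)"
      using norm_triangle[of k "?w n \<otimes> ?w n"] norm_mult[of "?w n" "?w n"] k by simp
    also have "\<dots> \<le> 1 + ?t n * ?t n"
      using le Suc by (intro add_mono mult_mono) (auto simp: sqrt_bound_range norm_nonneg)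
    finally show ?case by (simp add: norm_smult k power2_eq_square)
  qed simp
  have step: "nrm A (?w (Suc n) \<ominus> ?w n) \<le> ?t (Suc n) - ?t n" for n
  proof (induction n)
    case 0
    then show ?case using le k by (simp add: norm_smult)
  next
    case (Suc n)
    let ?u = "?w (Suc n)" and ?v = "?w n"
    have "?w (Suc (Suc n)) \<ominus> ?w (Suc n) = (1 / 2) \<odot> ((k \<oplus> ?u \<otimes> ?u) \<ominus> (k \<oplus> ?v \<otimes> ?v))"
      using k w[of "Suc n"] w[of n] by (simp only: sqrt_iter.simps scal_diff_right V.a_closed mult_closed)
    also have "(k \<oplus> ?u \<otimes> ?u) \<ominus> (k \<oplus> ?v \<otimes> ?v) = ?u \<otimes> ?u \<ominus> ?v \<otimes> ?v"
      using k w[of "Suc n"] w[of n] by (simp add: add_diff_add del: sqrt_iter.simps)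
    also have "\<dots> = (?u \<oplus> ?v) \<otimes> (?u \<ominus> ?v)"
      using w[of "Suc n"] w[of n] comm_w[of "Suc n" n] by (intro commuting_diff_squares)
    finally have eq: "?w (Suc (Suc n)) \<ominus> ?w (Suc n) = (1 / 2) \<odot> ((?u \<oplus> ?v) \<otimes> (?u \<ominus> ?v))" .
    have "nrm A ((?u \<oplus> ?v) \<otimes> (?u \<ominus> ?v)) \<le> nrm A (?u \<oplus> ?v) * nrm A (?u \<ominus> ?v)"
      using w[of "Suc n"] w[of n] by (intro norm_mult) (auto simp del: sqrt_iter.simps)
    also have "\<dots> \<le> (?t (Suc n) + ?t n) * (?t (Suc n) - ?t n)"
    proof (rule mult_mono)
      show "nrm A (?u \<oplus> ?v) \<le> ?t (Suc n) + ?t n"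
        using norm_triangle[of ?u ?v] bound[of "Suc n"] bound[of n] w[of "Suc n"] w[of n] by linarith
      show "0 \<le> ?t (Suc n) + ?t n"
        using sqrt_bound_range[of n] sqrt_bound_range[of "Suc n"] by linarith
      show "0 \<le> nrm A (?u \<ominus> ?v)"
        using w[of "Suc n"] w[of n] by (intro norm_nonneg diff_closed)
    qed (rule Suc)
    also have "\<dots> = 2 * (?t (Suc (Suc n)) - ?t (Suc n))"
    proof -
      have "2 * ?t (Suc (Suc n)) = 1 + (?t (Suc n))\<^sup>2" "2 * ?t (Suc n) = 1 + (?t n)\<^sup>2"
        by simp_all
      then show ?thesis
        by (simp add: power2_eq_square algebra_simps del: sqrt_bound.simps)
    qed
    finally show ?case
      unfolding eq using w[of "Suc n"] w[of n]
      by (simp add: norm_smult del: sqrt_iter.simps sqrt_bound.simps)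
  qed
  have diff: "nrm A (?w (n + d) \<ominus> ?w n) \<le> ?t (n + d) - ?t n" for n d
  proof (induction d)
    case (Suc d)
    show ?case
      using norm_diff_triangle[of "?w (Suc (n + d))" "?w (n + d)" "?w n"] w step[of "n + d"] Suc
      by (simp del: sqrt_iter.simps sqrt_bound.simps w add: w)
  qed simp
  have conv: "convergent ?t"
    using sqrt_bound_mono sqrt_bound_range
    by (intro Bseq_mono_convergent) (auto simp: Bseq_def incseq_def intro!: exI[of _ 1])
  have "\<exists>l. tends ?w l"
  proof (rule Cauchy_tends[OF w])
    fix \<epsilon> :: real assume "\<epsilon> > 0"
    then obtain M where M: "\<And>m n. \<lbrakk>m \<ge> M; n \<ge> M\<rbrakk> \<Longrightarrow> \<bar>?t m - ?t n\<bar> < \<epsilon>"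
      using convergent_Cauchy[OF conv] unfolding Cauchy_def dist_real_def by blast
    have le': "nrm A (?w m \<ominus> ?w n) \<le> ?t m - ?t n" if "n \<le> m" for m n
      using diff[of n "m - n"] that by simp
    have "nrm A (?w m \<ominus> ?w n) < \<epsilon>" if "m \<ge> M" "n \<ge> M" for m n
      using le'[of m n] le'[of n m] M[OF that] norm_diff_commute[OF w w, of m n]
      by (cases "n \<le> m") auto
    then show "\<exists>M. \<forall>m\<ge>M. \<forall>n\<ge>M. nrm A (?w m \<ominus> ?w n) < \<epsilon>" by blast
  qed
  then obtain l where l: "tends ?w l" by blast
  have lc [simp]: "l \<in> carrier A" using tendsD[OF l] by simp
  have "tends (\<lambda>n. ?w (Suc n)) ((1 / 2) \<odot> (k \<oplus> l \<otimes> l))"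
    using k by (simp, intro tends_smult tends_add tends_mult tends_const l)
  from tends_unique[OF tends_Suc[OF l] this] have fixpoint: "l = (1 / 2) \<odot> (k \<oplus> l \<otimes> l)" .
  have "tends ?w (star A l)"
    using tends_star[OF l] by (simp add: star)
  from tends_unique[OF this l] have "star A l = l" .
  moreover have "nrm A l \<le> 1"
    using tends_norm[OF l] bound sqrt_bound_range by (intro LIMSEQ_le_const2) (auto intro: order_trans)
  moreover have "c \<otimes> (\<one> \<ominus> l) = (\<one> \<ominus> l) \<otimes> c" if c: "c \<in> carrier A" "c \<otimes> k = k \<otimes> c" for c
  proof -
    have "c \<otimes> l = l \<otimes> c"
    proof (rule tends_unique)
      show "tends (\<lambda>n. c \<otimes> ?w n) (c \<otimes> l)"
        by (intro tends_mult tends_const l c)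
      show "tends (\<lambda>n. c \<otimes> ?w n) (l \<otimes> c)"
        unfolding comm[OF c] by (intro tends_mult tends_const l c)
    qed
    then show ?thesis
      using c by (simp add: mult_diff_left mult_diff_right)
  qed
  moreover have "(\<one> \<ominus> l) \<otimes> (\<one> \<ominus> l) = \<one> \<ominus> k"
  proof -
    have "2 \<odot> l = 2 \<odot> ((1 / 2) \<odot> (k \<oplus> l \<otimes> l))"
      using fixpoint by simp
    then have "l \<oplus> l = k \<oplus> l \<otimes> l"
      using k scal_add_left[of l 1 1] by simp
    then have e: "l \<ominus> l \<otimes> l = k \<ominus> l"
      using k by (intro diff_eq_diff) auto
    have "(\<one> \<ominus> l) \<otimes> (\<one> \<ominus> l) = (\<one> \<ominus> l) \<ominus> (l \<ominus> l \<otimes> l)"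
      by (simp add: mult_diff_left mult_diff_right)
    also have "\<dots> = \<one> \<ominus> k"
      unfolding e using k by (simp add: diff_diff_eq)
    finally show ?thesis .
  qed
  moreover have "\<one> \<ominus> (\<one> \<ominus> l) = l"
    by (simp add: diff_diff_cancel)
  moreover have "\<one> \<ominus> l \<in> carrier A" by simp
  moreover have "star A (\<one> \<ominus> l) = \<one> \<ominus> l"
    using \<open>star A l = l\<close> by (simp add: star_diff)
  ultimately show thesis
    by (intro that[of "\<one> \<ominus> l"]) simp_all
qed

text \<open>
  A compact set of reals lies in \<open>[0, \<infinity>)\<close> if and only if it lies in some interval \<open>[0, 2 t]\<close>, the ball of radius
  \<open>t\<close> around \<open>t\<close>. Stated with the norm, this describes positive elements without reference to spectra, and the
  triangle inequality shows that they form a cone.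
\<close>
definition pos :: "'a \<Rightarrow> bool" where
  "pos p \<longleftrightarrow> p \<in> carrier A \<and> star A p = p \<and> (\<exists>t. nrm A (scalar t \<ominus> p) \<le> t)"

lemma pos_closed: "pos p \<Longrightarrow> p \<in> carrier A" "pos p \<Longrightarrow> star A p = p"
  by (auto simp: pos_def)

text \<open>
  If \<open>\<parallel>t - p\<parallel> \<le> t\<close>, then \<open>p / t = 1 - k\<close> with \<open>\<parallel>k\<parallel> \<le> 1\<close>. The root of \<open>1 - k\<close> found above is at distance at
  most \<open>1\<close> from \<open>1\<close>, hence it is positive itself.
\<close>
lemma pos_sqrt:
  assumes "pos p"
  obtains r where "pos r" "r \<otimes> r = p"
    "\<And>c. \<lbrakk>c \<in> carrier A; c \<otimes> p = p \<otimes> c\<rbrakk> \<Longrightarrow> c \<otimes> r = r \<otimes> c"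
proof -
  have p [simp]: "p \<in> carrier A" "star A p = p" using assms by (auto simp: pos_def)
  obtain t where t: "nrm A (scalar t \<ominus> p) \<le> t" using assms by (auto simp: pos_def)
  then have "t \<ge> 0" using norm_nonneg[of "scalar t \<ominus> p"] by simp
  then consider "t = 0" | "t > 0" by linarith
  then show thesis
  proof cases
    case 1
    then have "nrm A (\<zero> \<ominus> p) = 0"
      using t norm_nonneg[of "\<zero> \<ominus> p"] by simp
    then have "p = \<zero>"
      using norm_eq_zero[of "\<zero> \<ominus> p"] diff_eq_zero_iff[of "\<zero>" p] by simp
    then show thesis
      using assms by (intro that[of "\<zero>"]) simp_all
  next
    case 2
    let ?k = "complex_of_real (1 / t) \<odot> (scalar t \<ominus> p)"
    have k: "?k = \<one> \<ominus> complex_of_real (1 / t) \<odot> p"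
      using 2 by (simp add: scal_diff_right)
    have "nrm A ?k \<le> 1"
      using 2 t by (simp add: norm_smult norm_divide)
    have "star A ?k = ?k"
      by (simp add: star_smult star_diff)
    have kc: "?k \<in> carrier A" by simp
    obtain v where v: "v \<in> carrier A" "star A v = v" "v \<otimes> v = \<one> \<ominus> ?k"
      "nrm A (\<one> \<ominus> v) \<le> 1" "\<And>c. \<lbrakk>c \<in> carrier A; c \<otimes> ?k = ?k \<otimes> c\<rbrakk> \<Longrightarrow> c \<otimes> v = v \<otimes> c"
      by (rule sqrt_one_minus[OF kc \<open>star A ?k = ?k\<close> \<open>nrm A ?k \<le> 1\<close>]) blast
    have vv: "v \<otimes> v = complex_of_real (1 / t) \<odot> p"
    proof -
      have "\<one> \<ominus> (\<one> \<ominus> complex_of_real (1 / t) \<odot> p) = complex_of_real (1 / t) \<odot> p"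
        by (intro diff_diff_cancel) auto
      then show ?thesis using v(3) k by simp
    qed
    let ?r = "complex_of_real (sqrt t) \<odot> v"
    have "complex_of_real (sqrt t) * complex_of_real (sqrt t) = complex_of_real t"
      using 2 by (metis less_imp_le of_real_mult real_sqrt_mult_self abs_of_pos)
    then have "?r \<otimes> ?r = p"
      using v(1) 2 vv by (simp add: smult_mult_left smult_mult_right)
    moreover have "pos ?r"
      unfolding pos_def
    proof (intro conjI exI)
      have "scalar (sqrt t) \<ominus> ?r = complex_of_real (sqrt t) \<odot> (\<one> \<ominus> v)"
        using v(1) by (simp add: scal_diff_right)
      then show "nrm A (scalar (sqrt t) \<ominus> ?r) \<le> sqrt t"
        using v(1,4) 2 by (simp add: norm_smult mult_left_le)
    qed (use v(1,2) in \<open>auto simp: star_smult\<close>)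
    moreover have "c \<otimes> ?r = ?r \<otimes> c" if "c \<in> carrier A" "c \<otimes> p = p \<otimes> c" for c
    proof -
      have "c \<otimes> ?k = ?k \<otimes> c"
        using that by (simp add: smult_mult_left smult_mult_right mult_diff_left mult_diff_right)
      then show ?thesis
        using v(5)[OF that(1) \<open>c \<otimes> ?k = ?k \<otimes> c\<close>] that(1) v(1)
        by (simp add: smult_mult_left smult_mult_right)
    qed
    ultimately show thesis by (intro that[of ?r]) blast+
  qed
qed

lemma posI:
  "\<lbrakk>p \<in> carrier A; star A p = p; nrm A (scalar t \<ominus> p) \<le> t\<rbrakk> \<Longrightarrow> pos p"
  by (auto simp: pos_def)

text \<open>
  For commuting self-adjoint \<open>h\<close> and \<open>v\<close> with \<open>h\<^sup>2 + v\<^sup>2 = t\<close>, the element \<open>u = h + \<i> v\<close> is \<open>\<surd>t\<close> times a unitary. Its norm is at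
  most \<open>\<surd>t\<close>, and \<open>h = (u + u\<^sup>*) / 2\<close>. This takes the place of spectral theory in the comparison of norms.
\<close>
lemma norm_le_of_square_sum:
  assumes h: "h \<in> carrier A" "star A h = h" and v: "v \<in> carrier A" "star A v = v"
    and comm: "h \<otimes> v = v \<otimes> h" and sum: "h \<otimes> h \<oplus> v \<otimes> v = scalar t" and "0 \<le> t"
  shows "(nrm A h)\<^sup>2 \<le> t"
proof -
  let ?w = "\<i> \<odot> v"
  let ?u = "h \<oplus> ?w"
  have w: "?w \<in> carrier A" "?w \<otimes> ?w = \<ominus> (v \<otimes> v)" "h \<otimes> ?w = ?w \<otimes> h" "star A ?w = \<ominus> ?w"
    using h v comm by (simp_all add: smult_mult_left smult_mult_right star_smult minus_scal)
  have su: "star A ?u = h \<ominus> ?w"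
    using h w by (simp add: star_add V.minus_eq)
  have "star A ?u \<otimes> ?u = (h \<oplus> ?w) \<otimes> (h \<ominus> ?w)"
  proof -
    have "(h \<ominus> ?w) \<otimes> (h \<oplus> ?w) = (h \<otimes> h \<oplus> h \<otimes> ?w) \<ominus> (?w \<otimes> ?w \<oplus> h \<otimes> ?w)"
      using h w(1,3) by (simp add: distr_right mult_diff_left add_diff_add V.a_comm[of "?w \<otimes> ?w"])
    also have "\<dots> = h \<otimes> h \<ominus> ?w \<otimes> ?w"
      using h w(1) by (simp add: add_diff_add)
    finally show ?thesis
      using commuting_diff_squares[OF h(1) w(1,3)] su by simp
  qed
  also have "\<dots> = h \<otimes> h \<ominus> ?w \<otimes> ?w"
    using commuting_diff_squares[OF h(1) w(1,3)] by simp
  also have "\<dots> = scalar t"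
    unfolding w(2) sum[symmetric] using h v by (simp add: V.minus_eq)
  finally have "(nrm A ?u)\<^sup>2 = nrm A (scalar t)"
    using cstar_identity[of ?u] h w by simp
  then have u: "(nrm A ?u)\<^sup>2 \<le> t"
    using norm_scalar_le[OF \<open>0 \<le> t\<close>] by simp
  have "h \<oplus> h = ?u \<oplus> star A ?u"
    unfolding su using h w(1) by (simp add: V.minus_eq V.a_ac V.r_neg)
  then have "2 * nrm A h \<le> nrm A ?u + nrm A (star A ?u)"
    using norm_triangle[of ?u "star A ?u"] norm_smult[OF h(1), of 2] scal_add_left[OF h(1), of 1 1] h w
    by simp
  also have "\<dots> = 2 * nrm A ?u"
    using h w(1) by simp
  finally have "(nrm A h)\<^sup>2 \<le> (nrm A ?u)\<^sup>2"
    using norm_nonneg[OF h(1)] by (intro power_mono) auto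
  with u show ?thesis by simp
qed

lemma pos_scalar_diff:
  assumes "p \<in> carrier A" "star A p = p" "nrm A p \<le> t"
  shows "pos (scalar t \<ominus> p)"
  using assms unfolding pos_def
  by (auto simp: star_diff diff_diff_cancel intro!: exI[of _ t])

lemma commute_scalar_diff:
  assumes "c \<in> carrier A" "p \<in> carrier A" "c \<otimes> p = p \<otimes> c"
  shows "c \<otimes> (scalar t \<ominus> p) = (scalar t \<ominus> p) \<otimes> c"
  using assms by (simp add: mult_diff_left mult_diff_right)

text \<open>
  The root \<open>v\<close> of \<open>t - h\<^sup>2\<close> commutes with \<open>h\<close>, and the norm bound for \<open>h + \<i> v\<close> applied to \<open>v\<^sup>2 + h\<^sup>2 = t\<close> gives \<open>\<parallel>v\<parallel>\<^sup>2 \<le> t\<close>.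
\<close>
lemma norm_scalar_diff_square:
  assumes h: "h \<in> carrier A" "star A h = h" and t: "(nrm A h)\<^sup>2 \<le> t"
  shows "nrm A (scalar t \<ominus> h \<otimes> h) \<le> t"
proof -
  have "pos (scalar t \<ominus> h \<otimes> h)"
    using h t norm_sa_square[OF h] by (intro pos_scalar_diff) (auto simp: star_mult)
  then obtain v where v: "pos v" "v \<otimes> v = scalar t \<ominus> h \<otimes> h"
    "\<And>c. \<lbrakk>c \<in> carrier A; c \<otimes> (scalar t \<ominus> h \<otimes> h) = (scalar t \<ominus> h \<otimes> h) \<otimes> c\<rbrakk> \<Longrightarrow> c \<otimes> v = v \<otimes> c"
    by (rule pos_sqrt) blast
  have vc: "v \<in> carrier A" "star A v = v" using v(1) pos_closed by auto
  have "h \<otimes> v = v \<otimes> h"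
    using v(3)[OF h(1) commute_scalar_diff] h mult_assoc by simp
  moreover have "v \<otimes> v \<oplus> h \<otimes> h = scalar t"
    using h by (simp add: v(2) diff_add_cancel)
  moreover have "0 \<le> t" using t zero_le_power2 order_trans by blast
  ultimately have "(nrm A v)\<^sup>2 \<le> t"
    using norm_le_of_square_sum[OF vc h] by simp
  then show ?thesis
    using norm_sa_square[OF vc] v(2) by simp
qed

lemma pos_square: "\<lbrakk>h \<in> carrier A; star A h = h\<rbrakk> \<Longrightarrow> pos (h \<otimes> h)"
  by (rule posI[OF _ _ norm_scalar_diff_square[of h "(nrm A h)\<^sup>2"]]) (simp_all add: star_mult)

lemma pos_add:
  assumes "pos p" "pos q"
  shows "pos (p \<oplus> q)"
proof -
  obtain s t where s: "nrm A (scalar s \<ominus> p) \<le> s" and t: "nrm A (scalar t \<ominus> q) \<le> t"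
    using assms by (auto simp: pos_def)
  have pq: "p \<in> carrier A" "q \<in> carrier A" using assms by (auto simp: pos_def)
  have "scalar (s + t) \<ominus> (p \<oplus> q) = (scalar s \<ominus> p) \<oplus> (scalar t \<ominus> q)"
    using pq by (simp add: scal_add_left add_diff_add)
  then have "nrm A (scalar (s + t) \<ominus> (p \<oplus> q)) \<le> s + t"
    using norm_triangle[of "scalar s \<ominus> p" "scalar t \<ominus> q"] s t pq by simp
  then show ?thesis
    using pos_closed[OF assms(1)] pos_closed[OF assms(2)]
    by (intro posI[of _ "s + t"]) (simp_all add: star_add)
qed

lemma pos_scale:
  assumes "pos p" "0 \<le> c"
  shows "pos (complex_of_real c \<odot> p)"
proof -
  obtain s where s: "nrm A (scalar s \<ominus> p) \<le> s" and p: "p \<in> carrier A" "star A p = p"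
    using assms by (auto simp: pos_def)
  have "scalar (c * s) \<ominus> complex_of_real c \<odot> p = complex_of_real c \<odot> (scalar s \<ominus> p)"
    using p by (simp add: scal_diff_right)
  then have "nrm A (scalar (c * s) \<ominus> complex_of_real c \<odot> p) \<le> c * s"
    using s p assms(2) by (simp add: norm_smult mult_left_mono)
  then show ?thesis
    using p by (intro posI[of _ "c * s"]) (simp_all add: star_smult)
qed

text \<open>
  With \<open>s = \<parallel>p + q\<parallel>\<close> the element \<open>s - p = (s - (p + q)) + q\<close> is positive. Its root and the root of \<open>p\<close> commute and their
  squares add up to \<open>s\<close>.
\<close>
lemma norm_pos_mono:
  assumes "pos p" "pos q"
  shows "nrm A p \<le> nrm A (p \<oplus> q)"
proof -
  note p = pos_closed[OF assms(1)] and q = pos_closed[OF assms(2)]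
  let ?s = "nrm A (p \<oplus> q)"
  have s: "0 \<le> ?s" using p q by (simp add: norm_nonneg)
  have "pos (scalar ?s \<ominus> (p \<oplus> q))"
    using p q by (intro pos_scalar_diff) (auto simp: star_add)
  from pos_add[OF this assms(2)] have "pos (scalar ?s \<ominus> p)"
  proof -
    have "(scalar ?s \<ominus> (p \<oplus> q)) \<oplus> q = scalar ?s \<ominus> p"
      using p q by (simp add: diff_add diff_add_cancel)
    with \<open>pos (scalar ?s \<ominus> (p \<oplus> q) \<oplus> q)\<close> show ?thesis by simp
  qed
  then obtain v where v: "pos v" "v \<otimes> v = scalar ?s \<ominus> p"
    "\<And>c. \<lbrakk>c \<in> carrier A; c \<otimes> (scalar ?s \<ominus> p) = (scalar ?s \<ominus> p) \<otimes> c\<rbrakk> \<Longrightarrow> c \<otimes> v = v \<otimes> c"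
    by (rule pos_sqrt) blast
  obtain r where r: "pos r" "r \<otimes> r = p"
    using pos_sqrt[OF assms(1)] by blast
  note vc = pos_closed[OF v(1)] and rc = pos_closed[OF r(1)]
  have "r \<otimes> p = p \<otimes> r" using r(2) rc mult_assoc by metis
  then have "r \<otimes> v = v \<otimes> r"
    using v(3)[OF rc(1) commute_scalar_diff] rc p by simp
  moreover have "r \<otimes> r \<oplus> v \<otimes> v = scalar ?s"
    using r v p by (simp add: V.a_comm[of p] diff_add_cancel)
  ultimately have "(nrm A r)\<^sup>2 \<le> ?s"
    using norm_le_of_square_sum[OF rc vc _ _ s] by simp
  then show ?thesis
    using norm_sa_square[OF rc] r(2) by simp
qed

text \<open>
  If \<open>b\<^sup>* b = - k\<^sup>2\<close>, then \<open>p = b b\<^sup>*\<close> is positive, being the sum of \<open>k\<^sup>2\<close> and \<open>b b\<^sup>* + b\<^sup>* b\<close>, which is half of a sum of two squares. With \<open>s = \<parallel>p\<parallel> = \<parallel>k\<parallel>\<^sup>2\<close> one has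
  \<open>s p + p\<^sup>2 = b (s - k\<^sup>2) b\<^sup>*\<close>, of norm at most \<open>s\<^sup>2\<close>. On the other hand \<open>s p + p\<^sup>2 = 2 p\<^sup>2 + p (s - p)\<close> is at least
  \<open>2 p\<^sup>2\<close>, of norm \<open>2 s\<^sup>2\<close>. Hence \<open>s = 0\<close>.
\<close>
lemma star_mult_self_neg_square:
  assumes b: "b \<in> carrier A" and k: "k \<in> carrier A" "star A k = k"
    and neg: "star A b \<otimes> b = \<ominus> (k \<otimes> k)"
  shows "b = \<zero>"
proof -
  let ?p = "b \<otimes> star A b" and ?s = "(nrm A b)\<^sup>2"
  \<comment> \<open>Twice the real and minus twice the imaginary part of \<open>b\<close>.\<close>
  let ?x = "b \<oplus> star A b" and ?y = "\<i> \<odot> (b \<ominus> star A b)"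
  have pc: "?p \<in> carrier A" "star A ?p = ?p" using b by (auto simp: star_mult)
  have sq: "?x \<otimes> ?x \<oplus> ?y \<otimes> ?y = 2 \<odot> (?p \<oplus> star A b \<otimes> b)"
  proof -
    let ?c = "star A b"
    have x: "?x \<otimes> ?x = (b \<otimes> b \<oplus> ?c \<otimes> ?c) \<oplus> (b \<otimes> ?c \<oplus> ?c \<otimes> b)"
      using b by (simp add: distr_left distr_right V.a_ac)
    have "(b \<ominus> ?c) \<otimes> (b \<ominus> ?c) = (b \<otimes> b \<oplus> ?c \<otimes> ?c) \<ominus> (b \<otimes> ?c \<oplus> ?c \<otimes> b)"
      using b by (simp add: V.minus_eq distr_left distr_right mult_minus_left mult_minus_right V.minus_add V.a_ac)
    then have y: "?y \<otimes> ?y = (b \<otimes> ?c \<oplus> ?c \<otimes> b) \<ominus> (b \<otimes> b \<oplus> ?c \<otimes> ?c)"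
      using b by (simp add: smult_mult_left smult_mult_right scal_minus_left V.minus_eq V.minus_add V.a_ac)
    show ?thesis
      unfolding x y by (rule add_add_diff) (use b in auto)
  qed
  have "pos (?x \<otimes> ?x \<oplus> ?y \<otimes> ?y)"
  proof (intro pos_add pos_square)
    show "star A ?x = ?x" using b by (simp add: star_add V.a_comm)
    have "star A ?y = (- \<i>) \<odot> (star A b \<ominus> b)"
      using b by (simp add: star_smult star_diff)
    also have "\<dots> = ?y"
      using b by (simp add: diff_scal scal_add_right V.a_comm)
    finally show "star A ?y = ?y" .
  qed (use b in auto)
  then have "pos (complex_of_real (1 / 2) \<odot> (2 \<odot> (?p \<oplus> star A b \<otimes> b)))"
    unfolding sq by (intro pos_scale) auto
  then have "pos (?p \<oplus> star A b \<otimes> b)"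
    using b by simp
  from pos_add[OF this pos_square[OF k]] have "pos ?p"
    using b k unfolding neg by (simp add: V.a_assoc V.l_neg)
  then obtain l where l: "pos l" "l \<otimes> l = ?p"
    using pos_sqrt by blast
  note lc = pos_closed[OF l(1)]
  have np: "nrm A ?p = ?s"
    using cstar_identity[of "star A b"] b by simp
  have nk: "(nrm A k)\<^sup>2 = ?s"
    using cstar_identity[OF b] norm_sa_square[OF k] b k unfolding neg by (simp add: norm_minus)
  have "pos (scalar ?s \<ominus> ?p)"
    using np pc by (intro pos_scalar_diff) auto
  then obtain m where m: "pos m" "m \<otimes> m = scalar ?s \<ominus> ?p"
    "\<And>c. \<lbrakk>c \<in> carrier A; c \<otimes> (scalar ?s \<ominus> ?p) = (scalar ?s \<ominus> ?p) \<otimes> c\<rbrakk> \<Longrightarrow> c \<otimes> m = m \<otimes> c"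
    by (rule pos_sqrt) blast
  note mc = pos_closed[OF m(1)]
  have lp: "l \<otimes> ?p = ?p \<otimes> l" using l(2) lc mult_assoc by metis
  have lm: "l \<otimes> m = m \<otimes> l"
    using m(3)[OF lc(1) commute_scalar_diff] lc pc lp by simp
  \<comment> \<open>\<open>p (s - p)\<close> is the square of the product of the commuting roots \<open>l\<close> of \<open>p\<close> and \<open>m\<close> of \<open>s - p\<close>.\<close>
  let ?r = "complex_of_real ?s \<odot> ?p \<ominus> ?p \<otimes> ?p"
  have "pos ((l \<otimes> m) \<otimes> (l \<otimes> m))"
    using lc mc lm by (intro pos_square) (auto simp: star_mult)
  moreover have "(l \<otimes> m) \<otimes> (l \<otimes> m) = ?r"
  proof -
    have "(l \<otimes> m) \<otimes> (l \<otimes> m) = (l \<otimes> m) \<otimes> (m \<otimes> l)" unfolding lm ..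
    also have "\<dots> = l \<otimes> (m \<otimes> m) \<otimes> l"
      using lc mc by (simp add: mult_assoc)
    also have "\<dots> = complex_of_real ?s \<odot> (l \<otimes> l) \<ominus> l \<otimes> (?p \<otimes> l)"
      unfolding m(2) using lc pc
      by (simp add: mult_diff_left mult_diff_right smult_mult_left smult_mult_right mult_assoc)
    also have "l \<otimes> (?p \<otimes> l) = ?p \<otimes> ?p"
      using lc pc lp l(2) mult_assoc by metis
    finally show ?thesis using l(2) by simp
  qed
  ultimately have "pos ?r" by simp
  moreover have "pos (complex_of_real 2 \<odot> (?p \<otimes> ?p))"
    using pc by (intro pos_scale pos_square) auto
  ultimately have "nrm A (complex_of_real 2 \<odot> (?p \<otimes> ?p)) \<le> nrm A (complex_of_real 2 \<odot> (?p \<otimes> ?p) \<oplus> ?r)"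
    by (intro norm_pos_mono)
  moreover have "complex_of_real 2 \<odot> (?p \<otimes> ?p) \<oplus> ?r = b \<otimes> (scalar ?s \<ominus> k \<otimes> k) \<otimes> star A b"
  proof -
    have "complex_of_real 2 \<odot> (?p \<otimes> ?p) \<oplus> ?r = complex_of_real ?s \<odot> ?p \<oplus> ?p \<otimes> ?p"
      using pc scal_add_left[of "?p \<otimes> ?p" 1 1]
      by (simp add: V.minus_eq V.a_ac V.r_neg1 V.r_neg2 V.r_neg)
    also have "\<dots> = complex_of_real ?s \<odot> ?p \<oplus> b \<otimes> (star A b \<otimes> b) \<otimes> star A b"
      using b by (simp add: mult_assoc)
    also have "\<dots> = b \<otimes> (scalar ?s \<ominus> k \<otimes> k) \<otimes> star A b"
      unfolding neg using b k
      by (simp add: distr_left distr_right smult_mult_left smult_mult_right mult_minus_left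
          mult_minus_right V.minus_eq)
    finally show ?thesis .
  qed
  moreover have "nrm A (b \<otimes> (scalar ?s \<ominus> k \<otimes> k) \<otimes> star A b) \<le> ?s * ?s"
  proof -
    have "nrm A (b \<otimes> (scalar ?s \<ominus> k \<otimes> k) \<otimes> star A b)
        \<le> nrm A b * nrm A (scalar ?s \<ominus> k \<otimes> k) * nrm A b"
      using norm_mult[of "b \<otimes> (scalar ?s \<ominus> k \<otimes> k)" "star A b"] norm_mult[of b "scalar ?s \<ominus> k \<otimes> k"] b k
      by (simp, meson mult_right_mono norm_nonneg order_trans)
    also have "\<dots> \<le> nrm A b * ?s * nrm A b"
      using norm_scalar_diff_square[OF k, of ?s] nk norm_nonneg[OF b]
      by (intro mult_right_mono mult_left_mono) (auto simp del: of_real_power)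
    finally show ?thesis by (simp add: power2_eq_square mult_ac)
  qed
  ultimately have "2 * (?s * ?s) \<le> ?s * ?s"
    using norm_sa_square[OF pc] np pc by (simp add: norm_smult power2_eq_square)
  moreover have "0 \<le> ?s * ?s" by simp
  ultimately have "?s * ?s = 0" by linarith
  then have "nrm A b = 0" by simp
  then show ?thesis using norm_eq_zero b by simp
qed

text \<open>
  The theorem of Kelley and Vaught. Let \<open>h = a\<^sup>* a\<close>, let \<open>r\<close> be the positive root of \<open>h\<^sup>2\<close> and \<open>e = r - h\<close>, which is twice the
  negative part of \<open>h\<close>. As \<open>h e = - r e\<close>, the element \<open>b = a e\<close> satisfies \<open>b\<^sup>* b = - e r e\<close>, the negative of a square.
  So \<open>b = 0\<close>, whence \<open>e\<^sup>2 = r e - h e = 0\<close> and \<open>h = r\<close>.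
\<close>
lemma pos_star_mult_self:
  assumes a: "a \<in> carrier A"
  shows "pos (star A a \<otimes> a)"
proof -
  let ?h = "star A a \<otimes> a"
  have h: "?h \<in> carrier A" "star A ?h = ?h" using a by (auto simp: star_mult)
  obtain r where r: "pos r" "r \<otimes> r = ?h \<otimes> ?h"
    "\<And>c. \<lbrakk>c \<in> carrier A; c \<otimes> (?h \<otimes> ?h) = (?h \<otimes> ?h) \<otimes> c\<rbrakk> \<Longrightarrow> c \<otimes> r = r \<otimes> c"
    by (rule pos_sqrt[OF pos_square[OF h]]) blast
  obtain \<rho> where \<rho>: "pos \<rho>" "\<rho> \<otimes> \<rho> = r"
    "\<And>c. \<lbrakk>c \<in> carrier A; c \<otimes> r = r \<otimes> c\<rbrakk> \<Longrightarrow> c \<otimes> \<rho> = \<rho> \<otimes> c"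
    by (rule pos_sqrt[OF r(1)]) blast
  note rc = pos_closed[OF r(1)] and \<rho>c = pos_closed[OF \<rho>(1)]
  have hr: "?h \<otimes> r = r \<otimes> ?h"
    using r(3)[OF h(1)] h mult_assoc[OF h(1) h(1) h(1)] by simp
  let ?e = "r \<ominus> ?h"
  have e: "?e \<in> carrier A" "star A ?e = ?e" using h rc by (auto simp: star_diff)
  have er: "?e \<otimes> r = r \<otimes> ?e"
    unfolding mult_diff_left[OF rc(1) h(1) rc(1)] mult_diff_right[OF rc(1) rc(1) h(1)] hr ..
  have e\<rho>: "?e \<otimes> \<rho> = \<rho> \<otimes> ?e" by (rule \<rho>(3)[OF e(1) er])
  have he: "?h \<otimes> ?e = \<ominus> (r \<otimes> ?e)"
  proof -
    have "?h \<otimes> ?e = r \<otimes> ?h \<ominus> r \<otimes> r"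
      unfolding mult_diff_right[OF h(1) rc(1) h(1)] hr r(2) ..
    also have "\<dots> = \<ominus> (r \<otimes> ?e)"
      unfolding mult_diff_right[OF rc(1) rc(1) h(1)]
      using h rc by (simp add: V.minus_eq V.minus_add V.a_comm)
    finally show ?thesis .
  qed
  have "star A (a \<otimes> ?e) \<otimes> (a \<otimes> ?e) = ?e \<otimes> (?h \<otimes> ?e)"
    using a e by (simp add: star_mult mult_assoc)
  also have "\<dots> = \<ominus> (?e \<otimes> (r \<otimes> ?e))"
    unfolding he by (rule mult_minus_right) (use e rc in auto)
  also have "?e \<otimes> (r \<otimes> ?e) = (\<rho> \<otimes> ?e) \<otimes> (\<rho> \<otimes> ?e)"
    using e(1) \<rho>c(1) e\<rho> \<rho>(2) by (metis mult_assoc mult_closed)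
  finally have "a \<otimes> ?e = \<zero>"
    using a e \<rho>c e\<rho> by (intro star_mult_self_neg_square[of _ "\<rho> \<otimes> ?e"]) (auto simp: star_mult)
  then have "?h \<otimes> ?e = \<zero>"
    using a e by (simp add: mult_assoc)
  then have re: "r \<otimes> ?e = \<zero>"
    using he V.minus_minus[of "r \<otimes> ?e"] mult_closed[OF rc(1) e(1)] by simp
  have "?e \<otimes> ?e = r \<otimes> ?e \<ominus> ?h \<otimes> ?e"
    by (rule mult_diff_left) (use e h rc in auto)
  then have "?e \<otimes> ?e = \<zero>"
    using re \<open>?h \<otimes> ?e = \<zero>\<close> by simp
  then have "nrm A ?e = 0"
    using norm_sa_square[OF e] by simp
  then have "r = ?h"
    using norm_eq_zero[OF e(1)] diff_eq_zero_iff[OF rc(1) h(1)] by simp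
  with r(1) show ?thesis by simp
qed

end

section \<open>Spaces of bounded operators\<close>

text \<open>
  \<open>A\<^sub>l(X, Y)\<close> is the carrier of records of different types, as an algebra and as a bimodule. The vector space
  structure depends on four fields only and is transported along their equality.
\<close>
lemma complex_vspace_subspace:
  fixes V :: "(complex, 'a, 'm) module_scheme" and W :: "(complex, 'a, 'k) module_scheme"
  assumes V: "complex_vspace V" and H: "linear_subspace H V"
    and W: "carrier W = H" "zero W = zero V" "add W = add V" "smult W = smult V"
  shows "complex_vspace W"
proof -
  interpret V: Module.module complex_ring V by fact
  note H = V.submoduleE[OF H]
  have sub: "x \<in> H \<Longrightarrow> x \<in> carrier V" for x using H(1) by blast
  have "abelian_group W"
  proof (rule abelian_groupI)
    fix x assume "x \<in> carrier W"
    then show "\<exists>y\<in>carrier W. y \<oplus>\<^bsub>W\<^esub> x = \<zero>\<^bsub>W\<^esub>"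
      using H(3)[of x] V.l_neg[of x] sub by (auto simp: W)
  next
    show "\<zero>\<^bsub>W\<^esub> \<in> carrier W"
    proof -
      obtain a where "a \<in> H" using H(2) by blast
      then show ?thesis using H(5)[of a "\<ominus>\<^bsub>V\<^esub> a"] H(3)[of a] V.r_neg[of a] sub by (simp add: W)
    qed
  qed (use H(5) sub in \<open>auto simp: W V.a_ac\<close>)
  then show ?thesis
    by (intro moduleI cring_complex_ring)
      (use H(4) sub V.smult_l_distr V.smult_r_distr V.smult_assoc1 V.smult_one in \<open>auto simp: W\<close>)
qed

lemma complex_normed_subspace:
  fixes V :: "(complex, 'a, 'm) module_scheme" and W :: "(complex, 'a, 'k) module_scheme"
  assumes V: "complex_normed V N" and H: "linear_subspace H V"
    and W: "carrier W = H" "zero W = zero V" "add W = add V" "smult W = smult V"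
  shows "complex_normed W N"
proof -
  interpret V: complex_normed V N by fact
  have "H \<subseteq> carrier V" using V.V.submoduleE(1)[OF H] .
  then have sub: "x \<in> H \<Longrightarrow> x \<in> carrier V" for x by blast
  show ?thesis
    using complex_vspace_subspace[OF V.vspace H W] V.norm_nonneg V.norm_eq_zero V.norm_smult
      V.norm_triangle sub
    by (intro complex_normed.intro) (auto simp: W)
qed

lemma complex_banach_cong:
  assumes "complex_banach V N" and eq: "\<And>x. x \<in> carrier V \<Longrightarrow> N' x = N x"
  shows "complex_banach V N'"
proof -
  interpret complex_banach V N by fact
  have "norm_dist V N' = norm_dist V N"
    by (auto simp: norm_dist_def eq fun_eq_iff)
  then show ?thesis
    using vspace norm_nonneg norm_eq_zero norm_smult norm_triangle complete eq
    by (intro complex_banach.intro) auto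
qed

locale normed_pair =
  X: complex_normed X "op_norm X" + Y: complex_normed Y "op_norm Y"
  for X :: "'x opspace" and Y :: "'y opspace"
begin

definition bounded :: "('x \<Rightarrow> 'y) \<Rightarrow> bool" where
  "bounded T \<longleftrightarrow> (\<exists>K. \<forall>x\<in>carrier X. op_norm Y (T x) \<le> K * op_norm X x)"

lemma linear_mapD:
  assumes "linear_map X Y T"
  shows "x \<in> carrier X \<Longrightarrow> T x \<in> carrier Y"
    and "\<lbrakk>x \<in> carrier X; y \<in> carrier X\<rbrakk> \<Longrightarrow> T (x \<oplus>\<^bsub>X\<^esub> y) = T x \<oplus>\<^bsub>Y\<^esub> T y"
    and "x \<in> carrier X \<Longrightarrow> T (c \<odot>\<^bsub>X\<^esub> x) = c \<odot>\<^bsub>Y\<^esub> T x"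
    and "T \<zero>\<^bsub>X\<^esub> = \<zero>\<^bsub>Y\<^esub>"
    and "\<lbrakk>x \<in> carrier X; y \<in> carrier X\<rbrakk> \<Longrightarrow> T (x \<ominus>\<^bsub>X\<^esub> y) = T x \<ominus>\<^bsub>Y\<^esub> T y"
proof -
  have T: "x \<in> carrier X \<Longrightarrow> T x \<in> carrier Y"
    "\<lbrakk>x \<in> carrier X; y \<in> carrier X\<rbrakk> \<Longrightarrow> T (x \<oplus>\<^bsub>X\<^esub> y) = T x \<oplus>\<^bsub>Y\<^esub> T y"
    "x \<in> carrier X \<Longrightarrow> T (c \<odot>\<^bsub>X\<^esub> x) = c \<odot>\<^bsub>Y\<^esub> T x" for x y c
    using assms by (auto simp: linear_map_def)
  show "x \<in> carrier X \<Longrightarrow> T x \<in> carrier Y"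
    "\<lbrakk>x \<in> carrier X; y \<in> carrier X\<rbrakk> \<Longrightarrow> T (x \<oplus>\<^bsub>X\<^esub> y) = T x \<oplus>\<^bsub>Y\<^esub> T y"
    "x \<in> carrier X \<Longrightarrow> T (c \<odot>\<^bsub>X\<^esub> x) = c \<odot>\<^bsub>Y\<^esub> T x" by (fact T)+
  show "T \<zero>\<^bsub>X\<^esub> = \<zero>\<^bsub>Y\<^esub>"
    using T(3)[of "\<zero>\<^bsub>X\<^esub>" 0] T(1)[of "\<zero>\<^bsub>X\<^esub>"] by simp
  show "\<lbrakk>x \<in> carrier X; y \<in> carrier X\<rbrakk> \<Longrightarrow> T (x \<ominus>\<^bsub>X\<^esub> y) = T x \<ominus>\<^bsub>Y\<^esub> T y"
    using T by (simp add: X.diff_scal Y.diff_scal)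
qed

lemma bdd_above_unit_ball:
  assumes "bounded T"
  shows "bdd_above {op_norm Y (T x) |x. x \<in> carrier X \<and> op_norm X x \<le> 1}"
proof -
  obtain K where K: "\<And>x. x \<in> carrier X \<Longrightarrow> op_norm Y (T x) \<le> K * op_norm X x"
    using assms by (auto simp: bounded_def)
  show ?thesis
  proof (rule bdd_aboveI)
    fix a assume "a \<in> {op_norm Y (T x) |x. x \<in> carrier X \<and> op_norm X x \<le> 1}"
    then obtain z where z: "a = op_norm Y (T z)" "z \<in> carrier X" "op_norm X z \<le> 1" by blast
    have "K * op_norm X z \<le> \<bar>K\<bar> * 1"
      using z X.norm_nonneg[OF z(2)] by (intro mult_mono) auto
    then show "a \<le> \<bar>K\<bar>" using K[OF z(2)] z(1) by simp
  qed
qed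

lemma norm_le_bop_norm:
  assumes T: "linear_map X Y T" "bounded T" and x: "x \<in> carrier X"
  shows "op_norm Y (T x) \<le> bop_norm X Y T * op_norm X x"
proof (cases "x = \<zero>\<^bsub>X\<^esub>")
  case True
  then show ?thesis using linear_mapD(4)[OF T(1)] by simp
next
  case False
  let ?r = "op_norm X x"
  have r: "?r > 0"
    using False X.norm_eq_zero[OF x] X.norm_nonneg[OF x] by linarith
  let ?x = "complex_of_real (1 / ?r) \<odot>\<^bsub>X\<^esub> x"
  have x1: "?x \<in> carrier X" "op_norm X ?x = 1"
    using x r by (auto simp: X.norm_smult norm_divide)
  have "op_norm Y (T ?x) \<le> bop_norm X Y T"
    unfolding bop_norm_def using x1 bdd_above_unit_ball[OF T(2)] by (intro cSup_upper) auto
  then have "op_norm Y (T x) / ?r \<le> bop_norm X Y T"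
    using x r linear_mapD[OF T(1)] by (simp add: Y.norm_smult norm_divide)
  then show ?thesis
    using r by (simp add: field_simps)
qed

lemma bop_norm_le:
  assumes "\<And>x. x \<in> carrier X \<Longrightarrow> op_norm Y (T x) \<le> K * op_norm X x" "0 \<le> K"
  shows "bop_norm X Y T \<le> K"
  unfolding bop_norm_def
proof (rule cSup_least)
  show "{op_norm Y (T x) |x. x \<in> carrier X \<and> op_norm X x \<le> 1} \<noteq> {}"
    using X.V.zero_closed by (auto intro!: exI[of _ "\<zero>\<^bsub>X\<^esub>"])
  fix a assume "a \<in> {op_norm Y (T x) |x. x \<in> carrier X \<and> op_norm X x \<le> 1}"
  then obtain z where z: "a = op_norm Y (T z)" "z \<in> carrier X" "op_norm X z \<le> 1" by blast
  then show "a \<le> K"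
    using assms(1)[OF z(2)] mult_left_le[OF z(3) assms(2)] by simp
qed

lemma bop_norm_nonneg:
  assumes "linear_map X Y T" "bounded T"
  shows "0 \<le> bop_norm X Y T"
proof -
  have "op_norm Y (T \<zero>\<^bsub>X\<^esub>) = 0"
    using linear_mapD(4)[OF assms(1)] by simp
  then show ?thesis
    unfolding bop_norm_def using X.V.zero_closed bdd_above_unit_ball[OF assms(2)]
    by (intro cSup_upper) force+
qed

lemma bounded_ops_simps:
  "carrier (bounded_ops X Y) = {T \<in> carrier X \<rightarrow>\<^sub>E carrier Y. linear_map X Y T \<and> bounded T}"
  "zero (bounded_ops X Y) = (\<lambda>x\<in>carrier X. \<zero>\<^bsub>Y\<^esub>)"
  "add (bounded_ops X Y) = (\<lambda>T R. \<lambda>x\<in>carrier X. T x \<oplus>\<^bsub>Y\<^esub> R x)"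
  "smult (bounded_ops X Y) = (\<lambda>c T. \<lambda>x\<in>carrier X. c \<odot>\<^bsub>Y\<^esub> T x)"
  by (auto simp: bounded_ops_def bounded_def)

lemma linear_map_add:
  "\<lbrakk>linear_map X Y T; linear_map X Y R\<rbrakk> \<Longrightarrow> linear_map X Y (\<lambda>x\<in>carrier X. T x \<oplus>\<^bsub>Y\<^esub> R x)"
  by (auto simp: linear_map_def Y.V.a_ac Y.scal_add_right Pi_iff)

lemma linear_map_smult:
  "linear_map X Y T \<Longrightarrow> linear_map X Y (\<lambda>x\<in>carrier X. c \<odot>\<^bsub>Y\<^esub> T x)"
  by (auto simp: linear_map_def Y.scal_add_right Pi_iff mult_ac)

lemma linear_map_zero: "linear_map X Y (\<lambda>x\<in>carrier X. \<zero>\<^bsub>Y\<^esub>)"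
  by (auto simp: linear_map_def)

lemma bop_norm_add:
  assumes T: "linear_map X Y T" "bounded T" and R: "linear_map X Y R" "bounded R"
  shows "bounded (\<lambda>x\<in>carrier X. T x \<oplus>\<^bsub>Y\<^esub> R x)"
    and "bop_norm X Y (\<lambda>x\<in>carrier X. T x \<oplus>\<^bsub>Y\<^esub> R x) \<le> bop_norm X Y T + bop_norm X Y R"
proof -
  have "op_norm Y (T x \<oplus>\<^bsub>Y\<^esub> R x) \<le> (bop_norm X Y T + bop_norm X Y R) * op_norm X x"
    if "x \<in> carrier X" for x
    using Y.norm_triangle[of "T x" "R x"] norm_le_bop_norm[OF T that] norm_le_bop_norm[OF R that]
      linear_mapD(1)[OF T(1)] linear_mapD(1)[OF R(1)] that by (simp add: distrib_right)
  then show "bounded (\<lambda>x\<in>carrier X. T x \<oplus>\<^bsub>Y\<^esub> R x)"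
    and "bop_norm X Y (\<lambda>x\<in>carrier X. T x \<oplus>\<^bsub>Y\<^esub> R x) \<le> bop_norm X Y T + bop_norm X Y R"
    using bop_norm_nonneg[OF T] bop_norm_nonneg[OF R]
    by (auto simp: bounded_def intro!: bop_norm_le)
qed

lemma bop_norm_smult_le:
  assumes T: "linear_map X Y T" "bounded T"
  shows "bounded (\<lambda>x\<in>carrier X. c \<odot>\<^bsub>Y\<^esub> T x)"
    and "bop_norm X Y (\<lambda>x\<in>carrier X. c \<odot>\<^bsub>Y\<^esub> T x) \<le> cmod c * bop_norm X Y T"
proof -
  have "op_norm Y (c \<odot>\<^bsub>Y\<^esub> T x) \<le> (cmod c * bop_norm X Y T) * op_norm X x"
    if "x \<in> carrier X" for x
    using norm_le_bop_norm[OF T that] linear_mapD(1)[OF T(1)] that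
    by (simp add: Y.norm_smult mult_left_mono mult.assoc)
  then show "bounded (\<lambda>x\<in>carrier X. c \<odot>\<^bsub>Y\<^esub> T x)"
    and "bop_norm X Y (\<lambda>x\<in>carrier X. c \<odot>\<^bsub>Y\<^esub> T x) \<le> cmod c * bop_norm X Y T"
    using bop_norm_nonneg[OF T]
    by (auto simp: bounded_def intro!: bop_norm_le)
qed

lemma bop_norm_smult:
  assumes T: "linear_map X Y T" "bounded T" "T \<in> carrier X \<rightarrow>\<^sub>E carrier Y"
  shows "bop_norm X Y (\<lambda>x\<in>carrier X. c \<odot>\<^bsub>Y\<^esub> T x) = cmod c * bop_norm X Y T"
proof (cases "c = 0")
  case True
  have "bop_norm X Y (\<lambda>x\<in>carrier X. c \<odot>\<^bsub>Y\<^esub> T x) \<le> 0"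
    using bop_norm_smult_le(2)[OF T(1,2), of c] True by simp
  moreover have "0 \<le> bop_norm X Y (\<lambda>x\<in>carrier X. c \<odot>\<^bsub>Y\<^esub> T x)"
    by (intro bop_norm_nonneg linear_map_smult T bop_norm_smult_le)
  ultimately show ?thesis using True by simp
next
  case False
  let ?R = "\<lambda>x\<in>carrier X. c \<odot>\<^bsub>Y\<^esub> T x"
  have "(\<lambda>x\<in>carrier X. (1 / c) \<odot>\<^bsub>Y\<^esub> ?R x) = T"
    using False T(3) by (auto simp: fun_eq_iff restrict_def PiE_def extensional_def Pi_iff)
  then have "bop_norm X Y T \<le> bop_norm X Y ?R / cmod c"
    using bop_norm_smult_le(2)[OF linear_map_smult[OF T(1), of c] bop_norm_smult_le(1)[OF T(1,2)], of "1 / c"]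
    by (simp add: norm_divide)
  with bop_norm_smult_le(2)[OF T(1,2), of c] show ?thesis
    using False by (simp add: field_simps)
qed

lemma complex_normed_bounded_ops: "complex_normed (bounded_ops X Y) (bop_norm X Y)"
proof (rule complex_normed.intro)
  let ?W = "bounded_ops X Y"
  have ext: "T = R" if "T \<in> carrier X \<rightarrow>\<^sub>E carrier Y" "R \<in> carrier X \<rightarrow>\<^sub>E carrier Y"
    "\<And>x. x \<in> carrier X \<Longrightarrow> T x = R x" for T R
    using that by (rule PiE_ext)
  have "abelian_group ?W"
  proof (rule abelian_groupI)
    fix T assume "T \<in> carrier ?W"
    then have T: "T \<in> carrier X \<rightarrow>\<^sub>E carrier Y" "linear_map X Y T" "bounded T"
      by (auto simp: bounded_ops_simps)
    let ?S = "\<lambda>x\<in>carrier X. (- 1) \<odot>\<^bsub>Y\<^esub> T x"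
    have "?S \<in> carrier ?W"
      using T linear_map_smult[OF T(2)] bop_norm_smult_le(1)[OF T(2,3)]
      by (auto simp: bounded_ops_simps)
    moreover have "?S \<oplus>\<^bsub>?W\<^esub> T = \<zero>\<^bsub>?W\<^esub>"
      unfolding bounded_ops_simps
      by (rule restrict_ext) (use linear_mapD(1)[OF T(2)] in \<open>simp add: Y.scal_minus_left Y.V.l_neg\<close>)
    ultimately show "\<exists>S\<in>carrier ?W. S \<oplus>\<^bsub>?W\<^esub> T = \<zero>\<^bsub>?W\<^esub>" by blast
  next
    show "\<zero>\<^bsub>?W\<^esub> \<in> carrier ?W"
      by (auto simp: bounded_ops_simps linear_map_zero bounded_def intro!: exI[of _ 0])
  next
    fix T assume "T \<in> carrier ?W"
    then show "\<zero>\<^bsub>?W\<^esub> \<oplus>\<^bsub>?W\<^esub> T = T"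
      by (auto simp: bounded_ops_simps fun_eq_iff PiE_iff extensional_def)
  qed (auto simp: bounded_ops_simps Y.V.a_ac PiE_iff linear_map_add bop_norm_add(1)
      intro!: ext restrict_ext)
  then show "complex_vspace ?W"
  proof (intro moduleI cring_complex_ring)
    fix T assume "T \<in> carrier ?W"
    then show "\<one>\<^bsub>complex_ring\<^esub> \<odot>\<^bsub>?W\<^esub> T = T"
      by (auto simp: bounded_ops_simps fun_eq_iff PiE_iff extensional_def)
  qed (auto simp: bounded_ops_simps PiE_iff Y.scal_add_left Y.scal_add_right linear_map_smult
        bop_norm_smult_le(1) intro!: ext restrict_ext)
  fix T assume "T \<in> carrier ?W"
  then have T: "T \<in> carrier X \<rightarrow>\<^sub>E carrier Y" "linear_map X Y T" "bounded T"
    by (auto simp: bounded_ops_simps)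
  show nn: "0 \<le> bop_norm X Y T" using bop_norm_nonneg[OF T(2,3)] .
  show "bop_norm X Y (c \<odot>\<^bsub>?W\<^esub> T) = cmod c * bop_norm X Y T" for c
    using bop_norm_smult[OF T(2,3,1)] by (simp add: bounded_ops_simps)
  show "(bop_norm X Y T = 0) = (T = \<zero>\<^bsub>?W\<^esub>)"
  proof
    assume 0: "bop_norm X Y T = 0"
    have "T x = \<zero>\<^bsub>Y\<^esub>" if x: "x \<in> carrier X" for x
      using norm_le_bop_norm[OF T(2,3) x] 0 Y.norm_nonneg[of "T x"] Y.norm_eq_zero[of "T x"]
        linear_mapD(1)[OF T(2) x] by simp
    then show "T = \<zero>\<^bsub>?W\<^esub>"
      using T(1) by (intro ext) (auto simp: bounded_ops_simps)
  next
    assume "T = \<zero>\<^bsub>?W\<^esub>"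
    then have "bop_norm X Y T \<le> 0"
      by (intro bop_norm_le) (auto simp: bounded_ops_simps)
    with nn show "bop_norm X Y T = 0" by simp
  qed
  fix R assume "R \<in> carrier ?W"
  then show "bop_norm X Y (T \<oplus>\<^bsub>?W\<^esub> R) \<le> bop_norm X Y T + bop_norm X Y R"
    using bop_norm_add(2)[OF T(2,3)] by (auto simp: bounded_ops_simps)
qed

end

section \<open>Adjointable maps between spaces with an algebra-valued inner product\<close>

definition adjoint_pair ::
  "'x opspace \<Rightarrow> ('b, 'p) cmodule \<Rightarrow> ('x \<Rightarrow> 'p) \<Rightarrow> 'y opspace \<Rightarrow> ('b, 'q) cmodule \<Rightarrow> ('y \<Rightarrow> 'q)
     \<Rightarrow> ('x \<Rightarrow> 'y) \<Rightarrow> ('y \<Rightarrow> 'x) \<Rightarrow> bool" where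
  "adjoint_pair X P i Y Q j T S \<longleftrightarrow>
     T \<in> carrier X \<rightarrow> carrier Y \<and> S \<in> carrier Y \<rightarrow> carrier X \<and> shilov_adjoint X P i Y Q j T S"

lemma adjoint_pairI:
  assumes "\<And>x. x \<in> carrier X \<Longrightarrow> T x \<in> carrier Y" "\<And>y. y \<in> carrier Y \<Longrightarrow> S y \<in> carrier X"
    and "\<And>x y. \<lbrakk>x \<in> carrier X; y \<in> carrier Y\<rbrakk> \<Longrightarrow> rip Q (j (T x)) (j y) = rip P (i x) (i (S y))"
  shows "adjoint_pair X P i Y Q j T S"
  using assms by (auto simp: adjoint_pair_def shilov_adjoint_def)

lemma adjoint_pairD:
  assumes "adjoint_pair X P i Y Q j T S"
  shows "x \<in> carrier X \<Longrightarrow> T x \<in> carrier Y" "y \<in> carrier Y \<Longrightarrow> S y \<in> carrier X"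
    and "\<lbrakk>x \<in> carrier X; y \<in> carrier Y\<rbrakk> \<Longrightarrow> rip Q (j (T x)) (j y) = rip P (i x) (i (S y))"
  using assms by (auto simp: adjoint_pair_def shilov_adjoint_def)

lemma adjoint_pair_compose:
  assumes T: "adjoint_pair X P i Y Q j T S" and T': "adjoint_pair Y Q j Z R k T' S'"
  shows "adjoint_pair X P i Z R k (compose (carrier X) T' T) (compose (carrier Z) S S')"
  using adjoint_pairD[OF T] adjoint_pairD[OF T'] by (intro adjoint_pairI) (auto simp: compose_def)

lemma Al_iff:
  "T \<in> Al X P i Y Q j \<longleftrightarrow> T \<in> carrier X \<rightarrow>\<^sub>E carrier Y \<and> (\<exists>S. adjoint_pair X P i Y Q j T S)"
  by (auto simp: Al_def adjoint_pair_def)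

text \<open>
  The part of the structure of a subspace of a C*-module that \<open>A\<^sub>l\<close> depends on. There is no module action on
  \<open>X\<close>, so the Cauchy-Schwarz inequality is an axiom here. It is satisfied by a C*-algebra with
  \<open>\<langle>a | b\<rangle> = a\<^sup>* b\<close>, by submultiplicativity of the norm, and later by subspaces of C*-modules.
\<close>
locale cstar_form =
  fixes B :: "'b cstar" and X :: "'x opspace" and P :: "('b, 'p) cmodule" and i :: "'x \<Rightarrow> 'p"
  assumes coefficients: "cstar_algebra B"
    and space: "complex_banach X (op_norm X)"
    and form_closed:
      "\<lbrakk>x \<in> carrier X; y \<in> carrier X\<rbrakk> \<Longrightarrow> rip P (i x) (i y) \<in> carrier B"
    and form_add: "\<lbrakk>x \<in> carrier X; y \<in> carrier X; z \<in> carrier X\<rbrakk>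
      \<Longrightarrow> rip P (i x) (i (y \<oplus>\<^bsub>X\<^esub> z)) = rip P (i x) (i y) \<oplus>\<^bsub>B\<^esub> rip P (i x) (i z)"
    and form_smult: "\<lbrakk>x \<in> carrier X; y \<in> carrier X\<rbrakk>
      \<Longrightarrow> rip P (i x) (i (c \<odot>\<^bsub>X\<^esub> y)) = c \<odot>\<^bsub>B\<^esub> rip P (i x) (i y)"
    and form_star: "\<lbrakk>x \<in> carrier X; y \<in> carrier X\<rbrakk>
      \<Longrightarrow> star B (rip P (i x) (i y)) = rip P (i y) (i x)"
    and form_norm: "x \<in> carrier X \<Longrightarrow> nrm B (rip P (i x) (i x)) = (op_norm X x)\<^sup>2"
    and cauchy_schwarz: "\<lbrakk>x \<in> carrier X; y \<in> carrier X\<rbrakk>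
      \<Longrightarrow> nrm B (rip P (i x) (i y)) \<le> op_norm X x * op_norm X y"
    and form_positive: "x \<in> carrier X \<Longrightarrow> cstar_positive B (rip P (i x) (i x))"
begin

abbreviation form :: "'x \<Rightarrow> 'x \<Rightarrow> 'b" where
  "form x y \<equiv> rip P (i x) (i y)"

sublocale B: cstar_algebra B by (rule coefficients)

sublocale complex_banach X "op_norm X" by (rule space)

lemma form_add_left:
  assumes "x \<in> carrier X" "y \<in> carrier X" "z \<in> carrier X"
  shows "form (x \<oplus>\<^bsub>X\<^esub> y) z = form x z \<oplus>\<^bsub>B\<^esub> form y z"
proof -
  have "star B (form z (x \<oplus>\<^bsub>X\<^esub> y)) = star B (form z x) \<oplus>\<^bsub>B\<^esub> star B (form z y)"
    using assms by (simp add: form_add form_closed B.star_add)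
  then show ?thesis using assms by (simp add: form_star)
qed

lemma form_smult_left:
  assumes "x \<in> carrier X" "y \<in> carrier X"
  shows "form (c \<odot>\<^bsub>X\<^esub> x) y = cnj c \<odot>\<^bsub>B\<^esub> form x y"
proof -
  have "star B (form y (c \<odot>\<^bsub>X\<^esub> x)) = cnj c \<odot>\<^bsub>B\<^esub> star B (form y x)"
    using assms by (simp add: form_smult form_closed B.star_smult)
  then show ?thesis using assms by (simp add: form_star)
qed

lemma form_diff:
  "\<lbrakk>x \<in> carrier X; y \<in> carrier X; z \<in> carrier X\<rbrakk>
    \<Longrightarrow> form x (y \<ominus>\<^bsub>X\<^esub> z) = form x y \<ominus>\<^bsub>B\<^esub> form x z"
  using form_smult[of x z "- 1"] by (simp add: diff_scal B.diff_scal form_add form_closed)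

lemma form_diff_left:
  "\<lbrakk>x \<in> carrier X; y \<in> carrier X; z \<in> carrier X\<rbrakk>
    \<Longrightarrow> form (x \<ominus>\<^bsub>X\<^esub> y) z = form x z \<ominus>\<^bsub>B\<^esub> form y z"
  using form_smult_left[of y z "- 1"] by (simp add: diff_scal B.diff_scal form_add_left form_closed)

lemma form_separates:
  assumes x: "x \<in> carrier X" "y \<in> carrier X"
    and eq: "\<And>z. z \<in> carrier X \<Longrightarrow> form x z = form y z"
  shows "x = y"
proof -
  have "form (x \<ominus>\<^bsub>X\<^esub> y) (x \<ominus>\<^bsub>X\<^esub> y) = \<zero>\<^bsub>B\<^esub>"
    using x eq[of "x \<ominus>\<^bsub>X\<^esub> y"] by (simp add: form_diff_left form_closed)
  then have "(op_norm X (x \<ominus>\<^bsub>X\<^esub> y))\<^sup>2 = 0"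
    using form_norm[of "x \<ominus>\<^bsub>X\<^esub> y"] x by simp
  then show ?thesis
    using x norm_eq_zero[of "x \<ominus>\<^bsub>X\<^esub> y"] diff_eq_zero_iff by simp
qed

lemma form_separates_right:
  assumes x: "x \<in> carrier X" "y \<in> carrier X"
    and eq: "\<And>z. z \<in> carrier X \<Longrightarrow> form z x = form z y"
  shows "x = y"
proof (rule form_separates[OF x])
  fix z assume z: "z \<in> carrier X"
  then have "star B (form z x) = star B (form z y)" using eq by simp
  then show "form x z = form y z" using z x by (simp add: form_star)
qed

lemma tends_form_left:
  assumes "tends u x" "y \<in> carrier X"
  shows "B.tends (\<lambda>n. form (u n) y) (form x y)"
proof -
  note u = tendsD[OF assms(1)]
  have "(\<lambda>n. op_norm X (u n \<ominus>\<^bsub>X\<^esub> x) * op_norm X y) \<longlonglongrightarrow> 0 * op_norm X y"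
    by (intro tendsto_mult u tendsto_const)
  then show ?thesis
    using u assms(2) cauchy_schwarz[of "u _ \<ominus>\<^bsub>X\<^esub> x" y]
    by (intro B.tends_dominated[where t = "\<lambda>n. op_norm X (u n \<ominus>\<^bsub>X\<^esub> x) * op_norm X y"])
      (auto simp: form_closed form_diff_left[symmetric])
qed

lemma tends_form_right:
  assumes "tends u x" "y \<in> carrier X"
  shows "B.tends (\<lambda>n. form y (u n)) (form y x)"
  using B.tends_star[OF tends_form_left[OF assms]] tendsD[OF assms(1)] assms(2)
  by (simp add: form_star)

end

locale cstar_form_pair =
  X: cstar_form B X P i + Y: cstar_form B Y Q j
  for B :: "'b cstar" and X :: "'x opspace" and P :: "('b, 'p) cmodule" and i :: "'x \<Rightarrow> 'p"
    and Y :: "'y opspace" and Q :: "('b, 'q) cmodule" and j :: "'y \<Rightarrow> 'q"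
begin

sublocale normed_pair X Y by unfold_locales

abbreviation adj :: "('x \<Rightarrow> 'y) \<Rightarrow> ('y \<Rightarrow> 'x) \<Rightarrow> bool" where
  "adj \<equiv> adjoint_pair X P i Y Q j"

lemma swap: "cstar_form_pair B Y Q j X P i"
  by unfold_locales

lemma adj_swap:
  assumes "adj T S"
  shows "adjoint_pair Y Q j X P i S T"
proof (rule adjoint_pairI)
  fix y x assume xy: "y \<in> carrier Y" "x \<in> carrier X"
  note T = adjoint_pairD[OF assms]
  show "X.form (S y) x = Y.form y (T x)"
    using X.form_star[OF xy(2) T(2)[OF xy(1)]] Y.form_star[OF T(1)[OF xy(2)] xy(1)] T(3)[OF xy(2,1)]
    by simp
qed (use adjoint_pairD[OF assms] in auto)

lemma adj_unique:
  assumes "adj T S" "adj T S'" "y \<in> carrier Y"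
  shows "S y = S' y"
  using adjoint_pairD[OF assms(1)] adjoint_pairD[OF assms(2)] assms(3)
  by (intro X.form_separates_right) auto

text \<open>
  \<open>T x\<close> is determined by the values \<open>\<langle>T x | y\<rangle> = \<langle>x | S y\<rangle>\<close>, which are conjugate-linear in \<open>x\<close>.
\<close>
lemma adj_linear:
  assumes "adj T S"
  shows "linear_map X Y T"
  unfolding linear_map_def
proof (intro conjI ballI allI)
  note T = adjoint_pairD[OF assms]
  show "T \<in> carrier X \<rightarrow> carrier Y" using T by auto
  show "T (x \<oplus>\<^bsub>X\<^esub> y) = T x \<oplus>\<^bsub>Y\<^esub> T y" if "x \<in> carrier X" "y \<in> carrier X" for x y
    using T that by (intro Y.form_separates) (auto simp: Y.form_add_left X.form_add_left)
  show "T (c \<odot>\<^bsub>X\<^esub> x) = c \<odot>\<^bsub>Y\<^esub> T x" if "x \<in> carrier X" for c x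
    using T that by (intro Y.form_separates) (auto simp: Y.form_smult_left X.form_smult_left)
qed

text \<open>
  Everywhere defined maps with an adjoint are bounded (Hellinger and Toeplitz): the sets of points \<open>x\<close> with
  \<open>\<parallel>T x\<parallel> \<le> n\<close> are closed, because \<open>T x\<close> is determined by the continuous functions
  \<open>\<langle>x | S y\<rangle>\<close> of \<open>x\<close>, and by Baire one of them has an interior point.
\<close>

lemma adj_bounded:
  assumes "adj T S"
  shows "bounded T"
proof -
  note T = adjoint_pairD[OF assms] and lin = linear_mapD[OF adj_linear[OF assms]]
  define F where "F n = {x \<in> carrier X. op_norm Y (T x) \<le> real n}" for n :: nat
  have closed: "closedin (norm_topology X (op_norm X)) (F n)" for n
    unfolding X.closedin_iff_sequentially
  proof (intro conjI allI impI)
    fix x l assume x: "\<forall>k. x k \<in> F n" and l: "X.tends x l"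
    have lc: "l \<in> carrier X" and xc: "x k \<in> carrier X" for k
      using X.tendsD[OF l] by auto
    have "X.B.tends (\<lambda>k. X.form (x k) (S (T l))) (X.form l (S (T l)))"
      using lc T by (intro X.tends_form_left l) auto
    then have "(\<lambda>k. nrm B (X.form (x k) (S (T l)))) \<longlonglongrightarrow> nrm B (X.form l (S (T l)))"
      by (rule X.B.tends_norm)
    then have "(\<lambda>k. nrm B (Y.form (T (x k)) (T l))) \<longlonglongrightarrow> nrm B (Y.form (T l) (T l))"
      using T xc lc by simp
    moreover have "nrm B (Y.form (T (x k)) (T l)) \<le> real n * op_norm Y (T l)" for k
    proof -
      have "nrm B (Y.form (T (x k)) (T l)) \<le> op_norm Y (T (x k)) * op_norm Y (T l)"
        using T xc lc by (intro Y.cauchy_schwarz) auto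
      also have "\<dots> \<le> real n * op_norm Y (T l)"
        using x T lc by (intro mult_right_mono) (auto simp: F_def Y.norm_nonneg)
      finally show ?thesis .
    qed
    ultimately have "nrm B (Y.form (T l) (T l)) \<le> real n * op_norm Y (T l)"
      by (intro LIMSEQ_le_const2) auto
    then have "op_norm Y (T l) * op_norm Y (T l) \<le> real n * op_norm Y (T l)"
      using Y.form_norm[OF T(1)[OF lc]] by (simp add: power2_eq_square)
    then have "op_norm Y (T l) \<le> real n"
      using Y.norm_nonneg[OF T(1)[OF lc]] by (cases "op_norm Y (T l) = 0") auto
    then show "l \<in> F n" using lc by (simp add: F_def)
  qed (auto simp: F_def)
  have cover: "\<Union> (range F) = carrier X"
  proof
    show "carrier X \<subseteq> \<Union> (range F)"
    proof
      fix x assume "x \<in> carrier X"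
      moreover obtain n :: nat where "op_norm Y (T x) \<le> real n" using real_arch_simple by blast
      ultimately show "x \<in> \<Union> (range F)" by (auto simp: F_def)
    qed
  qed (auto simp: F_def)
  have "\<exists>n. X.M.mtopology interior_of (F n) \<noteq> {}"
  proof (rule ccontr)
    assume "\<not> (\<exists>n. X.M.mtopology interior_of (F n) \<noteq> {})"
    then have "X.M.mtopology interior_of \<Union> (range F) = {}"
      using closed by (intro X.M.metric_Baire_category_alt X.complete) (auto simp: norm_topology_def)
    then have "carrier X = {}"
      unfolding cover by (metis X.M.topspace_mtopology interior_of_topspace)
    then show False using X.V.zero_closed by blast
  qed
  then obtain n x0 \<epsilon> where x0: "x0 \<in> carrier X" and e: "\<epsilon> > 0" and ball: "X.M.mball x0 \<epsilon> \<subseteq> F n"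
    by (auto simp: X.M.metric_interior_of)
  have "op_norm Y (T x) \<le> (4 * real n / \<epsilon>) * op_norm X x" if x: "x \<in> carrier X" for x
  proof (cases "x = \<zero>\<^bsub>X\<^esub>")
    case True
    then show ?thesis using lin(4) by simp
  next
    case False
    let ?r = "op_norm X x"
    have r: "?r > 0" using False X.norm_eq_zero[OF x] X.norm_nonneg[OF x] by linarith
    \<comment> \<open>Scaled so that \<open>x0 - c x\<close> stays in the ball around \<open>x0\<close>.\<close>
    define c where "c = complex_of_real (\<epsilon> / (2 * ?r))"
    have "x0 \<ominus>\<^bsub>X\<^esub> (x0 \<ominus>\<^bsub>X\<^esub> c \<odot>\<^bsub>X\<^esub> x) = c \<odot>\<^bsub>X\<^esub> x"
      using x x0 by (simp add: X.diff_diff_cancel)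
    moreover have "op_norm X (c \<odot>\<^bsub>X\<^esub> x) < \<epsilon>"
      using r e x by (simp add: X.norm_smult c_def norm_divide norm_mult)
    ultimately have "x0 \<ominus>\<^bsub>X\<^esub> c \<odot>\<^bsub>X\<^esub> x \<in> X.M.mball x0 \<epsilon>"
      using x x0 by (simp add: norm_dist_def)
    then have 1: "op_norm Y (T (x0 \<ominus>\<^bsub>X\<^esub> c \<odot>\<^bsub>X\<^esub> x)) \<le> real n"
      using ball by (auto simp: F_def)
    have "x0 \<in> F n" using x0 e by (intro subsetD[OF ball]) simp
    then have 2: "op_norm Y (T x0) \<le> real n"
      by (simp add: F_def)
    have "c \<odot>\<^bsub>Y\<^esub> T x = T x0 \<ominus>\<^bsub>Y\<^esub> T (x0 \<ominus>\<^bsub>X\<^esub> c \<odot>\<^bsub>X\<^esub> x)"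
      using lin x x0 by (simp add: Y.diff_diff_cancel)
    then have "op_norm Y (c \<odot>\<^bsub>Y\<^esub> T x) \<le> real n + real n"
      using Y.norm_diff_le[of "T x0" "T (x0 \<ominus>\<^bsub>X\<^esub> c \<odot>\<^bsub>X\<^esub> x)"] 1 2 T x x0 by simp
    then have "\<epsilon> / (2 * ?r) * op_norm Y (T x) \<le> 2 * real n"
      using T x r e by (simp add: Y.norm_smult c_def norm_divide norm_mult)
    then show ?thesis using r e by (simp add: field_simps)
  qed
  then show ?thesis unfolding bounded_def by blast
qed

lemma adj_norm_le:
  "\<lbrakk>adj T S; x \<in> carrier X\<rbrakk> \<Longrightarrow> op_norm Y (T x) \<le> bop_norm X Y T * op_norm X x"
  by (intro norm_le_bop_norm adj_linear adj_bounded)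

lemma adj_norm_nonneg: "adj T S \<Longrightarrow> 0 \<le> bop_norm X Y T"
  by (intro bop_norm_nonneg adj_linear adj_bounded)

lemma adj_add:
  assumes "adj T S" "adj T' S'"
  shows "adj (\<lambda>x\<in>carrier X. T x \<oplus>\<^bsub>Y\<^esub> T' x) (\<lambda>y\<in>carrier Y. S y \<oplus>\<^bsub>X\<^esub> S' y)"
  using adjoint_pairD[OF assms(1)] adjoint_pairD[OF assms(2)]
  by (intro adjoint_pairI) (auto simp: Y.form_add_left X.form_add)

lemma adj_smult:
  assumes "adj T S"
  shows "adj (\<lambda>x\<in>carrier X. c \<odot>\<^bsub>Y\<^esub> T x) (\<lambda>y\<in>carrier Y. cnj c \<odot>\<^bsub>X\<^esub> S y)"
  using adjoint_pairD[OF assms] by (intro adjoint_pairI) (auto simp: Y.form_smult_left X.form_smult)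

lemma adj_zero: "adj (\<lambda>x\<in>carrier X. \<zero>\<^bsub>Y\<^esub>) (\<lambda>y\<in>carrier Y. \<zero>\<^bsub>X\<^esub>)"
  using Y.form_smult_left[of "\<zero>\<^bsub>Y\<^esub>" _ 0] X.form_smult[of _ "\<zero>\<^bsub>X\<^esub>" 0]
  by (intro adjoint_pairI) (auto simp: X.form_closed Y.form_closed)

lemma adj_tends:
  assumes T: "\<And>n. adj (T n) (S n)"
    and t: "\<And>x. x \<in> carrier X \<Longrightarrow> Y.tends (\<lambda>n. T n x) (T' x)"
    and s: "\<And>y. y \<in> carrier Y \<Longrightarrow> X.tends (\<lambda>n. S n y) (S' y)"
  shows "adj T' S'"
proof (rule adjoint_pairI)
  fix x y assume xy: "x \<in> carrier X" "y \<in> carrier Y"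
  have "X.B.tends (\<lambda>n. Y.form (T n x) y) (Y.form (T' x) y)"
    using xy t by (intro Y.tends_form_left) auto
  moreover have "X.B.tends (\<lambda>n. Y.form (T n x) y) (X.form x (S' y))"
    unfolding adjoint_pairD(3)[OF T xy] using xy s by (intro X.tends_form_right) auto
  ultimately show "Y.form (T' x) y = X.form x (S' y)"
    by (rule X.B.tends_unique)
qed (use Y.tendsD(1)[OF t] X.tendsD(1)[OF s] in auto)

text \<open>The adjoint does not increase the norm: \<open>\<parallel>T x\<parallel>\<^sup>2 = \<parallel>\<langle>x | S (T x)\<rangle>\<parallel> \<le> \<parallel>x\<parallel> \<parallel>S\<parallel> \<parallel>T x\<parallel>\<close>.\<close>

lemma adj_norm_le_adjoint:
  assumes "adj T S"
  shows "bop_norm X Y T \<le> bop_norm Y X S"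
proof -
  interpret YX: cstar_form_pair B Y Q j X P i by (rule swap)
  note T = adjoint_pairD[OF assms] and S = adj_swap[OF assms]
  show ?thesis
  proof (rule bop_norm_le[OF _ YX.adj_norm_nonneg[OF S]])
    fix x assume x: "x \<in> carrier X"
    let ?t = "op_norm Y (T x)"
    have "?t * ?t = nrm B (X.form x (S (T x)))"
      using Y.form_norm[of "T x"] T x by (simp add: power2_eq_square)
    also have "\<dots> \<le> op_norm X x * op_norm X (S (T x))"
      using T x by (intro X.cauchy_schwarz) auto
    also have "\<dots> \<le> op_norm X x * (bop_norm Y X S * ?t)"
      using T x by (intro mult_left_mono YX.adj_norm_le[OF S]) (auto simp: X.norm_nonneg)
    finally have "?t * ?t \<le> (bop_norm Y X S * op_norm X x) * ?t"
      by (simp add: mult_ac)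
    then show "?t \<le> bop_norm Y X S * op_norm X x"
      using Y.norm_nonneg[of "T x"] X.norm_nonneg[OF x] YX.adj_norm_nonneg[OF S] T x
      by (cases "?t = 0") auto
  qed
qed

text \<open>
  \<open>\<parallel>T x\<parallel>\<^sup>2 = \<parallel>\<langle>x | S T x\<rangle>\<parallel> \<le> \<parallel>S T\<parallel> \<parallel>x\<parallel>\<^sup>2\<close> gives one inequality, \<open>\<parallel>S\<parallel> = \<parallel>T\<parallel>\<close> the other.
\<close>
lemma adj_cstar_identity:
  assumes "adj T S"
  shows "bop_norm X X (compose (carrier X) S T) = (bop_norm X Y T)\<^sup>2"
proof (rule antisym)
  interpret YX: cstar_form_pair B Y Q j X P i by (rule swap)
  interpret XX: cstar_form_pair B X P i X P i by unfold_locales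
  note T = adjoint_pairD[OF assms] and S = adj_swap[OF assms]
  note A = adjoint_pair_compose[OF assms S]
  have nT: "0 \<le> bop_norm X Y T" using adj_norm_nonneg[OF assms] .
  have nS: "bop_norm Y X S = bop_norm X Y T"
    using adj_norm_le_adjoint[OF assms] YX.adj_norm_le_adjoint[OF S] by simp
  show "bop_norm X X (compose (carrier X) S T) \<le> (bop_norm X Y T)\<^sup>2"
  proof (rule XX.bop_norm_le)
    fix x assume x: "x \<in> carrier X"
    have "op_norm X (S (T x)) \<le> bop_norm X Y T * op_norm Y (T x)"
      using YX.adj_norm_le[OF S, of "T x"] T x nS by simp
    also have "\<dots> \<le> bop_norm X Y T * (bop_norm X Y T * op_norm X x)"
      using adj_norm_le[OF assms x] nT by (intro mult_left_mono)
    finally show "op_norm X (compose (carrier X) S T x) \<le> (bop_norm X Y T)\<^sup>2 * op_norm X x"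
      using x by (simp add: compose_def power2_eq_square mult_ac)
  qed simp
  let ?a = "bop_norm X X (compose (carrier X) S T)"
  have na: "0 \<le> ?a" using XX.adj_norm_nonneg[OF A] .
  have "bop_norm X Y T \<le> sqrt ?a"
  proof (rule bop_norm_le)
    fix x assume x: "x \<in> carrier X"
    have "(op_norm Y (T x))\<^sup>2 = nrm B (X.form x (S (T x)))"
      using Y.form_norm[of "T x"] T x by simp
    also have "\<dots> \<le> op_norm X x * op_norm X (S (T x))"
      using T x by (intro X.cauchy_schwarz) auto
    also have "\<dots> \<le> op_norm X x * (?a * op_norm X x)"
      using XX.adj_norm_le[OF A x] x by (intro mult_left_mono) (auto simp: compose_def X.norm_nonneg)
    also have "\<dots> = (sqrt ?a * op_norm X x)\<^sup>2"
      using na by (simp add: power_mult_distrib power2_eq_square[of "op_norm X x"])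
    finally show "op_norm Y (T x) \<le> sqrt ?a * op_norm X x"
      by (rule power2_le_imp_le) (use na x X.norm_nonneg in auto)
  qed (use na in simp)
  then have "(bop_norm X Y T)\<^sup>2 \<le> (sqrt ?a)\<^sup>2" using nT by (rule power_mono)
  then show "(bop_norm X Y T)\<^sup>2 \<le> ?a" using na by simp
qed

end

context cstar_form_pair
begin

abbreviation AlXY :: "('x \<Rightarrow> 'y) set" where
  "AlXY \<equiv> Al X P i Y Q j"

lemma Al_adj_unique:
  assumes "adj T S"
  shows "Al_adj X P i Y Q j T = restrict S (carrier Y)"
  unfolding Al_adj_def
proof (rule the_equality)
  have "adj T (restrict S (carrier Y))"
    using adjoint_pairD[OF assms] by (intro adjoint_pairI) auto
  then show "restrict S (carrier Y) \<in> carrier Y \<rightarrow>\<^sub>E carrier X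
      \<and> shilov_adjoint X P i Y Q j T (restrict S (carrier Y))"
    using adjoint_pairD(2)[OF assms] by (auto simp: adjoint_pair_def)
  fix S' assume S': "S' \<in> carrier Y \<rightarrow>\<^sub>E carrier X \<and> shilov_adjoint X P i Y Q j T S'"
  then have "adj T S'"
    using assms by (auto simp: adjoint_pair_def)
  then show "S' = restrict S (carrier Y)"
    using S' adj_unique[OF _ assms] by (auto simp: fun_eq_iff PiE_iff extensional_def)
qed

lemma Al_adj:
  assumes "T \<in> AlXY"
  shows "adj T (Al_adj X P i Y Q j T)"
    and "Al_adj X P i Y Q j T \<in> Al Y Q j X P i"
    and "Al_adj Y Q j X P i (Al_adj X P i Y Q j T) = T"
proof -
  interpret YX: cstar_form_pair B Y Q j X P i by (rule swap)
  obtain S where S: "adj T S" and T: "T \<in> carrier X \<rightarrow>\<^sub>E carrier Y"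
    using assms by (auto simp: Al_iff)
  have S': "adj T (restrict S (carrier Y))"
    using adjoint_pairD[OF S] by (intro adjoint_pairI) auto
  then show "adj T (Al_adj X P i Y Q j T)" by (simp add: Al_adj_unique[OF S])
  show "Al_adj X P i Y Q j T \<in> Al Y Q j X P i"
    unfolding Al_adj_unique[OF S] Al_iff using adj_swap[OF S'] adjoint_pairD(2)[OF S] by auto
  show "Al_adj Y Q j X P i (Al_adj X P i Y Q j T) = T"
    unfolding Al_adj_unique[OF S] YX.Al_adj_unique[OF adj_swap[OF S']]
    using T by (simp add: PiE_restrict)
qed

lemma Al_mem: "\<lbrakk>T \<in> AlXY; x \<in> carrier X\<rbrakk> \<Longrightarrow> T x \<in> carrier Y"
  by (auto simp: Al_def)

lemma Al_subset: "AlXY \<subseteq> carrier (bounded_ops X Y)"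
  by (auto simp: Al_iff bounded_ops_simps adj_linear adj_bounded)

lemma Al_linear: "T \<in> AlXY \<Longrightarrow> linear_map X Y T"
  using Al_adj(1) adj_linear by blast

lemma Al_bop_norm:
  assumes "T \<in> AlXY"
  shows "x \<in> carrier X \<Longrightarrow> op_norm Y (T x) \<le> bop_norm X Y T * op_norm X x"
    and "0 \<le> bop_norm X Y T"
    and "bop_norm Y X (Al_adj X P i Y Q j T) = bop_norm X Y T"
    and "bop_norm X X (compose (carrier X) (Al_adj X P i Y Q j T) T) = (bop_norm X Y T)\<^sup>2"
proof -
  interpret YX: cstar_form_pair B Y Q j X P i by (rule swap)
  note T = Al_adj[OF assms]
  show "x \<in> carrier X \<Longrightarrow> op_norm Y (T x) \<le> bop_norm X Y T * op_norm X x"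
    by (rule adj_norm_le[OF T(1)])
  show "0 \<le> bop_norm X Y T" by (rule adj_norm_nonneg[OF T(1)])
  show "bop_norm Y X (Al_adj X P i Y Q j T) = bop_norm X Y T"
    using adj_norm_le_adjoint[OF T(1)] YX.adj_norm_le_adjoint[OF adj_swap[OF T(1)]] by simp
  show "bop_norm X X (compose (carrier X) (Al_adj X P i Y Q j T) T) = (bop_norm X Y T)\<^sup>2"
    by (rule adj_cstar_identity[OF T(1)])
qed

lemma Al_add:
  assumes "T \<in> AlXY" "R \<in> AlXY"
  shows "T \<oplus>\<^bsub>bounded_ops X Y\<^esub> R \<in> AlXY"
    and "Al_adj X P i Y Q j (T \<oplus>\<^bsub>bounded_ops X Y\<^esub> R)
      = Al_adj X P i Y Q j T \<oplus>\<^bsub>bounded_ops Y X\<^esub> Al_adj X P i Y Q j R"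
proof -
  interpret YX: cstar_form_pair B Y Q j X P i by (rule swap)
  note a = adj_add[OF Al_adj(1)[OF assms(1)] Al_adj(1)[OF assms(2)]]
  show "T \<oplus>\<^bsub>bounded_ops X Y\<^esub> R \<in> AlXY"
    using a Al_mem assms by (auto simp: Al_iff[of "\<lambda>x\<in>carrier X. T x \<oplus>\<^bsub>Y\<^esub> R x"] bounded_ops_simps)
  show "Al_adj X P i Y Q j (T \<oplus>\<^bsub>bounded_ops X Y\<^esub> R)
      = Al_adj X P i Y Q j T \<oplus>\<^bsub>bounded_ops Y X\<^esub> Al_adj X P i Y Q j R"
    unfolding bounded_ops_simps YX.bounded_ops_simps Al_adj_unique[OF a] by simp
qed

lemma Al_smult:
  assumes "T \<in> AlXY"
  shows "c \<odot>\<^bsub>bounded_ops X Y\<^esub> T \<in> AlXY"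
    and "Al_adj X P i Y Q j (c \<odot>\<^bsub>bounded_ops X Y\<^esub> T)
      = cnj c \<odot>\<^bsub>bounded_ops Y X\<^esub> Al_adj X P i Y Q j T"
proof -
  interpret YX: cstar_form_pair B Y Q j X P i by (rule swap)
  note a = adj_smult[OF Al_adj(1)[OF assms(1)], of c]
  show "c \<odot>\<^bsub>bounded_ops X Y\<^esub> T \<in> AlXY"
    using a Al_mem assms by (auto simp: Al_iff[of "\<lambda>x\<in>carrier X. c \<odot>\<^bsub>Y\<^esub> T x"] bounded_ops_simps)
  show "Al_adj X P i Y Q j (c \<odot>\<^bsub>bounded_ops X Y\<^esub> T)
      = cnj c \<odot>\<^bsub>bounded_ops Y X\<^esub> Al_adj X P i Y Q j T"
    unfolding bounded_ops_simps YX.bounded_ops_simps Al_adj_unique[OF a] by simp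
qed

sublocale BXY: complex_normed "bounded_ops X Y" "bop_norm X Y"
  by (rule complex_normed_bounded_ops)

lemma Al_subspace: "linear_subspace AlXY (bounded_ops X Y)"
proof (rule BXY.V.submoduleI[OF Al_subset])
  show "\<zero>\<^bsub>bounded_ops X Y\<^esub> \<in> AlXY"
    using adj_zero by (auto simp: Al_iff bounded_ops_simps)
  show "c \<odot>\<^bsub>bounded_ops X Y\<^esub> T \<in> AlXY" if "T \<in> AlXY" for c T
    using Al_smult(1)[OF that] .
  show "T \<oplus>\<^bsub>bounded_ops X Y\<^esub> R \<in> AlXY" if "T \<in> AlXY" "R \<in> AlXY" for T R
    using Al_add(1)[OF that] .
  show "\<ominus>\<^bsub>bounded_ops X Y\<^esub> T \<in> AlXY" if "T \<in> AlXY" for T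
    using Al_smult(1)[OF that, of "- 1"] that Al_subset
    by (subst BXY.minus_scal) auto
qed

text \<open>
  A Cauchy sequence in \<open>A\<^sub>l(X, Y)\<close> converges pointwise, and so do the adjoints, which form a Cauchy sequence
  as well; the adjoint relation passes to the limit.
\<close>

lemma Al_complete:
  fixes W :: "(complex, 'x \<Rightarrow> 'y, 'm) module_scheme"
  assumes W: "carrier W = AlXY" "zero W = zero (bounded_ops X Y)"
    "add W = add (bounded_ops X Y)" "smult W = smult (bounded_ops X Y)"
  shows "complex_banach W (bop_norm X Y)"
proof -
  interpret YX: cstar_form_pair B Y Q j X P i by (rule swap)
  have Wn: "complex_normed W (bop_norm X Y)"
    by (rule complex_normed_subspace[OF complex_normed_bounded_ops Al_subspace W])
  interpret W: complex_normed W "bop_norm X Y" by (rule Wn)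
  have diff_Al: "T \<ominus>\<^bsub>W\<^esub> R \<in> AlXY" if "T \<in> AlXY" "R \<in> AlXY" for T R
    using W.diff_closed that W(1) by simp
  have diff: "(T \<ominus>\<^bsub>W\<^esub> R) x = T x \<ominus>\<^bsub>Y\<^esub> R x" if "T \<in> AlXY" "R \<in> AlXY" "x \<in> carrier X" for T R x
    using that Al_mem[OF that(2,3)] by (simp add: W.diff_scal W bounded_ops_simps Y.diff_scal)
  have adj_diff: "Al_adj X P i Y Q j (T \<ominus>\<^bsub>W\<^esub> R)
      = Al_adj X P i Y Q j T \<ominus>\<^bsub>bounded_ops Y X\<^esub> Al_adj X P i Y Q j R" if "T \<in> AlXY" "R \<in> AlXY" for T R
    using that Al_smult[OF that(2), of "- 1"] Al_add(2)[OF that(1), of "(- 1) \<odot>\<^bsub>bounded_ops X Y\<^esub> R"]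
      Al_adj(2)[OF that(2)] YX.Al_subset
    by (simp add: W.diff_scal W YX.BXY.diff_scal subset_iff)
  show ?thesis
  proof (rule complex_banachI[OF Wn])
    fix T :: "nat \<Rightarrow> 'x \<Rightarrow> 'y"
    assume T: "\<And>n. T n \<in> carrier W"
      and C: "\<And>\<epsilon>. \<epsilon> > 0 \<Longrightarrow> \<exists>M. \<forall>m\<ge>M. \<forall>n\<ge>M. bop_norm X Y (T m \<ominus>\<^bsub>W\<^esub> T n) < \<epsilon>"
    define S where "S n = Al_adj X P i Y Q j (T n)" for n
    have TA: "T n \<in> AlXY" for n using T W(1) by simp
    have SA: "S n \<in> Al Y Q j X P i" for n unfolding S_def by (rule Al_adj(2)[OF TA])
    have small: "\<exists>M. \<forall>m\<ge>M. \<forall>n\<ge>M. f m n < \<epsilon>"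
      if "\<epsilon> > 0" "r \<ge> 0" "\<And>m n. f m n \<le> bop_norm X Y (T m \<ominus>\<^bsub>W\<^esub> T n) * r" for f and r \<epsilon> :: real
    proof -
      obtain M where M: "\<forall>m\<ge>M. \<forall>n\<ge>M. bop_norm X Y (T m \<ominus>\<^bsub>W\<^esub> T n) < \<epsilon> / (r + 1)"
        using C[of "\<epsilon> / (r + 1)"] \<open>\<epsilon> > 0\<close> \<open>r \<ge> 0\<close> by auto
      have "f m n < \<epsilon>" if "m \<ge> M" "n \<ge> M" for m n
      proof -
        have "f m n \<le> \<epsilon> / (r + 1) * r"
          using \<open>\<And>m n. f m n \<le> _\<close>[of m n] M that \<open>r \<ge> 0\<close>
          by (meson less_imp_le mult_right_mono order_trans)
        also have "\<dots> < \<epsilon>" using \<open>\<epsilon> > 0\<close> \<open>r \<ge> 0\<close> by (simp add: field_simps)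
        finally show ?thesis .
      qed
      then show ?thesis by blast
    qed
    have "\<exists>l. Y.tends (\<lambda>n. T n x) l" if x: "x \<in> carrier X" for x
    proof (rule Y.Cauchy_tends)
      fix \<epsilon> :: real assume "\<epsilon> > 0"
      show "\<exists>M. \<forall>m\<ge>M. \<forall>n\<ge>M. op_norm Y (T m x \<ominus>\<^bsub>Y\<^esub> T n x) < \<epsilon>"
        by (rule small[OF \<open>\<epsilon> > 0\<close> X.norm_nonneg[OF x]])
          (use Al_bop_norm(1)[OF diff_Al[OF TA TA] x] in \<open>simp add: diff[OF TA TA x]\<close>)
    qed (rule Al_mem[OF TA x])
    then obtain T' where T': "\<And>x. x \<in> carrier X \<Longrightarrow> Y.tends (\<lambda>n. T n x) (T' x)" by metis
    have "\<exists>l. X.tends (\<lambda>n. S n y) l" if y: "y \<in> carrier Y" for y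
    proof (rule X.Cauchy_tends)
      fix \<epsilon> :: real assume "\<epsilon> > 0"
      have bound: "op_norm X (S m y \<ominus>\<^bsub>X\<^esub> S n y) \<le> bop_norm X Y (T m \<ominus>\<^bsub>W\<^esub> T n) * op_norm Y y" for m n
      proof -
        have "Al_adj X P i Y Q j (T m \<ominus>\<^bsub>W\<^esub> T n) y = S m y \<ominus>\<^bsub>X\<^esub> S n y"
          using y SA YX.Al_subset YX.Al_mem[OF SA y]
          by (simp add: adj_diff[OF TA TA] S_def[symmetric] YX.BXY.diff_scal subset_iff
              YX.bounded_ops_simps X.diff_scal)
        then show ?thesis
          using YX.Al_bop_norm(1)[OF Al_adj(2)[OF diff_Al[OF TA TA]] y, of m n]
            Al_bop_norm(3)[OF diff_Al[OF TA TA], of m n] by simp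
      qed
      show "\<exists>M. \<forall>m\<ge>M. \<forall>n\<ge>M. op_norm X (S m y \<ominus>\<^bsub>X\<^esub> S n y) < \<epsilon>"
        by (rule small[OF \<open>\<epsilon> > 0\<close> Y.norm_nonneg[OF y] bound])
    qed (rule YX.Al_mem[OF SA y])
    then obtain S' where S': "\<And>y. y \<in> carrier Y \<Longrightarrow> X.tends (\<lambda>n. S n y) (S' y)" by metis
    define L where "L = restrict T' (carrier X)"
    have L: "x \<in> carrier X \<Longrightarrow> Y.tends (\<lambda>n. T n x) (L x)" for x
      unfolding L_def using T' by simp
    have TS: "adj (T n) (S n)" for n
      unfolding S_def by (rule Al_adj(1)[OF TA])
    have "adj L S'"
      by (rule adj_tends[OF TS L S'])
    then have LA: "L \<in> AlXY"
      unfolding Al_iff L_def using Y.tendsD(1)[OF T'] by auto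
    have "W.tends T L"
      unfolding W.tends_def
    proof (intro conjI allI)
      show "(\<lambda>n. bop_norm X Y (T n \<ominus>\<^bsub>W\<^esub> L)) \<longlonglongrightarrow> 0"
      proof (rule LIMSEQ_I)
        fix \<epsilon> :: real assume "\<epsilon> > 0"
        then obtain M where M: "\<forall>m\<ge>M. \<forall>n\<ge>M. bop_norm X Y (T m \<ominus>\<^bsub>W\<^esub> T n) < \<epsilon> / 2"
          using C[of "\<epsilon> / 2"] by auto
        have "bop_norm X Y (T n \<ominus>\<^bsub>W\<^esub> L) \<le> \<epsilon> / 2" if n: "n \<ge> M" for n
        proof (rule bop_norm_le)
          fix x assume x: "x \<in> carrier X"
          have "(\<lambda>m. op_norm Y (T n x \<ominus>\<^bsub>Y\<^esub> T m x)) \<longlonglongrightarrow> op_norm Y (T n x \<ominus>\<^bsub>Y\<^esub> L x)"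
            using L[OF x] Al_mem[OF TA x] by (intro Y.tends_norm Y.tends_diff Y.tends_const)
          moreover have "op_norm Y (T n x \<ominus>\<^bsub>Y\<^esub> T m x) \<le> \<epsilon> / 2 * op_norm X x" if "m \<ge> M" for m
          proof -
            have "op_norm Y (T n x \<ominus>\<^bsub>Y\<^esub> T m x) \<le> bop_norm X Y (T n \<ominus>\<^bsub>W\<^esub> T m) * op_norm X x"
              using Al_bop_norm(1)[OF diff_Al[OF TA TA] x] by (simp add: diff[OF TA TA x])
            also have "\<dots> \<le> \<epsilon> / 2 * op_norm X x"
              using M n that X.norm_nonneg[OF x] by (intro mult_right_mono) (auto intro: less_imp_le)
            finally show ?thesis .
          qed
          ultimately show "op_norm Y ((T n \<ominus>\<^bsub>W\<^esub> L) x) \<le> \<epsilon> / 2 * op_norm X x"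
            unfolding diff[OF TA LA x] by (intro LIMSEQ_le_const2) auto
        qed (use \<open>\<epsilon> > 0\<close> in simp)
        then have "norm (bop_norm X Y (T n \<ominus>\<^bsub>W\<^esub> L) - 0) < \<epsilon>" if "n \<ge> M" for n
          using that \<open>\<epsilon> > 0\<close> Al_bop_norm(2)[OF diff_Al[OF TA LA], of n] by fastforce
        then show "\<exists>M. \<forall>n\<ge>M. norm (bop_norm X Y (T n \<ominus>\<^bsub>W\<^esub> L) - 0) < \<epsilon>" by blast
      qed
    qed (use LA TA W(1) in auto)
    then show "\<exists>l. W.tends T l" by blast
  qed
qed

text \<open>
  A sequence in \<open>A\<^sub>l(X, Y)\<close> that converges in norm is a Cauchy sequence; by completeness its limit lies in
  \<open>A\<^sub>l(X, Y)\<close>.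
\<close>
lemma Al_closedin: "closedin (norm_topology (bounded_ops X Y) (bop_norm X Y)) AlXY"
  unfolding BXY.closedin_iff_sequentially
proof (intro conjI allI impI Al_subset)
  let ?W = "(bounded_ops X Y)\<lparr>carrier := AlXY\<rparr>"
  interpret W: complex_banach ?W "bop_norm X Y" by (rule Al_complete) simp_all
  fix T L assume T: "\<forall>n. T n \<in> AlXY" and L: "BXY.tends T L"
  have sub: "T \<in> AlXY \<Longrightarrow> T \<in> carrier (bounded_ops X Y)" for T using Al_subset by blast
  have diff: "T \<ominus>\<^bsub>?W\<^esub> R = T \<ominus>\<^bsub>bounded_ops X Y\<^esub> R" if "T \<in> AlXY" "R \<in> AlXY" for T R
    using that sub by (simp add: W.diff_scal BXY.diff_scal)
  have "\<exists>l. W.tends T l"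
  proof (rule W.Cauchy_tends)
    fix \<epsilon> :: real assume "\<epsilon> > 0"
    then obtain M where "\<forall>n\<ge>M. norm (bop_norm X Y (T n \<ominus>\<^bsub>bounded_ops X Y\<^esub> L) - 0) < \<epsilon> / 2"
      using LIMSEQ_D[OF BXY.tendsD(3)[OF L], of "\<epsilon> / 2"] by auto
    then have M: "bop_norm X Y (T n \<ominus>\<^bsub>bounded_ops X Y\<^esub> L) < \<epsilon> / 2" if "n \<ge> M" for n
      using that by (fastforce simp: abs_less_iff)
    have "bop_norm X Y (T m \<ominus>\<^bsub>?W\<^esub> T n) < \<epsilon>" if "m \<ge> M" "n \<ge> M" for m n
      using M[OF that(1)] M[OF that(2)] BXY.tendsD(1,2)[OF L] T
        BXY.norm_diff_triangle[of "T m" L "T n"] BXY.norm_diff_commute[of L "T n"]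
      by (simp add: diff)
    then show "\<exists>M. \<forall>m\<ge>M. \<forall>n\<ge>M. bop_norm X Y (T m \<ominus>\<^bsub>?W\<^esub> T n) < \<epsilon>" by blast
  qed (use T in simp)
  then obtain l where l: "W.tends T l" by blast
  then have lA: "l \<in> AlXY" using W.tendsD(1) by fastforce
  have "BXY.tends T l"
    using l lA T sub unfolding W.tends_def BXY.tends_def by (simp add: diff)
  from BXY.tends_unique[OF L this] show "L \<in> AlXY" using lA by simp
qed

end

lemma Al_compose:
  assumes XY: "cstar_form_pair B X P i Y Q j" and YZ: "cstar_form_pair B Y Q j Z R k"
    and T: "T \<in> Al X P i Y Q j" and U: "U \<in> Al Y Q j Z R k"
  shows "compose (carrier X) U T \<in> Al X P i Z R k"
    and "Al_adj X P i Z R k (compose (carrier X) U T)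
      = compose (carrier Z) (Al_adj X P i Y Q j T) (Al_adj Y Q j Z R k U)"
    and "bop_norm X Z (compose (carrier X) U T) \<le> bop_norm Y Z U * bop_norm X Y T"
proof -
  interpret XY: cstar_form_pair B X P i Y Q j by fact
  interpret YZ: cstar_form_pair B Y Q j Z R k by fact
  interpret XZ: cstar_form_pair B X P i Z R k by unfold_locales
  note a = adjoint_pair_compose[OF XY.Al_adj(1)[OF T] YZ.Al_adj(1)[OF U]]
  show "compose (carrier X) U T \<in> Al X P i Z R k"
    unfolding Al_iff using a XY.Al_mem[OF T] YZ.Al_mem[OF U] by (auto simp: compose_def)
  show "Al_adj X P i Z R k (compose (carrier X) U T)
      = compose (carrier Z) (Al_adj X P i Y Q j T) (Al_adj Y Q j Z R k U)"
    unfolding XZ.Al_adj_unique[OF a] by (simp add: compose_def)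
  show "bop_norm X Z (compose (carrier X) U T) \<le> bop_norm Y Z U * bop_norm X Y T"
  proof (rule XZ.bop_norm_le)
    fix x assume x: "x \<in> carrier X"
    have "op_norm Z (U (T x)) \<le> bop_norm Y Z U * op_norm Y (T x)"
      using YZ.Al_bop_norm(1)[OF U XY.Al_mem[OF T x]] .
    also have "\<dots> \<le> bop_norm Y Z U * (bop_norm X Y T * op_norm X x)"
      using XY.Al_bop_norm(1)[OF T x] YZ.Al_bop_norm(2)[OF U] by (rule mult_left_mono)
    finally show "op_norm Z (compose (carrier X) U T x) \<le> bop_norm Y Z U * bop_norm X Y T * op_norm X x"
      using x by (simp add: compose_def mult_ac)
  qed (use YZ.Al_bop_norm(2)[OF U] XY.Al_bop_norm(2)[OF T] in simp)
qed

lemma Al_algebra_simps [simp]: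
  "carrier (Al_algebra X P i) = Al X P i X P i"
  "monoid.mult (Al_algebra X P i) = compose (carrier X)"
  "one (Al_algebra X P i) = (\<lambda>x\<in>carrier X. x)"
  "zero (Al_algebra X P i) = zero (bounded_ops X X)"
  "add (Al_algebra X P i) = add (bounded_ops X X)"
  "smult (Al_algebra X P i) = smult (bounded_ops X X)"
  "star (Al_algebra X P i) = Al_adj X P i X P i"
  "nrm (Al_algebra X P i) = bop_norm X X"
  by (simp_all add: Al_algebra_def)

context cstar_form
begin

lemma self_pair: "cstar_form_pair B X P i X P i"
  by unfold_locales

lemma unital_cstar_algebra_Al: "unital_cstar_algebra (Al_algebra X P i)"
proof -
  let ?V = "bounded_ops X X"
  interpret XX: cstar_form_pair B X P i X P i by (rule self_pair)
  note comp = Al_compose[OF self_pair self_pair]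
  note lin = XX.linear_mapD[OF XX.Al_linear]
  have mem: "T \<in> carrier X \<rightarrow> carrier X" if "T \<in> Al X P i X P i" for T
    using that by (auto simp: Al_def)
  have one: "XX.adj (\<lambda>x\<in>carrier X. x) (\<lambda>x\<in>carrier X. x)"
    by (rule adjoint_pairI) auto
  have "cstar_algebra (Al_algebra X P i)"
  proof (rule cstar_algebra.intro; (simp only: Al_algebra_simps)?)
    show "complex_banach (Al_algebra X P i) (bop_norm X X)"
      by (rule XX.Al_complete) simp_all
    fix T U V c assume T: "T \<in> Al X P i X P i"
    show "Al_adj X P i X P i T \<in> Al X P i X P i" by (rule XX.Al_adj(2)[OF T])
    show "Al_adj X P i X P i (Al_adj X P i X P i T) = T" by (rule XX.Al_adj(3)[OF T])
    show "Al_adj X P i X P i (c \<odot>\<^bsub>?V\<^esub> T) = cnj c \<odot>\<^bsub>?V\<^esub> Al_adj X P i X P i T"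
      by (rule XX.Al_smult(2)[OF T])
    show "bop_norm X X (compose (carrier X) (Al_adj X P i X P i T) T) = (bop_norm X X T)\<^sup>2"
      by (rule XX.Al_bop_norm(4)[OF T])
    assume U: "U \<in> Al X P i X P i"
    show "compose (carrier X) T U \<in> Al X P i X P i" by (rule comp(1)[OF U T])
    show "Al_adj X P i X P i (compose (carrier X) T U)
        = compose (carrier X) (Al_adj X P i X P i U) (Al_adj X P i X P i T)"
      by (rule comp(2)[OF U T])
    show "bop_norm X X (compose (carrier X) T U) \<le> bop_norm X X T * bop_norm X X U"
      by (rule comp(3)[OF U T])
    show "Al_adj X P i X P i (T \<oplus>\<^bsub>?V\<^esub> U)
        = Al_adj X P i X P i T \<oplus>\<^bsub>?V\<^esub> Al_adj X P i X P i U"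
      by (rule XX.Al_add(2)[OF T U])
    show "compose (carrier X) (c \<odot>\<^bsub>?V\<^esub> T) U = c \<odot>\<^bsub>?V\<^esub> compose (carrier X) T U"
      using XX.Al_mem[OF U] by (auto simp: compose_def XX.bounded_ops_simps fun_eq_iff)
    show "compose (carrier X) T (c \<odot>\<^bsub>?V\<^esub> U) = c \<odot>\<^bsub>?V\<^esub> compose (carrier X) T U"
      using XX.Al_mem[OF U] lin(3)[OF T] by (auto simp: compose_def XX.bounded_ops_simps fun_eq_iff)
    assume V: "V \<in> Al X P i X P i"
    show "compose (carrier X) (compose (carrier X) T U) V = compose (carrier X) T (compose (carrier X) U V)"
      using XX.Al_mem[OF V] by (auto simp: compose_def fun_eq_iff)
    show "compose (carrier X) (T \<oplus>\<^bsub>?V\<^esub> U) V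
        = compose (carrier X) T V \<oplus>\<^bsub>?V\<^esub> compose (carrier X) U V"
      using XX.Al_mem[OF V] by (auto simp: compose_def XX.bounded_ops_simps fun_eq_iff)
    show "compose (carrier X) T (U \<oplus>\<^bsub>?V\<^esub> V)
        = compose (carrier X) T U \<oplus>\<^bsub>?V\<^esub> compose (carrier X) T V"
      using XX.Al_mem[OF U] XX.Al_mem[OF V] lin(2)[OF T]
      by (auto simp: compose_def XX.bounded_ops_simps fun_eq_iff)
  qed
  then show ?thesis
  proof (rule unital_cstar_algebra.intro[OF _ unital_cstar_algebra_axioms.intro];
      (simp only: Al_algebra_simps)?)
    show "(\<lambda>x\<in>carrier X. x) \<in> Al X P i X P i"
      unfolding Al_iff using one by auto
    fix T assume T: "T \<in> Al X P i X P i"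
    then show "compose (carrier X) (\<lambda>x\<in>carrier X. x) T = T" "compose (carrier X) T (\<lambda>x\<in>carrier X. x) = T"
      using XX.Al_mem[OF T] by (auto simp: Al_def compose_def fun_eq_iff PiE_iff extensional_def)
  qed
qed

end

section \<open>The Cauchy-Schwarz inequality\<close>

lemma complex_banach_reduct:
  fixes V :: "(complex, 'a, 'm) module_scheme" and W :: "(complex, 'a, 'k) module_scheme"
  assumes V: "complex_banach V N"
    and W: "carrier W = carrier V" "zero W = zero V" "add W = add V" "smult W = smult V"
  shows "complex_banach W N"
proof -
  interpret V: complex_banach V N by fact
  have "norm_dist W N = norm_dist V N"
    by (simp add: norm_dist_def a_minus_def a_inv_def m_inv_def W fun_eq_iff)
  then show ?thesis
    using complex_vspace_subspace[OF V.vspace V.V.carrier_is_submodule W]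
      V.norm_nonneg V.norm_eq_zero V.norm_smult V.norm_triangle V.complete
    by (intro complex_banach.intro) (simp_all add: W)
qed

text \<open>
  A C*-algebra as an inner product space over itself. Each matrix norm is the norm of the first entry; on matrices
  of size one this is the norm of the algebra. The adjointable maps are then the multipliers: they form a unital
  C*-algebra in which \<open>B\<close> sits isometrically by left multiplication. This supplies the unit that the
  theory of positive elements needs.
\<close>
definition regular_space :: "'b cstar \<Rightarrow> 'b opspace" where
  "regular_space B = \<lparr>carrier = carrier B, monoid.mult = undefined, one = undefined, zero = zero B,
     add = add B, smult = smult B, mnorm = (\<lambda>n v. nrm B (v 0 0))\<rparr>"

definition regular_module :: "'b cstar \<Rightarrow> ('b, 'b) cmodule" where
  "regular_module B = \<lparr>carrier = carrier B, monoid.mult = undefined, one = undefined, zero = zero B,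
     add = add B, smult = smult B, ract = monoid.mult B, rip = (\<lambda>a b. star B a \<otimes>\<^bsub>B\<^esub> b)\<rparr>"

lemma regular_simps [simp]:
  "carrier (regular_space B) = carrier B" "zero (regular_space B) = zero B"
  "add (regular_space B) = add B" "smult (regular_space B) = smult B"
  "op_norm (regular_space B) = nrm B"
  "rip (regular_module B) a b = star B a \<otimes>\<^bsub>B\<^esub> b"
  by (simp_all add: regular_space_def regular_module_def op_norm_def fun_eq_iff)

definition multipliers :: "'b cstar \<Rightarrow> ('b \<Rightarrow> 'b) cstar" where
  "multipliers B = Al_algebra (regular_space B) (regular_module B) id"

definition left_mult :: "'b cstar \<Rightarrow> 'b \<Rightarrow> 'b \<Rightarrow> 'b" where
  "left_mult B a = (\<lambda>x\<in>carrier B. a \<otimes>\<^bsub>B\<^esub> x)"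

context cstar_algebra
begin

lemma regular_form: "cstar_form A (regular_space A) (regular_module A) id"
proof (rule cstar_form.intro)
  show "cstar_algebra A" by unfold_locales
  show "complex_banach (regular_space A) (op_norm (regular_space A))"
    unfolding regular_simps by (rule complex_banach_reduct[OF banach]) simp_all
  fix x y assume "x \<in> carrier (regular_space A)" "y \<in> carrier (regular_space A)"
  then show "nrm A (rip (regular_module A) (id x) (id y))
      \<le> op_norm (regular_space A) x * op_norm (regular_space A) y"
    using norm_mult[of "star A x" y] by simp
qed (auto simp: distr_right smult_mult_right star_mult cstar_identity cstar_positive_def)

lemma unital_multipliers: "unital_cstar_algebra (multipliers A)"
  unfolding multipliers_def by (rule cstar_form.unital_cstar_algebra_Al[OF regular_form])

lemma left_mult_closed: "a \<in> carrier A \<Longrightarrow> left_mult A a \<in> carrier (multipliers A)"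
  and star_left_mult: "a \<in> carrier A \<Longrightarrow> star (multipliers A) (left_mult A a) = left_mult A (star A a)"
  and norm_left_mult: "a \<in> carrier A \<Longrightarrow> nrm (multipliers A) (left_mult A a) = nrm A a"
proof -
  interpret R: cstar_form_pair A "regular_space A" "regular_module A" id "regular_space A" "regular_module A" id
    by (rule cstar_form.self_pair[OF regular_form])
  assume a: "a \<in> carrier A"
  have adj: "R.adj (left_mult A a) (left_mult A (star A a))"
    using a by (intro adjoint_pairI) (auto simp: left_mult_def star_mult mult_assoc)
  show mem: "left_mult A a \<in> carrier (multipliers A)"
    unfolding multipliers_def Al_algebra_simps Al_iff
    using adj a by (auto simp: left_mult_def)
  show "star (multipliers A) (left_mult A a) = left_mult A (star A a)"
    unfolding multipliers_def Al_algebra_simps R.Al_adj_unique[OF adj]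
    by (simp add: left_mult_def)
  have mem': "left_mult A a \<in> R.AlXY"
    using mem by (simp add: multipliers_def)
  have "bop_norm (regular_space A) (regular_space A) (left_mult A a) \<le> nrm A a"
    using a norm_mult norm_nonneg by (intro R.bop_norm_le) (auto simp: left_mult_def)
  moreover have "nrm A a \<le> bop_norm (regular_space A) (regular_space A) (left_mult A a)"
  proof (cases "nrm A a = 0")
    case False
    then have "nrm A a > 0" using norm_nonneg[OF a] by simp
    moreover have "nrm A a * nrm A a \<le> bop_norm (regular_space A) (regular_space A) (left_mult A a) * nrm A a"
      \<comment> \<open>The norm is attained at \<open>a\<^sup>*\<close>.\<close>
      using R.Al_bop_norm(1)[OF mem', of "star A a"] a cstar_identity[of "star A a"]
      by (simp add: left_mult_def power2_eq_square)
    ultimately show ?thesis by simp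
  qed (use R.Al_bop_norm(2)[OF mem'] in simp)
  ultimately show "nrm (multipliers A) (left_mult A a) = nrm A a"
    by (simp add: multipliers_def)
qed

lemma left_mult_mult:
  "\<lbrakk>a \<in> carrier A; b \<in> carrier A\<rbrakk>
    \<Longrightarrow> left_mult A (a \<otimes> b) = left_mult A a \<otimes>\<^bsub>multipliers A\<^esub> left_mult A b"
  by (auto simp: multipliers_def left_mult_def compose_def mult_assoc fun_eq_iff)

lemma left_mult_add:
  "\<lbrakk>a \<in> carrier A; b \<in> carrier A\<rbrakk>
    \<Longrightarrow> left_mult A (a \<oplus> b) = left_mult A a \<oplus>\<^bsub>multipliers A\<^esub> left_mult A b"
  by (auto simp: multipliers_def left_mult_def bounded_ops_def distr_left fun_eq_iff)

lemma left_mult_smult: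
  "a \<in> carrier A \<Longrightarrow> left_mult A (c \<odot> a) = c \<odot>\<^bsub>multipliers A\<^esub> left_mult A a"
  by (auto simp: multipliers_def left_mult_def bounded_ops_def smult_mult_left fun_eq_iff)

lemma pos_left_mult:
  assumes "cstar_positive A p"
  shows "unital_cstar_algebra.pos (multipliers A) (left_mult A p)"
proof -
  interpret M: unital_cstar_algebra "multipliers A" by (rule unital_multipliers)
  obtain b where b: "b \<in> carrier A" "p = star A b \<otimes> b"
    using assms by (auto simp: cstar_positive_def)
  show ?thesis
    using M.pos_star_mult_self[OF left_mult_closed[OF b(1)]] b(1)
    by (simp add: b(2) left_mult_mult star_left_mult)
qed

text \<open>
  Norms of positive elements can be compared among the multipliers, where positivity is detected by the unit.
\<close>
lemma norm_positive_mono: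
  assumes p: "cstar_positive A p" and q: "cstar_positive A q"
  shows "nrm A p \<le> nrm A (p \<oplus> q)"
proof -
  interpret M: unital_cstar_algebra "multipliers A" by (rule unital_multipliers)
  have c: "p \<in> carrier A" "q \<in> carrier A" using p q by (auto simp: cstar_positive_def)
  show ?thesis
    using M.norm_pos_mono[OF pos_left_mult[OF p] pos_left_mult[OF q]] c
    by (simp add: left_mult_add[symmetric] norm_left_mult)
qed

end

sublocale right_cstar_module \<subseteq> B: cstar_algebra B
  by (rule cstar_algebra)

sublocale right_cstar_module \<subseteq> Z: complex_banach Z "cmod_norm B Z"
  by (rule banach)

context right_cstar_module
begin

lemma ip_add_left:
  assumes "z \<in> carrier Z" "w \<in> carrier Z" "v \<in> carrier Z"
  shows "rip Z (z \<oplus>\<^bsub>Z\<^esub> w) v = rip Z z v \<oplus>\<^bsub>B\<^esub> rip Z w v"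
proof -
  have "star B (rip Z v (z \<oplus>\<^bsub>Z\<^esub> w)) = star B (rip Z v z) \<oplus>\<^bsub>B\<^esub> star B (rip Z v w)"
    using assms by (simp add: ip_add ip_closed B.star_add)
  then show ?thesis using assms by (simp add: ip_star)
qed

lemma ip_smult_left:
  assumes "z \<in> carrier Z" "w \<in> carrier Z"
  shows "rip Z (u \<odot>\<^bsub>Z\<^esub> z) w = cnj u \<odot>\<^bsub>B\<^esub> rip Z z w"
proof -
  have "star B (rip Z w (u \<odot>\<^bsub>Z\<^esub> z)) = cnj u \<odot>\<^bsub>B\<^esub> star B (rip Z w z)"
    using assms by (simp add: ip_smult ip_closed B.star_smult)
  then show ?thesis using assms by (simp add: ip_star)
qed

lemma ip_act_left:
  assumes "z \<in> carrier Z" "w \<in> carrier Z" "b \<in> carrier B"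
  shows "rip Z (ract Z z b) w = star B b \<otimes>\<^bsub>B\<^esub> rip Z z w"
proof -
  have "star B (rip Z w (ract Z z b)) = star B b \<otimes>\<^bsub>B\<^esub> star B (rip Z w z)"
    using assms by (simp add: ip_act ip_closed B.star_mult)
  then show ?thesis using assms by (simp add: ip_star act_closed)
qed

lemma ip_diff:
  "\<lbrakk>z \<in> carrier Z; w \<in> carrier Z; v \<in> carrier Z\<rbrakk>
    \<Longrightarrow> rip Z z (w \<ominus>\<^bsub>Z\<^esub> v) = rip Z z w \<ominus>\<^bsub>B\<^esub> rip Z z v"
  using ip_smult[of z v "- 1"] by (simp add: Z.diff_scal B.diff_scal ip_add ip_closed)

lemma ip_diff_left:
  "\<lbrakk>z \<in> carrier Z; w \<in> carrier Z; v \<in> carrier Z\<rbrakk>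
    \<Longrightarrow> rip Z (z \<ominus>\<^bsub>Z\<^esub> w) v = rip Z z v \<ominus>\<^bsub>B\<^esub> rip Z w v"
  using ip_smult_left[of w v "- 1"] by (simp add: Z.diff_scal B.diff_scal ip_add_left ip_closed)

lemma norm_square: "z \<in> carrier Z \<Longrightarrow> (cmod_norm B Z z)\<^sup>2 = nrm B (rip Z z z)"
  by (simp add: cmod_norm_def B.norm_nonneg ip_closed)

text \<open>
  Let \<open>a = \<langle>y | x\<rangle>\<close>, \<open>t = \<parallel>y\<parallel>\<^sup>2\<close> and \<open>z = t x - y a\<close>. Expanding \<open>\<langle>z | z\<rangle>\<close> gives
  \<open>t\<^sup>2 \<langle>x | x\<rangle> = t a\<^sup>* a + a\<^sup>* (t - \<langle>y | y\<rangle>) a + \<langle>z | z\<rangle>\<close>. The last two summands are positive among the multipliers,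
  because \<open>t - \<langle>y | y\<rangle>\<close> has a root there. Hence \<open>t \<parallel>a\<parallel>\<^sup>2 \<le> t\<^sup>2 \<parallel>x\<parallel>\<^sup>2\<close>.
\<close>
lemma Cauchy_Schwarz:
  assumes x: "x \<in> carrier Z" and y: "y \<in> carrier Z"
  shows "nrm B (rip Z x y) \<le> cmod_norm B Z x * cmod_norm B Z y"
proof (cases "y = \<zero>\<^bsub>Z\<^esub>")
  case True
  have "rip Z x \<zero>\<^bsub>Z\<^esub> = \<zero>\<^bsub>B\<^esub>"
    using ip_smult[of x "\<zero>\<^bsub>Z\<^esub>" 0] x by (simp add: ip_closed)
  with True show ?thesis by simp
next
  case False
  interpret M: unital_cstar_algebra "multipliers B" by (rule B.unital_multipliers)
  define t where "t = (cmod_norm B Z y)\<^sup>2"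
  have t: "t > 0" using False Z.norm_eq_zero[OF y] by (simp add: t_def)
  let ?T = "complex_of_real t" and ?L = "left_mult B" and ?M = "multipliers B"
  define a where "a = rip Z y x"
  define z where "z = ?T \<odot>\<^bsub>Z\<^esub> x \<ominus>\<^bsub>Z\<^esub> ract Z y a"
  let ?a = "star B a" and ?Y = "rip Z y y"
  have c: "a \<in> carrier B" "?Y \<in> carrier B" "rip Z x x \<in> carrier B" "rip Z x y = ?a"
    "ract Z y a \<in> carrier Z" "z \<in> carrier Z" "rip Z z z \<in> carrier B" "?T \<odot>\<^bsub>Z\<^esub> x \<in> carrier Z"
    using x y by (auto simp: a_def z_def ip_closed ip_star act_closed)
  let ?X = "(?T * ?T) \<odot>\<^bsub>B\<^esub> rip Z x x" and ?u = "?T \<odot>\<^bsub>B\<^esub> (?a \<otimes>\<^bsub>B\<^esub> a)"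
    and ?w = "?a \<otimes>\<^bsub>B\<^esub> (?Y \<otimes>\<^bsub>B\<^esub> a)"
  have zz: "rip Z z z = (?X \<ominus>\<^bsub>B\<^esub> ?u) \<ominus>\<^bsub>B\<^esub> (?u \<ominus>\<^bsub>B\<^esub> ?w)"
  proof -
    have 1: "rip Z (?T \<odot>\<^bsub>Z\<^esub> x) (?T \<odot>\<^bsub>Z\<^esub> x) = ?X"
      using x c by (simp add: ip_smult ip_smult_left)
    have 2: "rip Z (?T \<odot>\<^bsub>Z\<^esub> x) (ract Z y a) = ?u"
      using x y c by (simp add: ip_act ip_smult_left B.smult_mult_left)
    have 3: "rip Z (ract Z y a) (?T \<odot>\<^bsub>Z\<^esub> x) = ?u"
      using x y c by (simp add: ip_act_left ip_smult a_def[symmetric] B.smult_mult_right)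
    have 4: "rip Z (ract Z y a) (ract Z y a) = ?w"
      using y c by (simp add: ip_act_left ip_act B.mult_assoc)
    have "rip Z z z = (?X \<ominus>\<^bsub>B\<^esub> rip Z (ract Z y a) (?T \<odot>\<^bsub>Z\<^esub> x))
        \<ominus>\<^bsub>B\<^esub> (?u \<ominus>\<^bsub>B\<^esub> ?w)"
      using c unfolding 1[symmetric] 2[symmetric] 4[symmetric]
      by (simp add: z_def ip_diff ip_diff_left)
    then show ?thesis by (simp only: 3)
  qed
  let ?q = "(?u \<ominus>\<^bsub>B\<^esub> ?w) \<oplus>\<^bsub>B\<^esub> rip Z z z"
  have X: "?X = ?u \<oplus>\<^bsub>B\<^esub> ?q"
  proof -
    have "?q = ?X \<ominus>\<^bsub>B\<^esub> ?u"
      unfolding zz using c by (simp add: B.V.a_comm[of "?u \<ominus>\<^bsub>B\<^esub> ?w"] B.diff_add_cancel)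
    then show ?thesis
      using c by (simp add: B.V.a_comm[of ?u] B.diff_add_cancel)
  qed
  have La: "?L a \<in> carrier (?M)" "?L ?Y \<in> carrier (?M)"
    "star (?M) (?L a) = ?L ?a"
    using c by (auto simp: B.left_mult_closed B.star_left_mult)
  have "M.pos (?L ?u)"
  proof -
    have "?L ?u = complex_of_real t \<odot>\<^bsub>?M\<^esub> (star (?M) (?L a) \<otimes>\<^bsub>?M\<^esub> ?L a)"
      using c by (simp add: B.left_mult_smult B.left_mult_mult B.star_left_mult)
    then show ?thesis
      using M.pos_scale[OF M.pos_star_mult_self[OF La(1)], of t] t by simp
  qed
  moreover have "M.pos (?L ?q)"
  proof -
    have "M.pos (M.scalar t \<ominus>\<^bsub>?M\<^esub> ?L ?Y)"
      using c y by (intro M.pos_scalar_diff)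
        (auto simp: B.left_mult_closed B.star_left_mult ip_star B.norm_left_mult t_def norm_square)
    then obtain f where f: "M.pos f" "f \<otimes>\<^bsub>?M\<^esub> f = M.scalar t \<ominus>\<^bsub>?M\<^esub> ?L ?Y"
      using M.pos_sqrt by blast
    note fc = M.pos_closed[OF f(1)]
    let ?g = "f \<otimes>\<^bsub>?M\<^esub> ?L a"
    have "star (?M) ?g \<otimes>\<^bsub>?M\<^esub> ?g
        = ?L ?a \<otimes>\<^bsub>?M\<^esub> ((f \<otimes>\<^bsub>?M\<^esub> f) \<otimes>\<^bsub>?M\<^esub> ?L a)"
      using fc La c by (simp add: M.star_mult M.mult_assoc B.left_mult_closed)
    also have "\<dots> = ?T \<odot>\<^bsub>?M\<^esub> (?L ?a \<otimes>\<^bsub>?M\<^esub> ?L a)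
        \<ominus>\<^bsub>?M\<^esub> ?L ?a \<otimes>\<^bsub>?M\<^esub> (?L ?Y \<otimes>\<^bsub>?M\<^esub> ?L a)"
      unfolding f(2) using La c
      by (simp add: M.mult_diff_left M.mult_diff_right M.smult_mult_right B.left_mult_closed)
    also have "\<dots> = ?L (?u \<ominus>\<^bsub>B\<^esub> ?w)"
      using c La by (simp add: B.diff_scal M.diff_scal B.left_mult_add B.left_mult_smult B.left_mult_mult
          B.left_mult_closed)
    finally have "M.pos (?L (?u \<ominus>\<^bsub>B\<^esub> ?w))"
      using M.pos_star_mult_self[of ?g] fc La by simp
    from M.pos_add[OF this B.pos_left_mult[OF ip_positive[OF c(6)]]]
    show ?thesis using c by (simp add: B.left_mult_add)
  qed
  ultimately have "nrm (?M) (?L ?u) \<le> nrm (?M) (?L ?u \<oplus>\<^bsub>?M\<^esub> ?L ?q)"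
    by (rule M.norm_pos_mono)
  then have "nrm B ?u \<le> nrm B ?X"
    unfolding X using c by (simp add: B.left_mult_add[symmetric] B.norm_left_mult)
  then have "t * (nrm B a)\<^sup>2 \<le> t * t * (cmod_norm B Z x)\<^sup>2"
    using c t x by (simp add: B.norm_smult B.cstar_identity norm_square norm_mult)
  then have "t * (nrm B a)\<^sup>2 \<le> t * (t * (cmod_norm B Z x)\<^sup>2)"
    by (simp add: mult.assoc)
  then have "(nrm B a)\<^sup>2 \<le> t * (cmod_norm B Z x)\<^sup>2"
    using t by simp
  then have "(nrm B a)\<^sup>2 \<le> (cmod_norm B Z x * cmod_norm B Z y)\<^sup>2"
    by (simp add: t_def power_mult_distrib mult_ac)
  then have "nrm B a \<le> cmod_norm B Z x * cmod_norm B Z y"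
    by (rule power2_le_imp_le) (simp add: Z.norm_nonneg x y)
  then show ?thesis using c by simp
qed

end

section \<open>The bimodule structure\<close>

lemma Al_bimodule_simps [simp]:
  "carrier (Al_bimodule X P i Y Q j) = Al X P i Y Q j"
  "zero (Al_bimodule X P i Y Q j) = zero (bounded_ops X Y)"
  "add (Al_bimodule X P i Y Q j) = add (bounded_ops X Y)"
  "smult (Al_bimodule X P i Y Q j) = smult (bounded_ops X Y)"
  "ract (Al_bimodule X P i Y Q j) T V = compose (carrier X) T V"
  "rip (Al_bimodule X P i Y Q j) T R = compose (carrier X) (Al_adj X P i Y Q j T) R"
  "lact (Al_bimodule X P i Y Q j) U T = compose (carrier X) U T"
  "lip (Al_bimodule X P i Y Q j) T R = compose (carrier Y) T (Al_adj X P i Y Q j R)"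
  by (simp_all add: Al_bimodule_def)

context cstar_form_pair
begin

text \<open>
  Let \<open>a = T\<^sup>* T\<close>, \<open>t = \<parallel>a\<parallel>\<close> and \<open>v\<close> a root of \<open>t - a\<close> in \<open>A\<^sub>l(X)\<close>. Then \<open>\<langle>v x | v x\<rangle> + \<langle>T x | T x\<rangle> = t \<langle>x | x\<rangle>\<close> in \<open>B\<close>, and since
  the norm of \<open>B\<close> is monotone on positive elements, \<open>\<parallel>v x\<parallel>\<^sup>2 \<le> t \<parallel>x\<parallel>\<^sup>2\<close>. So \<open>\<parallel>t - a\<parallel> = \<parallel>v\<parallel>\<^sup>2 \<le> t\<close>, which is positivity of \<open>a\<close>. The root
  of \<open>a\<close> is again a map of \<open>X\<close> into itself, although \<open>T\<close> need not be.
\<close>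
lemma adjoint_mult_positive:
  assumes T: "T \<in> AlXY"
  shows "cstar_positive (Al_algebra X P i) (compose (carrier X) (Al_adj X P i Y Q j T) T)"
proof -
  interpret XX: cstar_form_pair B X P i X P i by (rule X.self_pair)
  interpret A: unital_cstar_algebra "Al_algebra X P i" by (rule X.unital_cstar_algebra_Al)
  let ?A = "Al_algebra X P i"
  let ?S = "Al_adj X P i Y Q j T"
  define a where "a = compose (carrier X) ?S T"
  note S = Al_adj[OF T]
  note S_adj = adjoint_pairD[OF S(1)]
  have a: "a \<in> carrier ?A" "star ?A a = a"
    using Al_compose(1,2)[OF cstar_form_pair_axioms swap T S(2)] S(3) by (simp_all add: a_def)
  define t where "t = nrm ?A a"
  have t: "0 \<le> t" unfolding t_def by (rule A.norm_nonneg[OF a(1)])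
  have "A.pos (A.scalar t \<ominus>\<^bsub>?A\<^esub> a)"
    by (rule A.pos_scalar_diff[OF a]) (simp add: t_def)
  then obtain v where v: "A.pos v" "v \<otimes>\<^bsub>?A\<^esub> v = A.scalar t \<ominus>\<^bsub>?A\<^esub> a"
    using A.pos_sqrt by blast
  note vc = A.pos_closed[OF v(1)]
  have vA: "v \<in> XX.AlXY" using vc(1) by simp
  have v_adj: "XX.adj v v" using XX.Al_adj(1)[OF vA] vc(2) by simp
  have "(bop_norm X X v) \<le> sqrt t"
  proof (rule XX.bop_norm_le)
    fix x assume x: "x \<in> carrier X"
    have vx: "v x \<in> carrier X" "v (v x) \<in> carrier X" using XX.Al_mem[OF vA] x by auto
    have "(v \<otimes>\<^bsub>?A\<^esub> v) x = v (v x)" using x by (simp add: compose_def)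
    moreover have "(A.scalar t \<ominus>\<^bsub>?A\<^esub> a) x = complex_of_real t \<odot>\<^bsub>X\<^esub> x \<ominus>\<^bsub>X\<^esub> ?S (T x)"
      using x S_adj a(1) by (simp add: A.diff_scal X.diff_scal XX.bounded_ops_simps a_def compose_def)
    ultimately have vv: "v (v x) = complex_of_real t \<odot>\<^bsub>X\<^esub> x \<ominus>\<^bsub>X\<^esub> ?S (T x)"
      using v(2) by simp
    have "X.form (v x) (v x) = X.form x (v (v x))"
      by (rule adjoint_pairD(3)[OF v_adj x vx(1)])
    also have "\<dots> = complex_of_real t \<odot>\<^bsub>B\<^esub> X.form x x \<ominus>\<^bsub>B\<^esub> Y.form (T x) (T x)"
      unfolding vv using x S_adj by (simp add: X.form_diff X.form_smult)
    finally have sum: "X.form (v x) (v x) \<oplus>\<^bsub>B\<^esub> Y.form (T x) (T x) = complex_of_real t \<odot>\<^bsub>B\<^esub> X.form x x"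
      using x S_adj(1) X.form_closed Y.form_closed by (simp add: X.B.diff_add_cancel)
    have "nrm B (X.form (v x) (v x)) \<le> nrm B (X.form (v x) (v x) \<oplus>\<^bsub>B\<^esub> Y.form (T x) (T x))"
      by (rule X.B.norm_positive_mono[OF X.form_positive[OF vx(1)] Y.form_positive[OF S_adj(1)[OF x]]])
    then have "(op_norm X (v x))\<^sup>2 \<le> t * (op_norm X x)\<^sup>2"
      unfolding sum using x t X.form_norm[OF vx(1)] X.form_norm[OF x]
      by (simp add: X.B.norm_smult X.form_closed)
    also have "\<dots> = (sqrt t * op_norm X x)\<^sup>2"
      using t by (simp add: power_mult_distrib)
    finally show "op_norm X (v x) \<le> sqrt t * op_norm X x"
      by (rule power2_le_imp_le) (use t X.norm_nonneg[OF x] in simp)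
  qed (use t in simp)
  then have "(nrm ?A v)\<^sup>2 \<le> (sqrt t)\<^sup>2"
    using A.norm_nonneg[OF vc(1)] by (intro power_mono) simp_all
  then have "nrm ?A (A.scalar t \<ominus>\<^bsub>?A\<^esub> a) \<le> t"
    using A.norm_sa_square[OF vc] t unfolding v(2) by simp
  then have "A.pos a"
    by (rule A.posI[OF a])
  then obtain r where r: "A.pos r" "r \<otimes>\<^bsub>?A\<^esub> r = a"
    using A.pos_sqrt by blast
  have "a = star ?A r \<otimes>\<^bsub>?A\<^esub> r"
    using r A.pos_closed(2)[OF r(1)] by simp
  then show ?thesis
    unfolding cstar_positive_def a_def using A.pos_closed(1)[OF r(1)] by blast
qed

text \<open>
  The algebraic laws hold because composition is associative and linear in both arguments on linear maps. The
  left structure is the right structure of \<open>A\<^sub>l(Y, X)\<close>, seen through \<open>T \<mapsto> T\<^sup>*\<close>; this yields positivity and the norm.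
\<close>
lemma cstar_bimodule_Al:
  "cstar_bimodule (Al_algebra Y Q j) (Al_algebra X P i) (Al_bimodule X P i Y Q j) (bop_norm X Y)"
proof -
  interpret XX: cstar_form_pair B X P i X P i by (rule X.self_pair)
  interpret YY: cstar_form_pair B Y Q j Y Q j by (rule Y.self_pair)
  interpret YX: cstar_form_pair B Y Q j X P i by (rule swap)
  interpret A: unital_cstar_algebra "Al_algebra X P i" by (rule X.unital_cstar_algebra_Al)
  interpret C: unital_cstar_algebra "Al_algebra Y Q j" by (rule Y.unital_cstar_algebra_Al)
  let ?A = "Al_algebra X P i" and ?C = "Al_algebra Y Q j" and ?Z = "Al_bimodule X P i Y Q j" and ?V = "bounded_ops X Y"
  let ?adj = "Al_adj X P i Y Q j"
  note XY = cstar_form_pair_axioms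
  note mem = Al_mem XX.Al_mem YY.Al_mem YX.Al_mem
  note lin = linear_mapD[OF Al_linear] and Ylin = YY.linear_mapD[OF YY.Al_linear]
    and YXlin = YX.linear_mapD[OF YX.Al_linear]
  note ops = compose_def bounded_ops_def fun_eq_iff
  have Z: "complex_banach ?Z (bop_norm X Y)"
    by (rule Al_complete) simp_all
  have norm_right: "cmod_norm ?A ?Z T = bop_norm X Y T" if "T \<in> AlXY" for T
    using Al_bop_norm(4,2)[OF that] by (simp add: cmod_norm_def)
  have norm_left: "sqrt (nrm ?C (lip ?Z T T)) = bop_norm X Y T" if "T \<in> AlXY" for T
    using YX.Al_bop_norm(4)[OF Al_adj(2)[OF that]] Al_adj(3)[OF that] Al_bop_norm(2,3)[OF that]
    by simp
  have zero: "T = \<zero>\<^bsub>?V\<^esub>" if "T \<in> AlXY" "bop_norm X Y T = 0" for T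
    using BXY.norm_eq_zero[of T] that Al_subset by blast
  have right: "right_cstar_module ?A ?Z"
  proof (rule right_cstar_module.intro; (simp only: Al_algebra_simps Al_bimodule_simps)?)
    show "cstar_algebra ?A" by (rule A.cstar_algebra_axioms)
    show "complex_banach ?Z (cmod_norm ?A ?Z)"
      by (rule complex_banach_cong[OF Z]) (simp add: norm_right)
    fix T assume T: "T \<in> AlXY"
    show "cstar_positive ?A (compose (carrier X) (?adj T) T)"
      by (rule adjoint_mult_positive[OF T])
    show "T = \<zero>\<^bsub>?V\<^esub>"
      if "compose (carrier X) (?adj T) T = \<zero>\<^bsub>bounded_ops X X\<^esub>"
      using Al_bop_norm(4)[OF T] that A.norm_zero by (intro zero[OF T]) simp
    {
      fix V assume V: "V \<in> XX.AlXY"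
      show "compose (carrier X) T V \<in> AlXY" by (rule Al_compose(1)[OF X.self_pair XY V T])
      show "compose (carrier X) (c \<odot>\<^bsub>?V\<^esub> T) V = c \<odot>\<^bsub>?V\<^esub> compose (carrier X) T V" for c
        using mem(2)[OF V] by (auto simp: ops)
      show "compose (carrier X) T (c \<odot>\<^bsub>bounded_ops X X\<^esub> V) = c \<odot>\<^bsub>?V\<^esub> compose (carrier X) T V" for c
        using mem(2)[OF V] lin(3)[OF T] by (auto simp: ops)
      fix U assume U: "U \<in> XX.AlXY"
      show "compose (carrier X) T (compose (carrier X) V U) = compose (carrier X) (compose (carrier X) T V) U"
        using mem(2)[OF U] by (auto simp: ops)
      show "compose (carrier X) T (V \<oplus>\<^bsub>bounded_ops X X\<^esub> U)
          = compose (carrier X) T V \<oplus>\<^bsub>?V\<^esub> compose (carrier X) T U"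
        using mem(2)[OF U] mem(2)[OF V] lin(2)[OF T] by (auto simp: ops)
    }
    fix R assume R: "R \<in> AlXY"
    show "compose (carrier X) (T \<oplus>\<^bsub>?V\<^esub> R) V
        = compose (carrier X) T V \<oplus>\<^bsub>?V\<^esub> compose (carrier X) R V" if V: "V \<in> XX.AlXY" for V
      using mem(2)[OF V] by (auto simp: ops)
    note T' = Al_adj(2)[OF T] and R' = Al_adj(2)[OF R]
    show "compose (carrier X) (?adj T) R \<in> XX.AlXY" by (rule Al_compose(1)[OF XY swap R T'])
    show "Al_adj X P i X P i (compose (carrier X) (?adj T) R) = compose (carrier X) (?adj R) T"
      using Al_compose(2)[OF XY swap R T'] Al_adj(3)[OF T] by simp
    show "compose (carrier X) (?adj T) (c \<odot>\<^bsub>?V\<^esub> R)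
        = c \<odot>\<^bsub>bounded_ops X X\<^esub> compose (carrier X) (?adj T) R" for c
      using mem(1)[OF R] YXlin(3)[OF T'] by (auto simp: ops)
    show "compose (carrier X) (?adj T) (compose (carrier X) R V)
        = compose (carrier X) (compose (carrier X) (?adj T) R) V" if V: "V \<in> XX.AlXY" for V
      using mem(2)[OF V] by (auto simp: ops)
    show "compose (carrier X) (?adj T) (R \<oplus>\<^bsub>?V\<^esub> U)
        = compose (carrier X) (?adj T) R \<oplus>\<^bsub>bounded_ops X X\<^esub> compose (carrier X) (?adj T) U"
      if U: "U \<in> AlXY" for U
      using mem(1)[OF R] mem(1)[OF U] YXlin(2)[OF T'] by (auto simp: ops)
  qed
  have left: "left_cstar_module ?C ?Z"
  proof (rule left_cstar_module.intro; (simp only: Al_algebra_simps Al_bimodule_simps)?)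
    show "cstar_algebra ?C" by (rule C.cstar_algebra_axioms)
    show "complex_banach ?Z (\<lambda>T. sqrt (bop_norm Y Y (compose (carrier Y) T (?adj T))))"
      by (rule complex_banach_cong[OF Z]) (use norm_left in simp)
    fix T assume T: "T \<in> AlXY"
    note T' = Al_adj(2)[OF T]
    show "cstar_positive ?C (compose (carrier Y) T (?adj T))"
      using YX.adjoint_mult_positive[OF T'] by (simp add: Al_adj(3)[OF T])
    show "T = \<zero>\<^bsub>?V\<^esub>"
      if "compose (carrier Y) T (?adj T) = \<zero>\<^bsub>bounded_ops Y Y\<^esub>"
      using norm_left[OF T] that C.norm_zero by (intro zero[OF T]) simp
    {
      fix V assume V: "V \<in> YY.AlXY"
      show "compose (carrier X) V T \<in> AlXY" by (rule Al_compose(1)[OF XY Y.self_pair T V])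
      show "compose (carrier X) (c \<odot>\<^bsub>bounded_ops Y Y\<^esub> V) T = c \<odot>\<^bsub>?V\<^esub> compose (carrier X) V T" for c
        using mem(1)[OF T] by (auto simp: ops)
      show "compose (carrier X) V (c \<odot>\<^bsub>?V\<^esub> T) = c \<odot>\<^bsub>?V\<^esub> compose (carrier X) V T" for c
        using mem(1)[OF T] Ylin(3)[OF V] by (auto simp: ops)
      show "compose (carrier X) V (T \<oplus>\<^bsub>?V\<^esub> R)
          = compose (carrier X) V T \<oplus>\<^bsub>?V\<^esub> compose (carrier X) V R" if R: "R \<in> AlXY" for R
        using mem(1)[OF T] mem(1)[OF R] Ylin(2)[OF V] by (auto simp: ops)
      fix U assume U: "U \<in> YY.AlXY"
      show "compose (carrier X) (compose (carrier Y) V U) T = compose (carrier X) V (compose (carrier X) U T)"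
        using mem(1)[OF T] by (auto simp: ops)
      show "compose (carrier X) (V \<oplus>\<^bsub>bounded_ops Y Y\<^esub> U) T
          = compose (carrier X) V T \<oplus>\<^bsub>?V\<^esub> compose (carrier X) U T"
        using mem(1)[OF T] by (auto simp: ops)
    }
    fix R assume R: "R \<in> AlXY"
    note R' = Al_adj(2)[OF R]
    show "compose (carrier Y) T (?adj R) \<in> YY.AlXY" by (rule Al_compose(1)[OF swap XY R' T])
    show "Al_adj Y Q j Y Q j (compose (carrier Y) T (?adj R)) = compose (carrier Y) R (?adj T)"
      using Al_compose(2)[OF swap XY R' T] Al_adj(3)[OF R] by simp
    show "compose (carrier Y) (c \<odot>\<^bsub>?V\<^esub> T) (?adj R)
        = c \<odot>\<^bsub>bounded_ops Y Y\<^esub> compose (carrier Y) T (?adj R)" for c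
      using mem(4)[OF R'] by (auto simp: ops)
    show "compose (carrier Y) (compose (carrier X) V T) (?adj R)
        = compose (carrier Y) V (compose (carrier Y) T (?adj R))" if V: "V \<in> YY.AlXY" for V
      using mem(4)[OF R'] by (auto simp: ops)
    show "compose (carrier Y) (T \<oplus>\<^bsub>?V\<^esub> R) (?adj U)
        = compose (carrier Y) T (?adj U) \<oplus>\<^bsub>bounded_ops Y Y\<^esub> compose (carrier Y) R (?adj U)"
      if U: "U \<in> AlXY" for U
      using mem(4)[OF Al_adj(2)[OF U]] by (auto simp: ops)
  qed
  show ?thesis
  proof (rule cstar_bimodule.intro[OF left right]; (simp only: Al_algebra_simps Al_bimodule_simps)?)
    fix T assume T: "T \<in> AlXY"
    show "cmod_norm ?A ?Z T = bop_norm X Y T" by (rule norm_right[OF T])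
    show "sqrt (bop_norm Y Y (compose (carrier Y) T (?adj T))) = bop_norm X Y T"
      using norm_left[OF T] by simp
    show "compose (carrier X) (compose (carrier X) U T) V = compose (carrier X) U (compose (carrier X) T V)"
      if "V \<in> XX.AlXY" for U V
      using mem(2)[OF that] by (auto simp: ops)
    show "compose (carrier X) (compose (carrier Y) T (?adj R)) U
        = compose (carrier X) T (compose (carrier X) (?adj R) U)" if "U \<in> AlXY" for R U
      using mem(1)[OF that] by (auto simp: ops)
  qed
qed

end

section \<open>Spaces that generate a C*-module\<close>

context right_cstar_module
begin

lemma norm_act_le:
  assumes "z \<in> carrier Z" "b \<in> carrier B"
  shows "cmod_norm B Z (ract Z z b) \<le> cmod_norm B Z z * nrm B b"
proof (rule power2_le_imp_le)
  have "(cmod_norm B Z (ract Z z b))\<^sup>2 = nrm B (star B b \<otimes>\<^bsub>B\<^esub> (rip Z z z \<otimes>\<^bsub>B\<^esub> b))"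
    using assms by (simp add: norm_square act_closed ip_act ip_act_left ip_closed B.mult_assoc)
  also have "\<dots> \<le> nrm B (star B b) * (nrm B (rip Z z z) * nrm B b)"
    using assms B.norm_mult[of "star B b" "rip Z z z \<otimes>\<^bsub>B\<^esub> b"] B.norm_mult[of "rip Z z z" b]
    by (meson B.mult_closed B.norm_nonneg B.star_closed ip_closed mult_left_mono order_trans)
  also have "\<dots> = (cmod_norm B Z z * nrm B b)\<^sup>2"
    using assms by (simp add: norm_square[symmetric] power2_eq_square)
  finally show "(cmod_norm B Z (ract Z z b))\<^sup>2 \<le> (cmod_norm B Z z * nrm B b)\<^sup>2" .
qed (use assms in \<open>simp add: Z.norm_nonneg B.norm_nonneg\<close>)

lemma act_minus_left:
  "\<lbrakk>z \<in> carrier Z; w \<in> carrier Z; b \<in> carrier B\<rbrakk>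
    \<Longrightarrow> ract Z (z \<ominus>\<^bsub>Z\<^esub> w) b = ract Z z b \<ominus>\<^bsub>Z\<^esub> ract Z w b"
  by (simp add: Z.diff_scal act_add_left act_smult_left act_closed)

lemma tends_ip_left:
  assumes "Z.tends u z" "w \<in> carrier Z"
  shows "B.tends (\<lambda>n. rip Z (u n) w) (rip Z z w)"
proof -
  note u = Z.tendsD[OF assms(1)]
  have "(\<lambda>n. cmod_norm B Z (u n \<ominus>\<^bsub>Z\<^esub> z) * cmod_norm B Z w) \<longlonglongrightarrow> 0 * cmod_norm B Z w"
    by (intro tendsto_mult u tendsto_const)
  then show ?thesis
    using u assms(2) Cauchy_Schwarz[of "u _ \<ominus>\<^bsub>Z\<^esub> z" w]
    by (intro B.tends_dominated[where t = "\<lambda>n. cmod_norm B Z (u n \<ominus>\<^bsub>Z\<^esub> z) * cmod_norm B Z w"])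
      (auto simp: ip_closed ip_diff_left[symmetric])
qed

lemma tends_ip_right:
  assumes "Z.tends u z" "w \<in> carrier Z"
  shows "B.tends (\<lambda>n. rip Z w (u n)) (rip Z w z)"
  using B.tends_star[OF tends_ip_left[OF assms]] Z.tendsD[OF assms(1)] assms(2)
  by (simp add: ip_star)

lemma eq_of_ip:
  assumes "z \<in> carrier Z" "w \<in> carrier Z" "\<And>v. v \<in> carrier Z \<Longrightarrow> rip Z z v = rip Z w v"
  shows "z = w"
proof -
  have "rip Z (z \<ominus>\<^bsub>Z\<^esub> w) (z \<ominus>\<^bsub>Z\<^esub> w) = \<zero>\<^bsub>B\<^esub>"
    using assms(1,2) assms(3)[of "z \<ominus>\<^bsub>Z\<^esub> w"] by (simp add: ip_diff_left ip_closed)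
  then have "z \<ominus>\<^bsub>Z\<^esub> w = \<zero>\<^bsub>Z\<^esub>" using ip_definite[of "z \<ominus>\<^bsub>Z\<^esub> w"] assms by simp
  then show ?thesis using assms Z.diff_eq_zero_iff by simp
qed

end

text \<open>
  The properties of a Shilov boundary that make adjointable maps extendable: the embedding is isometric, and
  its range generates the module.
\<close>
locale generating_space =
  P: right_cstar_module B P
  for B :: "'b cstar" and P :: "('b, 'p) cmodule" +
  fixes X :: "'x opspace" and i :: "'x \<Rightarrow> 'p"
  assumes space: "complex_banach X (op_norm X)"
    and embedding_linear: "linear_map X P i"
    and embedding_norm: "x \<in> carrier X \<Longrightarrow> cmod_norm B P (i x) = op_norm X x"
    and generated: "generated_by B P (i ` carrier X)"
begin

lemma embedding:
  shows emb_closed: "x \<in> carrier X \<Longrightarrow> i x \<in> carrier P"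
    and emb_add: "\<lbrakk>x \<in> carrier X; y \<in> carrier X\<rbrakk> \<Longrightarrow> i (x \<oplus>\<^bsub>X\<^esub> y) = i x \<oplus>\<^bsub>P\<^esub> i y"
    and emb_smult: "x \<in> carrier X \<Longrightarrow> i (c \<odot>\<^bsub>X\<^esub> x) = c \<odot>\<^bsub>P\<^esub> i x"
  using embedding_linear by (auto simp: linear_map_def)

lemma cstar_form: "cstar_form B X P i"
  using space P.Cauchy_Schwarz
  by (intro cstar_form.intro P.cstar_algebra)
    (auto simp: embedding P.ip_closed P.ip_add P.ip_smult P.ip_star P.norm_square[symmetric]
      embedding_norm[symmetric] P.ip_positive)

text \<open>
  The elements with property \<open>\<phi>\<close> form a closed subspace that is invariant under the action of \<open>B\<close>, hence under
  the ternary product.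
\<close>
lemma generating_induct [consumes 1, case_names embed add smult act limit]:
  assumes p: "p \<in> carrier P"
    and emb: "\<And>x. x \<in> carrier X \<Longrightarrow> \<phi> (i x)"
    and add: "\<And>p q. \<lbrakk>p \<in> carrier P; q \<in> carrier P; \<phi> p; \<phi> q\<rbrakk> \<Longrightarrow> \<phi> (p \<oplus>\<^bsub>P\<^esub> q)"
    and smult: "\<And>p c. \<lbrakk>p \<in> carrier P; \<phi> p\<rbrakk> \<Longrightarrow> \<phi> (c \<odot>\<^bsub>P\<^esub> p)"
    and act: "\<And>p b. \<lbrakk>p \<in> carrier P; b \<in> carrier B; \<phi> p\<rbrakk> \<Longrightarrow> \<phi> (ract P p b)"
    and limit: "\<And>u l. \<lbrakk>P.Z.tends u l; \<And>n. \<phi> (u n)\<rbrakk> \<Longrightarrow> \<phi> l"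
  shows "\<phi> p"
proof -
  interpret X: complex_banach X "op_norm X" by (rule space)
  let ?E = "{p \<in> carrier P. \<phi> p}"
  have zero: "\<zero>\<^bsub>P\<^esub> \<in> ?E"
    using smult[OF emb_closed[OF X.V.zero_closed] emb[OF X.V.zero_closed], of 0]
    by (simp add: emb_closed)
  have "linear_subspace ?E P"
    by (rule P.Z.V.submoduleI)
      (use zero add smult in \<open>auto simp: P.Z.minus_scal\<close>)
  moreover have "closedin (norm_topology P (cmod_norm B P)) ?E"
    unfolding P.Z.closedin_iff_sequentially
    using limit P.Z.tendsD(1) by fastforce
  moreover have "i ` carrier X \<subseteq> ?E"
    using emb emb_closed by auto
  moreover have "\<forall>x\<in>?E. \<forall>y\<in>?E. \<forall>z\<in>?E. ract P x (rip P y z) \<in> ?E"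
    using act by (auto simp: P.ip_closed P.act_closed)
  ultimately have "?E = carrier P"
    using generated unfolding generated_by_def by blast
  with p show ?thesis by blast
qed

lemma eq_of_ip_embedding:
  assumes z: "z \<in> carrier P" "w \<in> carrier P"
    and eq: "\<And>x. x \<in> carrier X \<Longrightarrow> rip P z (i x) = rip P w (i x)"
  shows "z = w"
proof (rule P.eq_of_ip[OF z])
  fix v assume "v \<in> carrier P"
  then show "rip P z v = rip P w v"
  proof (induction v rule: generating_induct)
    case (limit u l)
    have "P.B.tends (\<lambda>n. rip P z (u n)) (rip P z l)"
      using limit z by (intro P.tends_ip_right) auto
    moreover have "P.B.tends (\<lambda>n. rip P z (u n)) (rip P w l)"
      unfolding limit(2) using limit z by (intro P.tends_ip_right) auto
    ultimately show ?case by (rule P.B.tends_unique)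
  qed (use z eq in \<open>auto simp: P.ip_add P.ip_smult P.ip_act\<close>)
qed

end

section \<open>Extension of adjointable maps to the generated modules\<close>
locale generating_pair =
  X: generating_space B P X i + Y: generating_space B Q Y j
  for B :: "'b cstar" and P :: "('b, 'p) cmodule" and X :: "'x opspace" and i :: "'x \<Rightarrow> 'p"
    and Q :: "('b, 'q) cmodule" and Y :: "'y opspace" and j :: "'y \<Rightarrow> 'q"
begin

lemma swap_generating: "generating_pair B Q Y j P X i"
  by unfold_locales

lemma form_pair: "cstar_form_pair B X P i Y Q j"
  using X.cstar_form Y.cstar_form by (rule cstar_form_pair.intro)

end

locale adjoint_generating_pair = generating_pair B P X i Q Y j
  for B :: "'b cstar" and P :: "('b, 'p) cmodule" and X :: "'x opspace" and i :: "'x \<Rightarrow> 'p"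
    and Q :: "('b, 'q) cmodule" and Y :: "'y opspace" and j :: "'y \<Rightarrow> 'q" +
  fixes T :: "'x \<Rightarrow> 'y" and S :: "'y \<Rightarrow> 'x"
  assumes adjoint: "adjoint_pair X P i Y Q j T S"
begin

lemma swap_adjoint: "adjoint_generating_pair B Q Y j P X i S T"
proof -
  interpret F: cstar_form_pair B X P i Y Q j by (rule form_pair)
  show ?thesis
    by (intro adjoint_generating_pair.intro adjoint_generating_pair_axioms.intro swap_generating
        F.adj_swap adjoint)
qed

sublocale F: cstar_form_pair B X P i Y Q j
  by (rule form_pair)

lemmas adjD = adjoint_pairD[OF adjoint]

abbreviation ST :: "'x \<Rightarrow> 'x" where
  "ST x \<equiv> S (T x)"

lemma ST_power_closed: "x \<in> carrier X \<Longrightarrow> (ST ^^ n) x \<in> carrier X"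
  by (induction n) (auto intro: adjD)

lemma ST_form: "\<lbrakk>x \<in> carrier X; y \<in> carrier X\<rbrakk> \<Longrightarrow> F.X.form (ST x) y = F.X.form x (ST y)"
  using adjD(3)[of x "T y"] adjoint_pairD(3)[OF F.adj_swap[OF adjoint], of "T x" y] adjD(1) by simp

lemma ST_power_form:
  "\<lbrakk>x \<in> carrier X; y \<in> carrier X\<rbrakk>
    \<Longrightarrow> F.X.form ((ST ^^ n) x) ((ST ^^ m) y) = F.X.form x ((ST ^^ (n + m)) y)"
proof (induction n arbitrary: m)
  case (Suc n)
  have "F.X.form ((ST ^^ Suc n) x) ((ST ^^ m) y) = F.X.form ((ST ^^ n) x) ((ST ^^ Suc m) y)"
    using ST_form[OF ST_power_closed ST_power_closed] Suc.prems by simp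
  also have "\<dots> = F.X.form x ((ST ^^ (n + Suc m)) y)"
    using Suc.prems by (rule Suc.IH)
  finally show ?case by simp
qed simp

text \<open>
  An extension \<open>R\<close> of \<open>T\<close> must map \<open>\<Sum>\<^sub>k x\<^sub>k b\<^sub>k\<close> to \<open>q = \<Sum>\<^sub>k (T x\<^sub>k) b\<^sub>k\<close>, where each
  \<open>b\<^sub>k\<close> is a (possibly empty) product of elements of \<open>B\<close>. To see that this
  is well defined and bounded, the sequence \<open>s\<^sub>n = \<Sum>\<^sub>k (S T)\<^sup>n x\<^sub>k b\<^sub>k\<close> is recorded together with \<open>q\<close>. Keeping it as part
  of the data, rather than as a function of \<open>s\<^sub>0\<close>, makes well-definedness a consequence of the norm estimate.
\<close>
inductive orbit :: "(nat \<Rightarrow> 'p) \<Rightarrow> 'q \<Rightarrow> bool" where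
  orbit_embed: "x \<in> carrier X \<Longrightarrow> orbit (\<lambda>n. i ((ST ^^ n) x)) (j (T x))"
| orbit_add: "\<lbrakk>orbit s q; orbit s' q'\<rbrakk> \<Longrightarrow> orbit (\<lambda>n. s n \<oplus>\<^bsub>P\<^esub> s' n) (q \<oplus>\<^bsub>Q\<^esub> q')"
| orbit_smult: "orbit s q \<Longrightarrow> orbit (\<lambda>n. c \<odot>\<^bsub>P\<^esub> s n) (c \<odot>\<^bsub>Q\<^esub> q)"
| orbit_act: "\<lbrakk>orbit s q; b \<in> carrier B\<rbrakk> \<Longrightarrow> orbit (\<lambda>n. ract P (s n) b) (ract Q q b)"

lemma orbit_closed: "orbit s q \<Longrightarrow> (\<forall>n. s n \<in> carrier P) \<and> q \<in> carrier Q"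
  by (induction rule: orbit.induct)
    (auto simp: X.emb_closed Y.emb_closed ST_power_closed adjD X.P.act_closed Y.P.act_closed)

text \<open>
  By sesquilinearity this reduces to \<open>\<langle>(S T)\<^sup>n x | (S T)\<^sup>m y\<rangle> = \<langle>x | (S T)\<^sup>n\<^sup>+\<^sup>m y\<rangle>\<close> and \<open>\<langle>T x | T y\<rangle> = \<langle>x | S T y\<rangle>\<close>.
\<close>
lemma orbit_ip:
  assumes "orbit s q" "orbit s' q'"
  shows "rip P (s n) (s' m) = rip P (s 0) (s' (n + m)) \<and> rip Q q q' = rip P (s 0) (s' 1)"
  using assms
proof (induction arbitrary: n m rule: orbit.induct)
  case (orbit_embed x)
  have ix: "i ((ST ^^ n) x) \<in> carrier P" "i x \<in> carrier P" "j (T x) \<in> carrier Q" for n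
    using orbit_embed(1) by (auto simp: X.emb_closed Y.emb_closed ST_power_closed adjD)
  show ?case
    using orbit_embed(2)
  proof (induction arbitrary: m rule: orbit.induct)
    case (orbit_embed y)
    then show ?case
      using \<open>x \<in> carrier X\<close> ST_power_form[of x y n m] adjD by simp
  next
    case (orbit_add s q s' q')
    then show ?case
      using ix orbit_closed[OF orbit_add(1)] orbit_closed[OF orbit_add(2)]
      by (simp add: X.P.ip_add Y.P.ip_add)
  next
    case (orbit_smult s q c)
    then show ?case
      using ix orbit_closed[OF orbit_smult(1)] by (simp add: X.P.ip_smult Y.P.ip_smult)
  next
    case (orbit_act s q b)
    then show ?case
      using ix orbit_closed[OF orbit_act(1)] by (simp add: X.P.ip_act Y.P.ip_act)
  qed
next
  case (orbit_add s1 q1 s2 q2)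
  note IH = orbit_add(3)[OF orbit_add(5), of n m] orbit_add(4)[OF orbit_add(5), of n m]
  show ?case
    using IH orbit_closed[OF orbit_add(1)] orbit_closed[OF orbit_add(2)] orbit_closed[OF orbit_add(5)]
    by (simp add: X.P.ip_add_left Y.P.ip_add_left)
next
  case (orbit_smult s1 q1 c)
  note IH = orbit_smult(2)[OF orbit_smult(3), of n m]
  show ?case
    using IH orbit_closed[OF orbit_smult(1)] orbit_closed[OF orbit_smult(3)]
    by (simp add: X.P.ip_smult_left Y.P.ip_smult_left)
next
  case (orbit_act s1 q1 b)
  note IH = orbit_act(3)[OF orbit_act(4), of n m]
  show ?case
    using IH orbit_act(2) orbit_closed[OF orbit_act(1)] orbit_closed[OF orbit_act(4)]
    by (simp add: X.P.ip_act_left Y.P.ip_act_left)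
qed

lemma orbit_ip_embed:
  assumes "orbit s q" "y \<in> carrier Y"
  shows "rip Q q (j y) = rip P (s 0) (i (S y))"
  using assms(1)
proof (induction rule: orbit.induct)
  case (orbit_embed x)
  then show ?case using assms(2) adjD(3) by simp
next
  case (orbit_add s q s' q')
  then show ?case
    using orbit_closed[OF orbit_add(1)] orbit_closed[OF orbit_add(2)] assms(2)
    by (simp add: X.P.ip_add_left Y.P.ip_add_left X.emb_closed Y.emb_closed adjD)
next
  case (orbit_smult s q c)
  then show ?case
    using orbit_closed[OF orbit_smult(1)] assms(2)
    by (simp add: X.P.ip_smult_left Y.P.ip_smult_left X.emb_closed Y.emb_closed adjD)
next
  case (orbit_act s q b)
  then show ?case
    using orbit_closed[OF orbit_act(1)] assms(2)
    by (simp add: X.P.ip_act_left Y.P.ip_act_left X.emb_closed Y.emb_closed adjD)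
qed

lemma ST_bound:
  obtains K where "K > 0" "\<And>x. x \<in> carrier X \<Longrightarrow> op_norm X (ST x) \<le> K * op_norm X x"
proof -
  interpret YX: cstar_form_pair B Y Q j X P i by (rule F.swap)
  let ?K = "bop_norm Y X S * bop_norm X Y T"
  have S: "adjoint_pair Y Q j X P i S T" by (rule F.adj_swap[OF adjoint])
  have "op_norm X (ST x) \<le> (?K + 1) * op_norm X x" if x: "x \<in> carrier X" for x
  proof -
    have "op_norm X (ST x) \<le> bop_norm Y X S * op_norm Y (T x)"
      using YX.adj_norm_le[OF S] adjD(1)[OF x] .
    also have "\<dots> \<le> bop_norm Y X S * (bop_norm X Y T * op_norm X x)"
      using F.adj_norm_le[OF adjoint x] YX.adj_norm_nonneg[OF S] by (rule mult_left_mono)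
    also have "\<dots> \<le> (?K + 1) * op_norm X x"
      using F.X.norm_nonneg[OF x] by (simp add: algebra_simps)
    finally show ?thesis .
  qed
  moreover have "0 \<le> ?K"
    using YX.adj_norm_nonneg[OF S] F.adj_norm_nonneg[OF adjoint] by simp
  ultimately show thesis by (intro that[of "?K + 1"]) auto
qed

text \<open>
  The constant \<open>M\<close> depends on the presentation \<open>\<Sum>\<^sub>k x\<^sub>k b\<^sub>k\<close>, but the rate \<open>K\<close> does not.
\<close>
lemma orbit_growth:
  assumes K: "K > 0" "\<And>x. x \<in> carrier X \<Longrightarrow> op_norm X (ST x) \<le> K * op_norm X x"
    and "orbit s q"
  shows "\<exists>M. \<forall>n. cmod_norm B P (s n) \<le> M * K ^ n"
  using assms(3)
proof (induction rule: orbit.induct)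
  case (orbit_embed x)
  have "op_norm X ((ST ^^ n) x) \<le> op_norm X x * K ^ n" for n
  proof (induction n)
    case (Suc n)
    have "op_norm X ((ST ^^ Suc n) x) \<le> K * op_norm X ((ST ^^ n) x)"
      using K(2)[OF ST_power_closed[OF orbit_embed]] by simp
    also have "\<dots> \<le> K * (op_norm X x * K ^ n)"
      using Suc K(1) by (intro mult_left_mono) auto
    finally show ?case by (simp add: mult_ac)
  qed simp
  then show ?case
    using X.embedding_norm[OF ST_power_closed[OF orbit_embed]] by (intro exI[of _ "op_norm X x"]) simp
next
  case (orbit_add s q s' q')
  then obtain M M' where M: "\<And>n. cmod_norm B P (s n) \<le> M * K ^ n" "\<And>n. cmod_norm B P (s' n) \<le> M' * K ^ n"
    by blast
  have "cmod_norm B P (s n \<oplus>\<^bsub>P\<^esub> s' n) \<le> (M + M') * K ^ n" for n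
    using X.P.Z.norm_triangle[of "s n" "s' n"] M(1)[of n] M(2)[of n]
      orbit_closed[OF orbit_add(1)] orbit_closed[OF orbit_add(2)] by (simp add: distrib_right)
  then show ?case by blast
next
  case (orbit_smult s q c)
  then obtain M where M: "\<And>n. cmod_norm B P (s n) \<le> M * K ^ n" by blast
  have "cmod_norm B P (c \<odot>\<^bsub>P\<^esub> s n) \<le> (cmod c * M) * K ^ n" for n
    using mult_left_mono[OF M[of n], of "cmod c"] orbit_closed[OF orbit_smult(1)]
    by (simp add: X.P.Z.norm_smult mult_ac)
  then show ?case by blast
next
  case (orbit_act s q b)
  then obtain M where M: "\<And>n. cmod_norm B P (s n) \<le> M * K ^ n" by blast
  have "cmod_norm B P (ract P (s n) b) \<le> (M * nrm B b) * K ^ n" for n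
  proof -
    have "cmod_norm B P (ract P (s n) b) \<le> cmod_norm B P (s n) * nrm B b"
      using orbit_closed[OF orbit_act(1)] orbit_act(2) by (intro X.P.norm_act_le) auto
    also have "\<dots> \<le> M * K ^ n * nrm B b"
      using M[of n] orbit_act(2) by (intro mult_right_mono X.P.B.norm_nonneg) auto
    finally show ?thesis by (simp add: mult_ac)
  qed
  then show ?case by blast
qed

text \<open>
  From \<open>\<parallel>s\<^sub>n\<parallel>\<^sup>2 = \<parallel>\<langle>s\<^sub>0 | s\<^sub>2\<^sub>n\<rangle>\<parallel> \<le> \<parallel>s\<^sub>0\<parallel> \<parallel>s\<^sub>2\<^sub>n\<parallel>\<close> the ratio \<open>\<rho> = \<parallel>s\<^sub>1\<parallel> / \<parallel>s\<^sub>0\<parallel>\<close> forces \<open>\<parallel>s\<^sub>m\<parallel> \<ge> \<rho>\<^sup>m \<parallel>s\<^sub>0\<parallel>\<close> for all powers \<open>m\<close> of two. This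
  contradicts the growth rate \<open>K\<close> if \<open>\<rho> > K\<close>. In this way the constant \<open>M\<close> disappears.
\<close>
lemma orbit_step_bound:
  assumes K: "K > 0" "\<And>x. x \<in> carrier X \<Longrightarrow> op_norm X (ST x) \<le> K * op_norm X x"
    and s: "orbit s q"
  shows "cmod_norm B P (s 1) \<le> K * cmod_norm B P (s 0)"
proof (rule ccontr)
  define f where "f n = cmod_norm B P (s n)" for n
  define c where "c = f 0"
  assume "\<not> cmod_norm B P (s 1) \<le> K * cmod_norm B P (s 0)"
  then have big: "K * c < f 1" by (simp add: f_def c_def)
  have f_nonneg: "0 \<le> f n" for n
    using orbit_closed[OF s] by (simp add: f_def X.P.Z.norm_nonneg)
  have f_square: "(f n)\<^sup>2 \<le> c * f (2 * n)" for n
  proof -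
    have "(f n)\<^sup>2 = nrm B (rip P (s 0) (s (2 * n)))"
      using orbit_ip[OF s s, of n n] orbit_closed[OF s] by (simp add: f_def X.P.norm_square mult_2)
    also have "\<dots> \<le> c * f (2 * n)"
      using orbit_closed[OF s] by (simp add: f_def c_def X.P.Cauchy_Schwarz)
    finally show ?thesis .
  qed
  have c: "c > 0"
  proof (rule ccontr)
    assume "\<not> c > 0"
    then have "c = 0" using f_nonneg[of 0] by (simp add: c_def)
    then show False using f_square[of 1] big by simp
  qed
  define \<rho> where "\<rho> = f 1 / c"
  have \<rho>: "K < \<rho>" using big c by (simp add: \<rho>_def field_simps)
  have lower: "c * \<rho> ^ (2 ^ n) \<le> f (2 ^ n)" for n
  proof (induction n)
    case (Suc n)
    have "0 \<le> c * \<rho> ^ (2 ^ n)" using c K(1) \<rho> by simp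
    then have "(c * \<rho> ^ (2 ^ n))\<^sup>2 \<le> (f (2 ^ n))\<^sup>2"
      using Suc by (intro power_mono)
    also have "\<dots> \<le> c * f (2 ^ Suc n)"
      using f_square[of "2 ^ n"] by simp
    finally have "c * (c * \<rho> ^ (2 ^ Suc n)) \<le> c * f (2 ^ Suc n)"
      by (simp add: power2_eq_square power_add[symmetric] mult_2[symmetric] mult_ac)
    then show ?case using c by simp
  qed (use c in \<open>simp add: \<rho>_def\<close>)
  obtain M where M: "\<And>n. f n \<le> M * K ^ n"
    using orbit_growth[OF K s] by (auto simp: f_def)
  have bounded: "(\<rho> / K) ^ (2 ^ n) \<le> M / c" for n
  proof -
    have "c * \<rho> ^ (2 ^ n) \<le> M * K ^ (2 ^ n)" using lower[of n] M[of "2 ^ n"] by simp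
    then show ?thesis using c K(1) by (simp add: power_divide field_simps)
  qed
  have 1: "1 < \<rho> / K" using \<rho> K(1) by simp
  then obtain n where "M / c < (\<rho> / K) ^ n" using real_arch_pow by blast
  also have "(\<rho> / K) ^ n \<le> (\<rho> / K) ^ (2 ^ n)"
    using 1 by (intro power_increasing) (auto intro: less_imp_le less_exp)
  also have "\<dots> \<le> M / c" by (rule bounded)
  finally show False by simp
qed

lemma orbit_norm_bound:
  assumes K: "K > 0" "\<And>x. x \<in> carrier X \<Longrightarrow> op_norm X (ST x) \<le> K * op_norm X x"
    and s: "orbit s q"
  shows "cmod_norm B Q q \<le> sqrt K * cmod_norm B P (s 0)"
proof (rule power2_le_imp_le)
  let ?c = "cmod_norm B P (s 0)"
  have c: "0 \<le> ?c" using orbit_closed[OF s] by (simp add: X.P.Z.norm_nonneg)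
  have "(cmod_norm B Q q)\<^sup>2 = nrm B (rip P (s 0) (s 1))"
    using orbit_ip[OF s s] orbit_closed[OF s] by (simp add: Y.P.norm_square)
  also have "\<dots> \<le> ?c * cmod_norm B P (s 1)"
    using orbit_closed[OF s] by (simp add: X.P.Cauchy_Schwarz)
  also have "\<dots> \<le> ?c * (K * ?c)"
    using orbit_step_bound[OF K s] c by (rule mult_left_mono)
  also have "\<dots> = (sqrt K * ?c)\<^sup>2"
    using K(1) by (simp add: power2_eq_square[of ?c] power_mult_distrib)
  finally show "(cmod_norm B Q q)\<^sup>2 \<le> (sqrt K * ?c)\<^sup>2" .
  show "0 \<le> sqrt K * ?c" using K(1) c by simp
qed

lemma orbit_dense:
  assumes "p \<in> carrier P" "\<epsilon> > 0"
  shows "\<exists>s q. orbit s q \<and> cmod_norm B P (s 0 \<ominus>\<^bsub>P\<^esub> p) < \<epsilon>"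
  using assms
proof (induction p arbitrary: \<epsilon> rule: X.generating_induct)
  case (embed x)
  then show ?case
    using orbit_embed[of x] by (auto simp: X.emb_closed intro!: exI)
next
  case (add p p')
  obtain s q s' q' where s: "orbit s q" "cmod_norm B P (s 0 \<ominus>\<^bsub>P\<^esub> p) < \<epsilon> / 2"
    and s': "orbit s' q'" "cmod_norm B P (s' 0 \<ominus>\<^bsub>P\<^esub> p') < \<epsilon> / 2"
    using add(3)[of "\<epsilon> / 2"] add(4)[of "\<epsilon> / 2"] \<open>\<epsilon> > 0\<close> by auto
  have "cmod_norm B P ((s 0 \<oplus>\<^bsub>P\<^esub> s' 0) \<ominus>\<^bsub>P\<^esub> (p \<oplus>\<^bsub>P\<^esub> p')) < \<epsilon>"
    using X.P.Z.norm_triangle[of "s 0 \<ominus>\<^bsub>P\<^esub> p" "s' 0 \<ominus>\<^bsub>P\<^esub> p'"] s(2) s'(2) add(1,2)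
      orbit_closed[OF s(1)] orbit_closed[OF s'(1)] by (simp add: X.P.Z.add_diff_add)
  then show ?case using orbit_add[OF s(1) s'(1)] by (intro exI conjI)
next
  case (smult p c)
  obtain s q where s: "orbit s q" "cmod_norm B P (s 0 \<ominus>\<^bsub>P\<^esub> p) < \<epsilon> / (cmod c + 1)"
    using smult(2)[of "\<epsilon> / (cmod c + 1)"] \<open>\<epsilon> > 0\<close> by (auto simp: add_nonneg_pos)
  have "cmod_norm B P (c \<odot>\<^bsub>P\<^esub> s 0 \<ominus>\<^bsub>P\<^esub> c \<odot>\<^bsub>P\<^esub> p) = cmod c * cmod_norm B P (s 0 \<ominus>\<^bsub>P\<^esub> p)"
    using smult(1) orbit_closed[OF s(1)] by (simp add: X.P.Z.scal_diff_right[symmetric] X.P.Z.norm_smult)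
  also have "\<dots> \<le> cmod c * (\<epsilon> / (cmod c + 1))"
    using s(2) by (intro mult_left_mono) auto
  also have "\<dots> < \<epsilon>"
    using \<open>\<epsilon> > 0\<close> add_nonneg_pos[OF norm_ge_zero zero_less_one, of c] by (simp add: field_simps)
  finally show ?case using orbit_smult[OF s(1)] by (intro exI conjI)
next
  case (act p b)
  let ?r = "nrm B b"
  have r: "0 \<le> ?r" using act(2) by (rule X.P.B.norm_nonneg)
  obtain s q where s: "orbit s q" "cmod_norm B P (s 0 \<ominus>\<^bsub>P\<^esub> p) < \<epsilon> / (?r + 1)"
    using act(3)[of "\<epsilon> / (?r + 1)"] \<open>\<epsilon> > 0\<close> r by auto
  have "cmod_norm B P (ract P (s 0) b \<ominus>\<^bsub>P\<^esub> ract P p b) \<le> cmod_norm B P (s 0 \<ominus>\<^bsub>P\<^esub> p) * ?r"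
    using act(1,2) orbit_closed[OF s(1)] X.P.norm_act_le[of "s 0 \<ominus>\<^bsub>P\<^esub> p" b]
    by (simp add: X.P.act_minus_left)
  also have "\<dots> \<le> \<epsilon> / (?r + 1) * ?r"
    using s(2) r by (intro mult_right_mono) auto
  also have "\<dots> < \<epsilon>"
    using \<open>\<epsilon> > 0\<close> r by (simp add: field_simps)
  finally show ?case using orbit_act[OF s(1) act(2)] by (intro exI conjI)
next
  case (limit u l)
  note u = X.P.Z.tendsD[OF limit(1)]
  obtain n where "\<forall>m\<ge>n. norm (cmod_norm B P (u m \<ominus>\<^bsub>P\<^esub> l) - 0) < \<epsilon> / 2"
    using LIMSEQ_D[OF u(3), of "\<epsilon> / 2"] \<open>\<epsilon> > 0\<close> by auto
  then have "cmod_norm B P (u n \<ominus>\<^bsub>P\<^esub> l) < \<epsilon> / 2"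
    by (fastforce simp: abs_less_iff)
  moreover obtain s q where s: "orbit s q" "cmod_norm B P (s 0 \<ominus>\<^bsub>P\<^esub> u n) < \<epsilon> / 2"
    using limit(2)[of "\<epsilon> / 2" n] \<open>\<epsilon> > 0\<close> by auto
  ultimately have "cmod_norm B P (s 0 \<ominus>\<^bsub>P\<^esub> l) < \<epsilon>"
    using X.P.Z.norm_diff_triangle[of "s 0" "u n" l] u orbit_closed[OF s(1)] by simp
  then show ?case using s(1) by blast
qed

text \<open>
  Approximate \<open>p\<close> by initial terms \<open>s\<^sub>0\<close> of orbits. The corresponding elements \<open>q\<close> form a Cauchy sequence since
  orbits are closed under differences, and both the norm bound and the inner products with \<open>Y\<close> pass to the limit.
\<close>
lemma extension_value:
  obtains K where "\<And>p. p \<in> carrier P \<Longrightarrow> \<exists>q\<in>carrier Q. cmod_norm B Q q \<le> K * cmod_norm B P p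
    \<and> (\<forall>y\<in>carrier Y. rip Q q (j y) = rip P p (i (S y)))"
proof -
  obtain K where K: "K > 0" "\<And>x. x \<in> carrier X \<Longrightarrow> op_norm X (ST x) \<le> K * op_norm X x"
    by (rule ST_bound) blast
  have "\<exists>q\<in>carrier Q. cmod_norm B Q q \<le> sqrt K * cmod_norm B P p
    \<and> (\<forall>y\<in>carrier Y. rip Q q (j y) = rip P p (i (S y)))" if p: "p \<in> carrier P" for p
  proof -
    have "\<forall>n. \<exists>s q. orbit s q \<and> cmod_norm B P (s 0 \<ominus>\<^bsub>P\<^esub> p) < inverse (real (Suc n))"
      using orbit_dense[OF p] by simp
    then obtain s q where s: "\<And>n. orbit (s n) (q n)"
      and close: "\<And>n. cmod_norm B P (s n 0 \<ominus>\<^bsub>P\<^esub> p) < inverse (real (Suc n))"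
      by metis
    have c: "s n m \<in> carrier P" "q n \<in> carrier Q" for n m using orbit_closed[OF s[of n]] by auto
    have tp: "X.P.Z.tends (\<lambda>n. s n 0) p"
      using close by (intro X.P.Z.tends_dominated[OF _ p _ LIMSEQ_inverse_real_of_nat])
        (auto simp: c intro: less_imp_le)
    have diff: "cmod_norm B Q (q m \<ominus>\<^bsub>Q\<^esub> q n) \<le> sqrt K * cmod_norm B P (s m 0 \<ominus>\<^bsub>P\<^esub> s n 0)" for m n
      using orbit_norm_bound[OF K orbit_add[OF s[of m] orbit_smult[OF s[of n], of "- 1"]]]
      by (simp add: X.P.Z.diff_scal Y.P.Z.diff_scal c)
    have "\<exists>l. Y.P.Z.tends q l"
    proof (rule Y.P.Z.Cauchy_tends[OF c(2)])
      fix \<epsilon> :: real assume "\<epsilon> > 0"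
      then have e: "0 < \<epsilon> / (2 * sqrt K)" using K(1) by simp
      obtain M where "\<forall>n\<ge>M. norm (cmod_norm B P (s n 0 \<ominus>\<^bsub>P\<^esub> p) - 0) < \<epsilon> / (2 * sqrt K)"
        using LIMSEQ_D[OF X.P.Z.tendsD(3)[OF tp] e] by blast
      then have M: "cmod_norm B P (s n 0 \<ominus>\<^bsub>P\<^esub> p) < \<epsilon> / (2 * sqrt K)" if "n \<ge> M" for n
        using that by (fastforce simp: abs_less_iff)
      have "cmod_norm B Q (q m \<ominus>\<^bsub>Q\<^esub> q n) < \<epsilon>" if "m \<ge> M" "n \<ge> M" for m n
      proof -
        have "cmod_norm B P (s m 0 \<ominus>\<^bsub>P\<^esub> s n 0) < \<epsilon> / sqrt K"
          using X.P.Z.norm_diff_triangle[OF c(1) p c(1), of m 0 n 0]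
            X.P.Z.norm_diff_commute[OF p c(1), of n 0] M[OF that(1)] M[OF that(2)] by simp
        then have "sqrt K * cmod_norm B P (s m 0 \<ominus>\<^bsub>P\<^esub> s n 0) < \<epsilon>"
          using K(1) by (simp add: field_simps)
        then show ?thesis using diff[of m n] by simp
      qed
      then show "\<exists>M. \<forall>m\<ge>M. \<forall>n\<ge>M. cmod_norm B Q (q m \<ominus>\<^bsub>Q\<^esub> q n) < \<epsilon>" by blast
    qed
    then obtain l where l: "Y.P.Z.tends q l" by blast
    have "cmod_norm B Q l \<le> sqrt K * cmod_norm B P p"
    proof (rule LIMSEQ_le)
      show "(\<lambda>n. cmod_norm B Q (q n)) \<longlonglongrightarrow> cmod_norm B Q l" by (rule Y.P.Z.tends_norm[OF l])
      show "(\<lambda>n. sqrt K * cmod_norm B P (s n 0)) \<longlonglongrightarrow> sqrt K * cmod_norm B P p"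
        by (intro tendsto_mult tendsto_const X.P.Z.tends_norm[OF tp])
      show "\<exists>N. \<forall>n\<ge>N. cmod_norm B Q (q n) \<le> sqrt K * cmod_norm B P (s n 0)"
        using orbit_norm_bound[OF K s] by blast
    qed
    moreover have "rip Q l (j y) = rip P p (i (S y))" if y: "y \<in> carrier Y" for y
    proof (rule X.P.B.tends_unique)
      show "X.P.B.tends (\<lambda>n. rip Q (q n) (j y)) (rip Q l (j y))"
        using l y by (intro Y.P.tends_ip_left Y.emb_closed)
      show "X.P.B.tends (\<lambda>n. rip Q (q n) (j y)) (rip P p (i (S y)))"
        unfolding orbit_ip_embed[OF s y] using tp y adjD by (intro X.P.tends_ip_left X.emb_closed)
    qed
    ultimately show ?thesis using Y.P.Z.tendsD(1)[OF l] by blast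
  qed
  then show thesis by (rule that)
qed

text \<open>
  The value at \<open>p\<close> is unique because \<open>j Y\<close> separates the points of \<open>Q\<close>. Uniqueness makes the choice of values
  linear and compatible with the action.
\<close>
lemma extension:
  obtains R K where "R \<in> carrier P \<rightarrow> carrier Q" "bmodule_map B P Q R"
    "\<And>p y. \<lbrakk>p \<in> carrier P; y \<in> carrier Y\<rbrakk> \<Longrightarrow> rip Q (R p) (j y) = rip P p (i (S y))"
    "\<And>p. p \<in> carrier P \<Longrightarrow> cmod_norm B Q (R p) \<le> K * cmod_norm B P p"
    "\<And>x. x \<in> carrier X \<Longrightarrow> R (i x) = j (T x)"
proof -
  obtain K where "\<And>p. p \<in> carrier P \<Longrightarrow> \<exists>q\<in>carrier Q. cmod_norm B Q q \<le> K * cmod_norm B P p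
    \<and> (\<forall>y\<in>carrier Y. rip Q q (j y) = rip P p (i (S y)))"
    by (rule extension_value) blast
  then obtain R where R: "\<And>p. p \<in> carrier P \<Longrightarrow> R p \<in> carrier Q"
    and K: "\<And>p. p \<in> carrier P \<Longrightarrow> cmod_norm B Q (R p) \<le> K * cmod_norm B P p"
    and ip: "\<And>p y. \<lbrakk>p \<in> carrier P; y \<in> carrier Y\<rbrakk> \<Longrightarrow> rip Q (R p) (j y) = rip P p (i (S y))"
    by metis
  note closed = R X.emb_closed Y.emb_closed adjD(1,2) X.P.act_closed Y.P.act_closed
  have "bmodule_map B P Q R"
    unfolding bmodule_map_def linear_map_def
  proof (intro conjI ballI allI)
    show "R (p \<oplus>\<^bsub>P\<^esub> p') = R p \<oplus>\<^bsub>Q\<^esub> R p'" if "p \<in> carrier P" "p' \<in> carrier P" for p p'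
      using that by (intro Y.eq_of_ip_embedding)
        (simp_all add: closed ip X.P.ip_add_left Y.P.ip_add_left)
    show "R (c \<odot>\<^bsub>P\<^esub> p) = c \<odot>\<^bsub>Q\<^esub> R p" if "p \<in> carrier P" for c p
      using that by (intro Y.eq_of_ip_embedding)
        (simp_all add: closed ip X.P.ip_smult_left Y.P.ip_smult_left)
    show "R (ract P p b) = ract Q (R p) b" if "p \<in> carrier P" "b \<in> carrier B" for p b
      using that by (intro Y.eq_of_ip_embedding)
        (simp_all add: closed ip X.P.ip_act_left Y.P.ip_act_left)
  qed (use R in auto)
  moreover have "R (i x) = j (T x)" if "x \<in> carrier X" for x
    using that by (intro Y.eq_of_ip_embedding) (simp_all add: closed ip adjD(3))
  ultimately show thesis using R ip K by (intro that[of R K]) auto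
qed

text \<open>
  Let \<open>R\<close> and \<open>R'\<close> extend \<open>T\<close> and \<open>S\<close>. For \<open>p\<close> in \<open>X\<close> the equation \<open>\<langle>R p | q\<rangle> = \<langle>p | R' q\<rangle>\<close> is the property that determines \<open>R'\<close>. Both sides
  are continuous in \<open>p\<close> and compatible with the action, so it holds on the whole module.
\<close>
lemma adjointable_extension:
  "\<exists>R R'. bmodule_map B P Q R \<and> adjoint_maps P Q R R'
     \<and> (\<forall>x\<in>carrier X. R (i x) = j (T x)) \<and> (\<forall>y\<in>carrier Y. R' (j y) = i (S y))"
proof -
  interpret swapped: adjoint_generating_pair B Q Y j P X i S T by (rule swap_adjoint)
  obtain R K where R: "R \<in> carrier P \<rightarrow> carrier Q" "bmodule_map B P Q R"
    "\<And>p y. \<lbrakk>p \<in> carrier P; y \<in> carrier Y\<rbrakk> \<Longrightarrow> rip Q (R p) (j y) = rip P p (i (S y))"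
    "\<And>p. p \<in> carrier P \<Longrightarrow> cmod_norm B Q (R p) \<le> K * cmod_norm B P p"
    "\<And>x. x \<in> carrier X \<Longrightarrow> R (i x) = j (T x)"
    by (rule extension) blast
  obtain R' where R': "R' \<in> carrier Q \<rightarrow> carrier P"
    "\<And>q x. \<lbrakk>q \<in> carrier Q; x \<in> carrier X\<rbrakk> \<Longrightarrow> rip P (R' q) (i x) = rip Q q (j (T x))"
    "\<And>y. y \<in> carrier Y \<Longrightarrow> R' (j y) = i (S y)"
    by (rule swapped.extension) blast
  have Rc: "p \<in> carrier P \<Longrightarrow> R p \<in> carrier Q" and R'c: "q \<in> carrier Q \<Longrightarrow> R' q \<in> carrier P" for p q
    using R(1) R'(1) by auto
  have lin: "\<lbrakk>p \<in> carrier P; p' \<in> carrier P\<rbrakk> \<Longrightarrow> R (p \<oplus>\<^bsub>P\<^esub> p') = R p \<oplus>\<^bsub>Q\<^esub> R p'"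
    "p \<in> carrier P \<Longrightarrow> R (c \<odot>\<^bsub>P\<^esub> p) = c \<odot>\<^bsub>Q\<^esub> R p"
    "\<lbrakk>p \<in> carrier P; b \<in> carrier B\<rbrakk> \<Longrightarrow> R (ract P p b) = ract Q (R p) b" for p p' c b
    using R(2) by (auto simp: bmodule_map_def linear_map_def)
  have "rip Q (R p) q = rip P p (R' q)" if p: "p \<in> carrier P" and q: "q \<in> carrier Q" for p q
    using p
  proof (induction p rule: X.generating_induct)
    case (embed x)
    have "rip Q (j (T x)) q = star B (rip Q q (j (T x)))"
      using embed q by (simp add: Y.P.ip_star Y.emb_closed adjD)
    also have "\<dots> = star B (rip P (R' q) (i x))"
      using embed q R'(2) by simp
    also have "\<dots> = rip P (i x) (R' q)"
      using embed q by (simp add: X.P.ip_star X.emb_closed R'c)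
    finally show ?case using R(5)[OF embed] by simp
  next
    case (limit u l)
    note u = X.P.Z.tendsD[OF limit(1)]
    have "Y.P.Z.tends (\<lambda>n. R (u n)) (R l)"
    proof (rule Y.P.Z.tends_dominated[where t = "\<lambda>n. K * cmod_norm B P (u n \<ominus>\<^bsub>P\<^esub> l)"])
      show "cmod_norm B Q (R (u n) \<ominus>\<^bsub>Q\<^esub> R l) \<le> K * cmod_norm B P (u n \<ominus>\<^bsub>P\<^esub> l)" for n
        using R(4)[of "u n \<ominus>\<^bsub>P\<^esub> l"] u by (simp add: X.P.Z.diff_scal Y.P.Z.diff_scal lin Rc)
      show "(\<lambda>n. K * cmod_norm B P (u n \<ominus>\<^bsub>P\<^esub> l)) \<longlonglongrightarrow> 0"
        using tendsto_mult[OF tendsto_const u(3), of K] by simp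
    qed (use u Rc in auto)
    then have "X.P.B.tends (\<lambda>n. rip Q (R (u n)) q) (rip Q (R l) q)"
      using q by (rule Y.P.tends_ip_left)
    moreover have "X.P.B.tends (\<lambda>n. rip Q (R (u n)) q) (rip P l (R' q))"
      unfolding limit(2) using limit(1) R'c[OF q] by (rule X.P.tends_ip_left)
    ultimately show ?case by (rule X.P.B.tends_unique)
  qed (use q Rc R'c in \<open>auto simp: lin X.P.ip_add_left Y.P.ip_add_left X.P.ip_smult_left
      Y.P.ip_smult_left X.P.ip_act_left Y.P.ip_act_left\<close>)
  then have "adjoint_maps P Q R R'"
    using R(1) R'(1) by (auto simp: adjoint_maps_def)
  then show ?thesis using R(2,5) R'(3) by blast
qed

end

section \<open>Shilov boundaries\<close>

lemma (in cstar_algebra) finsum_one: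
  fixes f :: "nat \<Rightarrow> 'a"
  assumes "f 0 \<in> carrier A"
  shows "(\<Oplus>k\<in>{..<1}. f k) = f 0"
proof -
  have "{..<1::nat} = {0}" by auto
  then show ?thesis using V.finsum_insert[of "{}" 0 f] assms by simp
qed

text \<open>
  The supremum over the unit ball is a maximum, attained at \<open>c\<^sup>* / \<parallel>c\<parallel>\<close> if \<open>c \<noteq> 0\<close>. For \<open>c = 0\<close> this expression
  is \<open>0\<close>, as division by zero yields zero.
\<close>
lemma (in cstar_algebra) cstar_matrix_norm_one:
  assumes c: "b 0 0 \<in> carrier A"
  shows "cstar_matrix_norm A 1 b = nrm A (b 0 0)"
proof -
  let ?c = "b 0 0"
  have col: "column_norm A 1 v = nrm A (v 0)" if "v 0 \<in> carrier A" for v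
    using that finsum_one[of "\<lambda>i. star A (v i) \<otimes> v i"]
    by (simp add: column_norm_def cstar_identity norm_nonneg)
  have matrix_apply: "column_norm A 1 (\<lambda>i. \<Oplus>j\<in>{..<1}. b i j \<otimes> v j) = nrm A (?c \<otimes> v 0)"
    if "v 0 \<in> carrier A" for v
    using that c finsum_one[of "\<lambda>j. b 0 j \<otimes> v j"] by (subst col) simp_all
  show ?thesis
    unfolding cstar_matrix_norm_def
  proof (rule cSup_eq_maximum)
    let ?r = "nrm A ?c"
    let ?v = "\<lambda>_ :: nat. complex_of_real (1 / ?r) \<odot> star A ?c"
    have "column_norm A 1 ?v \<le> 1"
      using c norm_nonneg[OF c] by (subst col) (simp_all add: norm_smult norm_divide)
    moreover have "nrm A (?c \<otimes> ?v 0) = ?r"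
      using c norm_nonneg[OF c] cstar_identity[of "star A ?c"]
      by (simp add: smult_mult_right norm_smult norm_divide power2_eq_square)
    ultimately show "?r \<in> {column_norm A 1 (\<lambda>i. \<Oplus>j\<in>{..<1}. b i j \<otimes> v j) |v.
        v \<in> {..<1} \<rightarrow> carrier A \<and> column_norm A 1 v \<le> 1}"
      using c matrix_apply[of ?v] by (intro CollectI exI[of _ ?v]) auto
  next
    fix x assume "x \<in> {column_norm A 1 (\<lambda>i. \<Oplus>j\<in>{..<1}. b i j \<otimes> v j) |v.
        v \<in> {..<1} \<rightarrow> carrier A \<and> column_norm A 1 v \<le> 1}"
    then obtain v where v: "x = column_norm A 1 (\<lambda>i. \<Oplus>j\<in>{..<1}. b i j \<otimes> v j)"
      "v 0 \<in> carrier A" "column_norm A 1 v \<le> 1" by auto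
    have "x \<le> nrm A ?c * nrm A (v 0)"
      unfolding v(1) matrix_apply[of v, OF v(2)] by (rule norm_mult[OF c v(2)])
    also have "\<dots> \<le> nrm A ?c"
      using v(3) norm_nonneg[OF c] unfolding col[of v, OF v(2)] by (simp add: mult_left_le)
    finally show "x \<le> nrm A ?c" .
  qed
qed

lemma complete_isometry_norm:
  assumes Z: "right_cstar_module B Z" and k: "complete_isometry X B Z k" and x: "x \<in> carrier X"
  shows "cmod_norm B Z (k x) = op_norm X x"
proof -
  interpret right_cstar_module B Z by fact
  have kx: "k x \<in> carrier Z" using k x by (auto simp: complete_isometry_def linear_map_def)
  have "cmod_matrix_norm B Z 1 (\<lambda>_ _. k x) = op_norm X x"
    using k x unfolding complete_isometry_def op_norm_def matrices_def by auto
  moreover have "cmod_matrix_norm B Z 1 (\<lambda>_ _. k x) = cmod_norm B Z (k x)"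
    using kx B.finsum_one[of "\<lambda>_. rip Z (k x) (k x)"]
    by (simp add: cmod_matrix_norm_def cmod_norm_def B.cstar_matrix_norm_one ip_closed del: One_nat_def)
  ultimately show ?thesis by simp
qed

text \<open>
  A complete isometry is an isometry on matrices of size one.
\<close>
lemma shilov_generating_space:
  assumes "shilov_boundary X B P i"
  shows "generating_space B P X i"
proof -
  interpret shilov_boundary X B P i by fact
  show ?thesis
  proof (intro generating_space.intro cmodule generating_space_axioms.intro)
    show "complex_banach X (op_norm X)" using operator_space by (rule operator_space.banach)
    show "linear_map X P i" using embedding by (simp add: complete_isometry_def)
    show "generated_by B P (i ` carrier X)" by (rule generated)
  qed (rule complete_isometry_norm[OF cmodule embedding])
qed

theorem theorem4p1:
  fixes X :: "'x opspace" and Y :: "'y opspace" and B :: "'b cstar"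
    and P :: "('b, 'p) cmodule" and Q :: "('b, 'q) cmodule"
    and i :: "'x \<Rightarrow> 'p" and j :: "'y \<Rightarrow> 'q"
  assumes "shilov_boundary X B P i"
    and "shilov_boundary Y B Q j"
  shows "(\<forall>T \<in> carrier X \<rightarrow> carrier Y.
            (\<exists>R R'. bmodule_map B P Q R \<and> adjoint_maps P Q R R'
                  \<and> R ` i ` carrier X \<subseteq> j ` carrier Y \<and> R' ` j ` carrier Y \<subseteq> i ` carrier X
                  \<and> (\<forall>x\<in>carrier X. R (i x) = j (T x)))
            \<longleftrightarrow>
            (\<exists>S \<in> carrier Y \<rightarrow> carrier X. \<forall>x\<in>carrier X. \<forall>y\<in>carrier Y.
                  rip Q (j (T x)) (j y) = rip P (i x) (i (S y))))
       \<and> linear_subspace (Al X P i Y Q j) (bounded_ops X Y)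
       \<and> closedin (norm_topology (bounded_ops X Y) (bop_norm X Y)) (Al X P i Y Q j)
       \<and> cstar_bimodule (Al_algebra Y Q j) (Al_algebra X P i) (Al_bimodule X P i Y Q j) (bop_norm X Y)
       \<and> (\<forall>T \<in> Al X P i Y Q j. \<forall>R \<in> Al X P i Y Q j. \<forall>S \<in> carrier Y \<rightarrow>\<^sub>E carrier X.
            shilov_adjoint X P i Y Q j T S \<longrightarrow>
            rip (Al_bimodule X P i Y Q j) T R = compose (carrier X) S R)"
proof -
  interpret GP: generating_pair B P X i Q Y j
    using assms by (intro generating_pair.intro shilov_generating_space)
  interpret F: cstar_form_pair B X P i Y Q j by (rule GP.form_pair)
  show ?thesis
  proof (intro conjI F.Al_subspace F.Al_closedin F.cstar_bimodule_Al ballI impI iffI)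
    fix T assume T: "T \<in> carrier X \<rightarrow> carrier Y"
    assume "\<exists>R R'. bmodule_map B P Q R \<and> adjoint_maps P Q R R'
        \<and> R ` i ` carrier X \<subseteq> j ` carrier Y \<and> R' ` j ` carrier Y \<subseteq> i ` carrier X
        \<and> (\<forall>x\<in>carrier X. R (i x) = j (T x))"
    then obtain R R' where R: "adjoint_maps P Q R R'" "R' ` j ` carrier Y \<subseteq> i ` carrier X"
      "\<And>x. x \<in> carrier X \<Longrightarrow> R (i x) = j (T x)" by blast
    from R(2) have "\<forall>y\<in>carrier Y. \<exists>x\<in>carrier X. R' (j y) = i x" by blast
    then obtain S where S: "\<And>y. y \<in> carrier Y \<Longrightarrow> S y \<in> carrier X \<and> R' (j y) = i (S y)"
      by metis
    have "rip Q (j (T x)) (j y) = rip P (i x) (i (S y))" if "x \<in> carrier X" "y \<in> carrier Y" for x y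
      using R(1) R(3)[OF that(1)] S[OF that(2)] GP.X.emb_closed[OF that(1)] GP.Y.emb_closed[OF that(2)]
      unfolding adjoint_maps_def by metis
    with S show "\<exists>S\<in>carrier Y \<rightarrow> carrier X. \<forall>x\<in>carrier X. \<forall>y\<in>carrier Y.
        rip Q (j (T x)) (j y) = rip P (i x) (i (S y))" by blast
  next
    fix T assume T: "T \<in> carrier X \<rightarrow> carrier Y"
    assume "\<exists>S\<in>carrier Y \<rightarrow> carrier X. \<forall>x\<in>carrier X. \<forall>y\<in>carrier Y.
        rip Q (j (T x)) (j y) = rip P (i x) (i (S y))"
    then obtain S where S: "S \<in> carrier Y \<rightarrow> carrier X"
      and adj: "\<forall>x\<in>carrier X. \<forall>y\<in>carrier Y. rip Q (j (T x)) (j y) = rip P (i x) (i (S y))" by blast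
    interpret adjoint_generating_pair B P X i Q Y j T S
      using T S adj by unfold_locales (auto simp: adjoint_pair_def shilov_adjoint_def)
    obtain R R' where R: "bmodule_map B P Q R" "adjoint_maps P Q R R'"
      "\<And>x. x \<in> carrier X \<Longrightarrow> R (i x) = j (T x)" "\<And>y. y \<in> carrier Y \<Longrightarrow> R' (j y) = i (S y)"
      using adjointable_extension by blast
    then show "\<exists>R R'. bmodule_map B P Q R \<and> adjoint_maps P Q R R'
        \<and> R ` i ` carrier X \<subseteq> j ` carrier Y \<and> R' ` j ` carrier Y \<subseteq> i ` carrier X
        \<and> (\<forall>x\<in>carrier X. R (i x) = j (T x))"
      using T S by (intro exI[of _ R] exI[of _ R']) auto
  next
    fix T R S
    assume T: "T \<in> Al X P i Y Q j" and R: "R \<in> Al X P i Y Q j"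
      and S: "S \<in> carrier Y \<rightarrow>\<^sub>E carrier X" "shilov_adjoint X P i Y Q j T S"
    have "adjoint_pair X P i Y Q j T S"
      using T S by (auto simp: adjoint_pair_def Al_def)
    from F.Al_adj_unique[OF this] S(1) have "Al_adj X P i Y Q j T = S"
      by (simp add: PiE_restrict)
    then show "rip (Al_bimodule X P i Y Q j) T R = compose (carrier X) S R" by simp
  qed
qed

end
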